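(* Let $N\ge 2$ be an integer, let $\Omega\subset\mathbb{R}^d$ be a bounded convex domain whose boundary has Lebesgue measure zero, let $\mu$ be Lebesgue measure on $\Omega$ normalized to be a probability, and let $u_1,\dots,u_{N-1}:\Omega\to\mathbb{R}^d$ be bounded measurable vector fields. The following properties are equivalent: (1) The $(N-1)$-tuple $(u_1,\dots,u_{N-1})$ is jointly $N$-monotone a.e., that is, there exists a measure zero set $\Omega_0$ such that $(u_1,\dots,u_{N-1})$ is jointly $N$-monotone on $\Omega\setminus\Omega_0$. (2) The infimum of the Monge-Kantorovich problem $$\inf\Big\{\int_{\Omega^N}\sum_{\ell=1}^{N-1}\langle u_\ell(x_1),x_1-x_{\ell+1}\rangle\,d\pi(x_1,x_2,\dots,x_N):\ \pi\in\mathcal{P}^\mu_{\mathrm{sym}}(\Omega^N)\Big\}$$ is equal to zero, and is therefore attained by the push-forward of $\mu$ by the map $x\mapsto(x,x,\dots,x)$. (3) $(u_1,\dots,u_{N-1})$ is in the polar of $\mathcal{S}_N(\Omega,\mu)$ in the following sense: $$\inf\Big\{\int_\Omega\sum_{\ell=1}^{N-1}\langle u_\ell(x),x-S^\ell x\rangle\,d\mu:\ S\in\mathcal{S}_N(\Omega,\mu)\Big\}=0.$$ (4) The following holds: $$\inf\Big\{\int_\Omega\sum_{\ell=1}^{N-1}|u_\ell(x)-S^\ell x|^2\,d\mu:\ S\in\mathcal{S}_N(\Omega,\mu)\Big\}=\sum_{\ell=1}^{N-1}\int_\Omega|u_\ell(x)-x|^2\,d\mu.$$ (5) There exists an $N$-sub-antisymmetric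 function $H:\Omega^N\to\mathbb{R}$ which is concave in the first variable, jointly convex in the last $(N-1)$ variables, and vanishing on the diagonal (i.e. $H(x,\dots,x)=0$ for all $x\in\Omega$), such that $$(u_1(x),\dots,u_{N-1}(x))=\nabla_{2,\dots,N}H(x,x,\dots,x)\quad\text{for a.e. }x\in\Omega;$$ moreover, $H$ satisfies $H(\mathbf{x})+H_{2,\dots,N}(\mathbf{x})=0$ for all $\mathbf{x}\in\Omega^N$, where $H_{2,\dots,N}$ is the concavification, with respect to the last $(N-1)$ variables, of the function $K(\mathbf{x})=\sum_{i=1}^{N-1}H(\sigma^i(\mathbf{x}))$. (6) The following duality holds: $$\inf\Big\{\int_\Omega L_H(x,u_1(x),\dots,u_{N-1}(x))\,d\mu:\ H\in\mathcal{H}_N(\Omega)\Big\}=\sup\Big\{\int_\Omega\sum_{\ell=1}^{N-1}\langle u_\ell(x),S^\ell x\rangle\,d\mu:\ S\in\mathcal{S}_N(\Omega,\mu)\Big\},$$ and the latter (the supremum) is attained at the identity map.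
   Context: A domain is a nonempty open connected subset of $\mathbb{R}^d$. Jointly $N$-monotone: for a set $A\subset\mathbb{R}^d$ and maps $u_1,\dots,u_{N-1}$ from $A$ into $\mathbb{R}^d$, the tuple $(u_1,\dots,u_{N-1})$ is jointly $N$-monotone on $A$ if for all points $x_1,\dots,x_{2N-1}$ of $A$ such that $x_{N+i}=x_i$ for $1\le i\le N-1$, one has $\sum_{i=1}^N\sum_{\ell=1}^{N-1}\langle u_\ell(x_i),x_i-x_{i+\ell}\rangle\ge 0$. The map $\sigma$ is the cyclic permutation $\sigma(x_1,x_2,\dots,x_{N-1},x_N)=(x_2,x_3,\dots,x_N,x_1)$, with iterates $\sigma^i$. A probability measure $\pi$ on $\Omega^N$ is $\sigma$-invariant if $\int_{\Omega^N}h(x_1,\dots,x_N)\,d\pi=\int_{\Omega^N}h(\sigma(x_1,\dots,x_N))\,d\pi$ for all $h\in L^1(\Omega^N,d\pi)$. $\mathcal{P}^\mu_{\mathrm{sym}}(\Omega^N)$ is the set of $\sigma$-invariant probability measures $\pi$ on $\Omega^N$ whose first marginal is $\mu$. $\mathcal{S}(\Omega,\mu)$ is the set of $\mu$-measure preserving transformations $S:\Omega\to\Omega$, and $\mathcal{S}_N(\Omega,\mu)=\{S\in\mathcal{S}(\Omega,\mu):\ S^N=I\ \mu\text{-a.e.}\}$, where $S^\ell$ is the $\ell$-th iterate of $S$ and $I$ is the identity. A function $H$ on $\Omega^N$ is $N$-sub-antisymmetric if $\sum_{i=0}^{N-1}H(\sigma^i(x_1,\dots,x_N))\le 0$ on $\Omega^N$.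 The class of continuous $N$-antisymmetric Hamiltonians is $\mathcal{H}_N(\Omega)=\{H\in C(\Omega^N):\ \sum_{i=0}^{N-1}H(\sigma^i(x_1,\dots,x_N))=0\text{ on }\Omega^N\}$. $\nabla_{2,\dots,N}H(x,x,\dots,x)$ denotes the gradient of $(y_1,\dots,y_{N-1})\mapsto H(x,y_1,\dots,y_{N-1})$ at $(y_1,\dots,y_{N-1})=(x,\dots,x)$. The concavification of a function $K$ on $\Omega^N$ with respect to the last $(N-1)$ variables is $$(x_1,\dots,x_N)\mapsto\sup\Big\{\sum_{i=1}^n\lambda_iK(x_1,x_2^i,\dots,x_N^i):\ n\in\mathbb{N},\ \lambda_i\ge0,\ \sum_{i=1}^n\lambda_i=1,\ x_j^i\in\Omega,\ \sum_{i=1}^n\lambda_i(x_2^i,\dots,x_N^i)=(x_2,\dots,x_N)\Big\}.$$ For a function $H$ on $\Omega^N$, $x\in\Omega$ and $p_1,\dots,p_{N-1}\in\mathbb{R}^d$, $$L_H(x,p_1,\dots,p_{N-1})=\sup\Big\{\sum_{i=1}^{N-1}\langle p_i,y_i\rangle-H(x,y_1,\dots,y_{N-1}):\ y_i\in\Omega\Big\}.$$ *)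

theory Defs
  imports "HOL-Probability.Probability"
begin

text \<open>
  A point \<open>(x\<^sub>1, \<dots>, x\<^sub>N)\<close> of \<open>\<Omega>\<^sup>N\<close> is an extensional function in
  \<open>{1..N} \<rightarrow>\<^sub>E \<Omega>\<close>; its coordinates outside \<open>{1..N}\<close> are fixed, so the product topology
  on \<open>nat \<Rightarrow> _\<close> restricts to the usual topology of \<open>\<Omega>\<^sup>N\<close>. Tuples of vector fields
  \<open>(u\<^sub>1, \<dots>, u\<^sub>N\<^sub>-\<^sub>1)\<close> are families indexed by \<open>nat\<close> of which only the indices
  \<open>1, \<dots>, N - 1\<close> are used. Infima, suprema and integrals of possibly unbounded quantities
  are taken in \<open>ereal\<close>.
\<close>

abbreviation pow_set :: "'a set \<Rightarrow> nat \<Rightarrow> (nat \<Rightarrow> 'a) set" where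
  "pow_set \<Omega> N \<equiv> {1..N} \<rightarrow>\<^sub>E \<Omega>"

definition diag :: "nat \<Rightarrow> 'a \<Rightarrow> (nat \<Rightarrow> 'a)" where
  "diag N x = (\<lambda>i\<in>{1..N}. x)"

definition cyclic_shift :: "nat \<Rightarrow> (nat \<Rightarrow> 'a) \<Rightarrow> (nat \<Rightarrow> 'a)" where
  "cyclic_shift N x = (\<lambda>i\<in>{1..N}. if i = N then x 1 else x (i + 1))"

definition jointly_monotone_on ::
    "nat \<Rightarrow> 'a::real_inner set \<Rightarrow> (nat \<Rightarrow> 'a \<Rightarrow> 'a) \<Rightarrow> bool" where
  "jointly_monotone_on N A u \<longleftrightarrow>
     (\<forall>x :: nat \<Rightarrow> 'a.
        (\<forall>i\<in>{1..2*N-1}. x i \<in> A) \<longrightarrow> (\<forall>i\<in>{1..N-1}. x (N + i) = x i) \<longrightarrow>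
        (\<Sum>i=1..N. \<Sum>l=1..N-1. u l (x i) \<bullet> (x i - x (i + l))) \<ge> 0)"

definition normalized_lebesgue :: "'a::euclidean_space set \<Rightarrow> 'a measure" where
  "normalized_lebesgue \<Omega> = uniform_measure (lebesgue_on \<Omega>) \<Omega>"

definition shift_invariant :: "nat \<Rightarrow> (nat \<Rightarrow> 'a) measure \<Rightarrow> bool" where
  "shift_invariant N \<pi> \<longleftrightarrow>
     (\<forall>h :: (nat \<Rightarrow> 'a) \<Rightarrow> real. integrable \<pi> h \<longrightarrow>
        (\<integral>x. h x \<partial>\<pi>) = (\<integral>x. h (cyclic_shift N x) \<partial>\<pi>))"

definition sym_plans :: "nat \<Rightarrow> 'a measure \<Rightarrow> (nat \<Rightarrow> 'a) measure set" where
  "sym_plans N \<mu> =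
     {\<pi>. sets \<pi> = sets (Pi\<^sub>M {1..N} (\<lambda>_. \<mu>)) \<and> prob_space \<pi> \<and>
         shift_invariant N \<pi> \<and> distr \<pi> \<mu> (\<lambda>x. x 1) = \<mu>}"

definition measure_preserving_maps :: "'a measure \<Rightarrow> ('a \<Rightarrow> 'a) set" where
  "measure_preserving_maps \<mu> = {S \<in> measurable \<mu> \<mu>. distr \<mu> \<mu> S = \<mu>}"

definition N_periodic_maps :: "nat \<Rightarrow> 'a measure \<Rightarrow> ('a \<Rightarrow> 'a) set" where
  "N_periodic_maps N \<mu> = {S \<in> measure_preserving_maps \<mu>. AE x in \<mu>. (S ^^ N) x = x}"

definition sub_antisymmetric :: "nat \<Rightarrow> 'a set \<Rightarrow> ((nat \<Rightarrow> 'a) \<Rightarrow> real) \<Rightarrow> bool" where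
  "sub_antisymmetric N \<Omega> H \<longleftrightarrow>
     (\<forall>x\<in>pow_set \<Omega> N. (\<Sum>i=0..N-1. H ((cyclic_shift N ^^ i) x)) \<le> 0)"

definition antisym_hamiltonians ::
    "nat \<Rightarrow> 'a::topological_space set \<Rightarrow> ((nat \<Rightarrow> 'a) \<Rightarrow> real) set" where
  "antisym_hamiltonians N \<Omega> =
     {H. continuous_on (pow_set \<Omega> N) H \<and>
         (\<forall>x\<in>pow_set \<Omega> N. (\<Sum>i=0..N-1. H ((cyclic_shift N ^^ i) x)) = 0)}"

definition concave_first :: "nat \<Rightarrow> 'a::real_vector set \<Rightarrow> ((nat \<Rightarrow> 'a) \<Rightarrow> real) \<Rightarrow> bool" where
  "concave_first N \<Omega> H \<longleftrightarrow> (\<forall>x\<in>pow_set \<Omega> N. concave_on \<Omega> (\<lambda>z. H (x(1 := z))))"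

definition convex_last :: "nat \<Rightarrow> 'a::real_vector set \<Rightarrow> ((nat \<Rightarrow> 'a) \<Rightarrow> real) \<Rightarrow> bool" where
  "convex_last N \<Omega> H \<longleftrightarrow>
     (\<forall>x\<in>pow_set \<Omega> N. \<forall>y\<in>pow_set \<Omega> N. \<forall>t\<in>{0..1}. x 1 = y 1 \<longrightarrow>
        H (\<lambda>i\<in>{1..N}. (1 - t) *\<^sub>R x i + t *\<^sub>R y i) \<le> (1 - t) * H x + t * H y)"

text \<open>
  The Frechet gradient at the diagonal point \<open>(x, \<dots>, x)\<close> of
  \<open>(y\<^sub>1, \<dots>, y\<^sub>N\<^sub>-\<^sub>1) \<mapsto> H (x, y\<^sub>1, \<dots>, y\<^sub>N\<^sub>-\<^sub>1)\<close> is \<open>(p\<^sub>1, \<dots>, p\<^sub>N\<^sub>-\<^sub>1)\<close>. Since the number of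
  variables is not fixed by a type, the library derivative is written out with the Euclidean
  norm of \<open>(y\<^sub>1 - x, \<dots>, y\<^sub>N\<^sub>-\<^sub>1 - x)\<close>; the variable \<open>y\<^sub>l\<close> is coordinate \<open>l + 1\<close> of the tuple.
\<close>

definition has_gradient_last ::
    "nat \<Rightarrow> 'a::real_inner set \<Rightarrow> ((nat \<Rightarrow> 'a) \<Rightarrow> real) \<Rightarrow> 'a \<Rightarrow> (nat \<Rightarrow> 'a) \<Rightarrow> bool" where
  "has_gradient_last N \<Omega> H x p \<longleftrightarrow>
     (\<forall>\<epsilon>>0. \<exists>\<delta>>0. \<forall>y\<in>pow_set \<Omega> N.
        y 1 = x \<and> L2_set (\<lambda>l. norm (y (l + 1) - x)) {1..N-1} < \<delta> \<longrightarrow>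
        \<bar>H y - H (diag N x) - (\<Sum>l=1..N-1. p l \<bullet> (y (l + 1) - x))\<bar>
          \<le> \<epsilon> * L2_set (\<lambda>l. norm (y (l + 1) - x)) {1..N-1})"

text \<open>For tuples indexed by a finite type, this is the library gradient.\<close>

lemma has_gradient_last_iff_GDERIV:
  fixes \<Omega> :: "'a::euclidean_space set" and e :: "'k::finite \<Rightarrow> nat"
  assumes e: "bij_betw e UNIV {1..N-1}" and "N \<ge> 2" and "open \<Omega>" and x: "x \<in> \<Omega>"
  shows "has_gradient_last N \<Omega> H x p \<longleftrightarrow>
    (GDERIV (\<lambda>y :: 'a ^ 'k. H (\<lambda>i\<in>{1..N}. if i = 1 then x else y $ inv e (i - 1))) (\<chi> k. x)
       :> (\<chi> k. p (e k)))"
proof -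
  define T where "T y = (\<lambda>i\<in>{1..N}. if i = 1 then x else (y :: 'a ^ 'k) $ inv e (i - 1))" for y
  define a :: "'a ^ 'k" where "a = (\<chi> k. x)"
  define D :: "'a ^ 'k" where "D = (\<chi> k. p (e k))"
  have inj: "inj e" using e by (simp add: bij_betw_def)
  have e_in: "e k \<in> {1..N-1}" for k using e by (auto simp: bij_betw_def)
  have T_e: "T y (e k + 1) = y $ k" for y k
    using e_in[of k] inj by (auto simp: T_def)
  have T_1: "T y 1 = x" for y using \<open>N \<ge> 2\<close> by (simp add: T_def)
  have T_a: "T a = diag N x" by (auto simp: T_def a_def diag_def fun_eq_iff)
  have nrm: "L2_set (\<lambda>l. norm (T y (l + 1) - x)) {1..N-1} = norm (y - a)" for y
    unfolding L2_set_def norm_vec_def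
    by (subst sum.reindex_bij_betw[OF e, symmetric]) (simp add: T_e a_def del: One_nat_def add_Suc_right Nat.add_0_right)
  have inn: "(\<Sum>l=1..N-1. p l \<bullet> (T y (l + 1) - x)) = (y - a) \<bullet> D" for y
    unfolding inner_vec_def
    by (subst sum.reindex_bij_betw[OF e, symmetric])
       (simp add: T_e a_def D_def inner_commute del: One_nat_def add_Suc_right Nat.add_0_right)
  obtain r where r: "r > 0" "ball x r \<subseteq> \<Omega>"
    using \<open>open \<Omega>\<close> x by (auto simp: open_contains_ball)
  have T_in: "T y \<in> pow_set \<Omega> N" if "norm (y - a) < r" for y
  proof -
    have "y $ k \<in> \<Omega>" for k
    proof -
      have "norm (y $ k - x) \<le> norm (y - a)"
        using Finite_Cartesian_Product.norm_nth_le[of "y - a" k] by (simp add: a_def)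
      then have "y $ k \<in> ball x r" using that by (simp add: dist_norm norm_minus_commute)
      then show ?thesis using r by blast
    qed
    then show ?thesis using x by (auto simp: T_def)
  qed
  have T_surj: "\<exists>y. T y = z" if z: "z \<in> pow_set \<Omega> N" "z 1 = x" for z
  proof
    show "T (\<chi> k. z (e k + 1)) = z"
    proof
      fix i
      show "T (\<chi> k. z (e k + 1)) i = z i"
      proof (cases "i \<in> {1..N} \<and> i \<noteq> 1")
        case True
        then have "i - 1 \<in> range e" using e by (auto simp: bij_betw_def)
        then have "e (inv e (i - 1)) = i - 1" by (rule f_inv_into_f)
        then show ?thesis using True by (simp add: T_def)
      next
        case False
        then show ?thesis using z by (auto simp: T_def PiE_def extensional_def)
      qed
    qed
  qed
  have "has_gradient_last N \<Omega> H x p \<longleftrightarrow>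
     (\<forall>\<epsilon>>0. \<exists>\<delta>>0. \<forall>y. norm (y - a) < \<delta> \<longrightarrow>
        norm (H (T y) - H (T a) - (y - a) \<bullet> D) \<le> \<epsilon> * norm (y - a))" (is "_ \<longleftrightarrow> ?R")
  proof
    assume L: "has_gradient_last N \<Omega> H x p"
    show ?R
    proof (intro allI impI)
      fix \<epsilon> :: real assume "\<epsilon> > 0"
      then obtain \<delta> where \<delta>: "\<delta> > 0" "\<And>y. y \<in> pow_set \<Omega> N \<Longrightarrow>
        y 1 = x \<and> L2_set (\<lambda>l. norm (y (l + 1) - x)) {1..N-1} < \<delta> \<Longrightarrow>
        \<bar>H y - H (diag N x) - (\<Sum>l=1..N-1. p l \<bullet> (y (l + 1) - x))\<bar>
          \<le> \<epsilon> * L2_set (\<lambda>l. norm (y (l + 1) - x)) {1..N-1}"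
        using L unfolding has_gradient_last_def by blast
      have "norm (H (T y) - H (T a) - (y - a) \<bullet> D) \<le> \<epsilon> * norm (y - a)"
        if "norm (y - a) < min \<delta> r" for y
        using \<delta>(2)[of "T y", unfolded nrm inn] T_in[of y] T_1 T_a that by simp
      then show "\<exists>\<delta>>0. \<forall>y. norm (y - a) < \<delta> \<longrightarrow>
        norm (H (T y) - H (T a) - (y - a) \<bullet> D) \<le> \<epsilon> * norm (y - a)"
        using \<open>\<delta> > 0\<close> \<open>r > 0\<close> by (intro exI[of _ "min \<delta> r"]) auto
    qed
  next
    assume R: ?R
    show "has_gradient_last N \<Omega> H x p"
      unfolding has_gradient_last_def
    proof (intro allI impI)
      fix \<epsilon> :: real assume "\<epsilon> > 0"
      then obtain \<delta> where \<delta>: "\<delta> > 0" "\<And>y. norm (y - a) < \<delta> \<Longrightarrow>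
        norm (H (T y) - H (T a) - (y - a) \<bullet> D) \<le> \<epsilon> * norm (y - a)"
        using R by blast
      have "\<bar>H z - H (diag N x) - (\<Sum>l=1..N-1. p l \<bullet> (z (l + 1) - x))\<bar>
          \<le> \<epsilon> * L2_set (\<lambda>l. norm (z (l + 1) - x)) {1..N-1}"
        if z: "z \<in> pow_set \<Omega> N" "z 1 = x"
          "L2_set (\<lambda>l. norm (z (l + 1) - x)) {1..N-1} < \<delta>" for z
      proof -
        obtain y where y: "z = T y" using T_surj z by blast
        show ?thesis using z(3) \<delta>(2)[of y] unfolding y nrm inn T_a by simp
      qed
      then show "\<exists>\<delta>>0. \<forall>y\<in>pow_set \<Omega> N.
        y 1 = x \<and> L2_set (\<lambda>l. norm (y (l + 1) - x)) {1..N-1} < \<delta> \<longrightarrow>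
        \<bar>H y - H (diag N x) - (\<Sum>l=1..N-1. p l \<bullet> (y (l + 1) - x))\<bar>
          \<le> \<epsilon> * L2_set (\<lambda>l. norm (y (l + 1) - x)) {1..N-1}"
        using \<open>\<delta> > 0\<close> by blast
    qed
  qed
  also have "\<dots> \<longleftrightarrow> (GDERIV (\<lambda>y. H (T y)) a :> D)"
    unfolding gderiv_def has_derivative_at_alt
    using bounded_linear_inner_left[of D] by simp
  finally show ?thesis unfolding T_def a_def D_def .
qed

definition concavification_last ::
    "nat \<Rightarrow> 'a::real_vector set \<Rightarrow> ((nat \<Rightarrow> 'a) \<Rightarrow> real) \<Rightarrow> (nat \<Rightarrow> 'a) \<Rightarrow> ereal" where
  "concavification_last N \<Omega> K x =
     Sup {ereal (\<Sum>i=1..n. c i * K (Y i)) | (n::nat) (c :: nat \<Rightarrow> real) (Y :: nat \<Rightarrow> nat \<Rightarrow> 'a).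
            (\<forall>i\<in>{1..n}. c i \<ge> 0 \<and> Y i \<in> pow_set \<Omega> N \<and> Y i 1 = x 1) \<and>
            (\<Sum>i=1..n. c i) = 1 \<and>
            (\<forall>j\<in>{2..N}. (\<Sum>i=1..n. c i *\<^sub>R Y i j) = x j)}"

text \<open>The tuple \<open>(x, y\<^sub>1, \<dots>, y\<^sub>N\<^sub>-\<^sub>1)\<close> is a \<open>y \<in> \<Omega>\<^sup>N\<close> with first coordinate \<open>x\<close>.\<close>

definition legendre_last ::
    "nat \<Rightarrow> 'a::real_inner set \<Rightarrow> ((nat \<Rightarrow> 'a) \<Rightarrow> real) \<Rightarrow> 'a \<Rightarrow> (nat \<Rightarrow> 'a) \<Rightarrow> ereal" where
  "legendre_last N \<Omega> H x p =
     (SUP y\<in>{y \<in> pow_set \<Omega> N. y 1 = x}. ereal ((\<Sum>i=1..N-1. p i \<bullet> y (i + 1)) - H y))"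

text \<open>
  Integral of an extended-real function as integral of the positive part minus integral of the
  negative part (\<open>e2ennreal\<close> sends negative numbers to 0). It is needed because a continuous
  \<open>H\<close> on the open set \<open>\<Omega>\<^sup>N\<close> may be unbounded; for antisymmetric \<open>H\<close> the integrand
  \<open>legendre_last N \<Omega> H x (u x)\<close> is bounded below, as \<open>H\<close> vanishes on the diagonal.
\<close>

definition ereal_integral :: "'a measure \<Rightarrow> ('a \<Rightarrow> ereal) \<Rightarrow> ereal" where
  "ereal_integral M f =
     enn2ereal (\<integral>\<^sup>+x. e2ennreal (f x) \<partial>M) - enn2ereal (\<integral>\<^sup>+x. e2ennreal (- f x) \<partial>M)"

end

theory Submission
  imports Defs
begin

text \<open>
  Put \<open>F\<^sub>u(x\<^sub>1, \<dots>, x\<^sub>N) = \<Sum>\<^sub>l \<langle>u\<^sub>l(x\<^sub>1), x\<^sub>l\<^sub>+\<^sub>1 - x\<^sub>1\<rangle>\<close> (\<open>field_form\<close>). Joint \<open>N\<close>-monotonicity of \<open>u\<close> on a set \<open>A\<close>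
  says that the sum of \<open>F\<^sub>u\<close> over the \<open>N\<close> cyclic shifts of any point of \<open>A\<^sup>N\<close> is nonpositive, that is,
  \<open>F\<^sub>u\<close> is sub-antisymmetric on \<open>A\<close>. The transport costs are integrals of \<open>- F\<^sub>u\<close>. The saddle
  function and the Hamiltonian that attains the last duality dominate \<open>F\<^sub>u\<close> for almost every first
  variable. The hub of the equivalences is the statement that the polar integral
  \<open>\<integral> \<Sum>\<^sub>l \<langle>u\<^sub>l(x), x - S\<^sup>l x\<rangle> d\<mu>\<close> is nonnegative for every periodic map \<open>S\<close>.

  \<^emph>\<open>From monotonicity to transport.\<close> A shift-invariant plan gives \<open>F\<^sub>u\<close> and all its shifted copies the
  same integral, so \<open>N \<integral> F\<^sub>u\<close> is the integral of a nonpositive function. A periodic map \<open>S\<close> induces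
  the plan carried by its orbits \<open>(x, S x, \<dots>, S\<^sup>N\<^sup>-\<^sup>1 x)\<close>; hence the Monge-Kantorovich problem controls
  the polar integrals. Since \<open>S\<close> preserves \<open>\<integral> |x|\<^sup>2 d\<mu>\<close>, expanding squares turns the quadratic problem
  into the polar one.

  \<^emph>\<open>From the polar condition to monotonicity\<close> (\<open>monotone_if_polar\<close>). Rotating \<open>N\<close> small congruent cubes
  with corners at distinct points \<open>x\<^sub>1, \<dots>, x\<^sub>N\<close> is a periodic map. Its polar integral is, up to a
  positive factor, the negated cyclic sum of \<open>F\<close> for the averages of \<open>u\<close> over the cubes, so Lebesgue's
  differentiation theorem yields the inequality at almost all distinct points. Coinciding points
  are limits of distinct ones along which \<open>u\<close> converges, because a measurable map is
  approximately continuous almost everywhere.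

  \<^emph>\<open>The saddle function\<close> (\<open>self_dual_saddle\<close>, \<open>saddle_hamiltonian\<close>). Cluster values extend \<open>u\<close> to a tuple
  \<open>w\<close> that is jointly monotone on all of \<open>\<Omega>\<close>, so that \<open>F\<^sub>w\<close> is sub-antisymmetric, and affine in its last
  variables. For a sub-antisymmetric \<open>H\<close> that is convex in the last variables, let \<open>K\<close> be the sum of its
  shifts \<open>H \<circ> \<sigma>\<^sup>i\<close>, \<open>1 \<le> i < N\<close>, and let \<open>- G\<close> be the concavification of \<open>K\<close>. Then \<open>H \<le> G \<le> - K\<close>, and
  \<open>((N - 1) H + G) / N\<close> is again sub-antisymmetric, because \<open>K\<close> and \<open>(N - 1) H\<close> have the same cyclic sum.
  Iterating this from \<open>F\<^sub>w\<close> gives a bounded increasing sequence, and its limit satisfies \<open>H = G\<close>.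
  Concavity in the first variable is then automatic: that variable is one of the last variables of
  each shift in \<open>K\<close>.

  \<^emph>\<open>The gradient\<close> (\<open>has_gradient_last_at_approximate_continuity\<close>). The gap \<open>H - F\<^sub>w\<close> lies between \<open>0\<close> and the
  negated cyclic sum of \<open>F\<^sub>w\<close>. Cyclic sums vanish for constant fields, so near the diagonal point of
  \<open>x\<close> the gap is \<open>o(|y - x|)\<close> as long as all coordinates of \<open>y\<close> lie in a set on which \<open>u\<close> is close
  to \<open>u(x)\<close>. At a point of approximate continuity the convex hull of that set contains small
  balls around \<open>x\<close>, and convexity of the gap spreads the bound to all \<open>y\<close>. Conversely, if \<open>u\<close> is
  the gradient of a convex function that vanishes on the diagonal, then \<open>F\<^sub>u \<le> H\<close> for almost every first
  variable, and \<open>F\<^sub>u\<close> inherits sub-antisymmetry from \<open>H\<close>.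

  \<^emph>\<open>Duality\<close> (\<open>legendre_duality\<close>). Subtracting from the saddle function its mean over the shifts gives an
  antisymmetric Hamiltonian that lies above \<open>H\<close>. It is continuous because \<open>H\<close> is bounded and is
  convex or concave in each variable. For almost every \<open>x\<close>, its Legendre transform at \<open>(x, u(x))\<close> is
  \<open>\<Sum>\<^sub>l \<langle>u\<^sub>l(x), x\<rangle>\<close>, a value below which no Hamiltonian vanishing on the diagonal can go.
\<close>

section \<open>Cyclic shifts and cyclic sums\<close>

definition cyclic_sum :: "nat \<Rightarrow> ((nat \<Rightarrow> 'a) \<Rightarrow> real) \<Rightarrow> (nat \<Rightarrow> 'a) \<Rightarrow> real" where
  "cyclic_sum N H x = (\<Sum>i=0..N-1. H ((cyclic_shift N ^^ i) x))"

text \<open>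
  The terms of the cyclic sum other than \<open>H\<close> itself; this is the function whose concavification
  the saddle function has to cancel.
\<close>

definition proper_cyclic_sum :: "nat \<Rightarrow> ((nat \<Rightarrow> 'a) \<Rightarrow> real) \<Rightarrow> (nat \<Rightarrow> 'a) \<Rightarrow> real" where
  "proper_cyclic_sum N H x = (\<Sum>i=1..N-1. H ((cyclic_shift N ^^ i) x))"

definition field_form ::
    "nat \<Rightarrow> (nat \<Rightarrow> 'a \<Rightarrow> 'a) \<Rightarrow> (nat \<Rightarrow> 'a::real_inner) \<Rightarrow> real" where
  "field_form N u x = (\<Sum>l=1..N-1. u l (x 1) \<bullet> (x (l + 1) - x 1))"

lemma cyclic_sum_lessThan: "N \<ge> 1 \<Longrightarrow> cyclic_sum N H x = (\<Sum>i<N. H ((cyclic_shift N ^^ i) x))"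
  unfolding cyclic_sum_def by (rule sum.cong) auto

lemma cyclic_shift_in_pow_set: "x \<in> pow_set A N \<Longrightarrow> cyclic_shift N x \<in> pow_set A N"
  by (auto simp: cyclic_shift_def PiE_def Pi_def)

lemma cyclic_shift_pow_in_pow_set: "x \<in> pow_set A N \<Longrightarrow> (cyclic_shift N ^^ i) x \<in> pow_set A N"
  by (induction i) (simp_all add: cyclic_shift_in_pow_set del: One_nat_def)

lemma cyclic_shift_pow_apply:
  assumes "x \<in> pow_set A N" "j \<in> {1..N}"
  shows "(cyclic_shift N ^^ i) x j = x ((j + i - 1) mod N + 1)"
  using assms(2)
proof (induction i arbitrary: j)
  case 0
  then show ?case by (cases j) auto
next
  case (Suc i)
  then have "N \<ge> 1" by auto
  show ?case
  proof (cases "j = N")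
    case True
    have "(N + Suc i - 1) mod N = i mod N" by simp
    moreover have "(1 + i - 1) mod N = i mod N" by simp
    ultimately show ?thesis using True \<open>N \<ge> 1\<close> Suc.IH[of 1] Suc.prems
      by (simp add: cyclic_shift_def)
  next
    case False
    then show ?thesis using Suc.IH[of "j + 1"] Suc.prems
      by (simp add: cyclic_shift_def)
  qed
qed

lemma cyclic_shift_pow_period:
  assumes "x \<in> pow_set A N"
  shows "(cyclic_shift N ^^ N) x = x"
proof
  fix j
  show "(cyclic_shift N ^^ N) x j = x j"
  proof (cases "j \<in> {1..N}")
    case True
    then have "(j + N - 1) mod N = j - 1" by (cases j) auto
    then show ?thesis using cyclic_shift_pow_apply[OF assms True, of N] True by simp
  next
    case False
    then show ?thesis using cyclic_shift_pow_in_pow_set[OF assms, of N] assms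
      by (metis PiE_arb)
  qed
qed

lemma cyclic_sum_split:
  assumes "N \<ge> 1"
  shows "cyclic_sum N H x = H x + proper_cyclic_sum N H x"
  unfolding cyclic_sum_def proper_cyclic_sum_def
  by (subst sum.atLeast_Suc_atMost) auto

text \<open>
  In commutative monoids, because it serves measures of blocks as well as sums of vectors.
\<close>

lemma sum_mod_shift:
  fixes g :: "nat \<Rightarrow> 'b::comm_monoid_add"
  shows "(\<Sum>j<N. g ((j + 1) mod N)) = (\<Sum>j<N. g j)"
proof (cases N)
  case (Suc M)
  have "(\<Sum>j<N. g ((j + 1) mod N)) = (\<Sum>j<M. g ((j + 1) mod N)) + g ((M + 1) mod N)"
    by (simp add: Suc)
  also have "\<dots> = (\<Sum>j<M. g (Suc j)) + g 0" by (simp add: Suc)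
  also have "\<dots> = (\<Sum>j<N. g j)" unfolding Suc sum.lessThan_Suc_shift by (simp add: add.commute)
  finally show ?thesis .
qed simp

lemma cyclic_sum_shift:
  assumes "x \<in> pow_set A N" "N \<ge> 1"
  shows "cyclic_sum N H (cyclic_shift N x) = cyclic_sum N H x"
proof -
  define g where "g i = H ((cyclic_shift N ^^ i) x)" for i
  have "cyclic_sum N H (cyclic_shift N x) = (\<Sum>i<N. g (Suc i))"
    using assms(2) by (simp add: cyclic_sum_lessThan g_def funpow_Suc_right del: funpow.simps)
  also have "\<dots> = (\<Sum>i<Suc N. g i) - g 0" by (subst sum.lessThan_Suc_shift) simp
  also have "\<dots> = (\<Sum>i<N. g i)"
    using cyclic_shift_pow_period[OF assms(1)] by (simp add: g_def)
  finally show ?thesis using assms(2) by (simp add: g_def cyclic_sum_lessThan)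
qed

lemma cyclic_sum_shift_pow:
  assumes "x \<in> pow_set A N" "N \<ge> 1"
  shows "cyclic_sum N H ((cyclic_shift N ^^ i) x) = cyclic_sum N H x"
proof (induction i)
  case (Suc i)
  then show ?case
    using cyclic_sum_shift[OF cyclic_shift_pow_in_pow_set[OF assms(1)] assms(2), of H i] by simp
qed simp

lemma cyclic_sum_cyclic_sum:
  assumes "x \<in> pow_set A N" "N \<ge> 1"
  shows "cyclic_sum N (cyclic_sum N H) x = N * cyclic_sum N H x"
  unfolding cyclic_sum_def[of N "cyclic_sum N H"]
  using cyclic_sum_shift_pow[OF assms] assms(2) by (simp add: of_nat_diff)

lemma cyclic_sum_linear:
  "cyclic_sum N (\<lambda>x. a * H x + b * G x) x = a * cyclic_sum N H x + b * cyclic_sum N G x"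
  by (simp add: cyclic_sum_def sum.distrib sum_distrib_left)

text \<open>
  Every shift of \<open>H\<close> occurs \<open>N - 1\<close> times when the proper cyclic sum is summed over all shifts.
  This count makes the averaging step of the saddle construction preserve sub-antisymmetry.
\<close>

lemma cyclic_sum_proper_cyclic_sum:
  assumes "x \<in> pow_set A N" "N \<ge> 1"
  shows "cyclic_sum N (proper_cyclic_sum N H) x = (real N - 1) * cyclic_sum N H x"
proof -
  have "proper_cyclic_sum N H = (\<lambda>x. 1 * cyclic_sum N H x + (-1) * H x)"
    by (auto simp: fun_eq_iff cyclic_sum_split[OF assms(2)])
  then show ?thesis
    using cyclic_sum_linear[of N 1 "cyclic_sum N H" "-1" H x] cyclic_sum_cyclic_sum[OF assms]
    by (simp add: algebra_simps)
qed

lemma sub_antisymmetric_iff: "sub_antisymmetric N A H \<longleftrightarrow> (\<forall>x\<in>pow_set A N. cyclic_sum N H x \<le> 0)"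
  by (simp add: sub_antisymmetric_def cyclic_sum_def)

lemma cyclic_sum_field_form:
  assumes "x \<in> pow_set A N" "N \<ge> 1"
  shows "cyclic_sum N (field_form N u) x =
    (\<Sum>i<N. \<Sum>l=1..N-1. u l (x (i + 1)) \<bullet> (x ((i + l) mod N + 1) - x (i + 1)))"
proof -
  have "field_form N u ((cyclic_shift N ^^ i) x) =
      (\<Sum>l=1..N-1. u l (x (i + 1)) \<bullet> (x ((i + l) mod N + 1) - x (i + 1)))" if "i < N" for i
    unfolding field_form_def using that assms(2)
    by (intro sum.cong refl)
       (auto simp: cyclic_shift_pow_apply[OF assms(1)] add.commute)
  then show ?thesis using assms(2) by (simp add: cyclic_sum_lessThan)
qed

lemma sum_periodic_sequence:
  assumes x: "x \<in> pow_set A N" and N: "N \<ge> 1"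
    and X: "\<And>i l. i < N \<Longrightarrow> l < N \<Longrightarrow> X (i + 1 + l) = x ((i + l) mod N + 1)"
  shows "(\<Sum>i=1..N. \<Sum>l=1..N-1. u l (X i) \<bullet> (X i - X (i + l))) = - cyclic_sum N (field_form N u) x"
proof -
  have "(\<Sum>i=1..N. \<Sum>l=1..N-1. u l (X i) \<bullet> (X i - X (i + l)))
     = (\<Sum>i<N. \<Sum>l=1..N-1. u l (X (i+1)) \<bullet> (X (i+1) - X (i + 1 + l)))"
    by (rule sum.reindex_bij_witness[of _ "\<lambda>i. i + 1" "\<lambda>i. i - 1"]) auto
  also have "\<dots> = (\<Sum>i<N. \<Sum>l=1..N-1. - (u l (x (i+1)) \<bullet> (x ((i + l) mod N + 1) - x (i + 1))))"
  proof (intro sum.cong refl)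
    fix i l assume "i \<in> {..<N}" "l \<in> {1..N-1}"
    then have "X (i + 1 + l) = x ((i + l) mod N + 1)" "X (i + 1) = x (i + 1)"
      using X[of i l] X[of i 0] by auto
    then show "u l (X (i+1)) \<bullet> (X (i+1) - X (i + 1 + l)) =
       - (u l (x (i+1)) \<bullet> (x ((i + l) mod N + 1) - x (i + 1)))"
      by (simp add: inner_diff_right)
  qed
  also have "\<dots> = - cyclic_sum N (field_form N u) x"
    by (simp add: cyclic_sum_field_form[OF x N] sum_negf)
  finally show ?thesis .
qed

text \<open>
  The \<open>2 N - 1\<close> points with \<open>x\<^sub>N\<^sub>+\<^sub>i = x\<^sub>i\<close> are one point of \<open>A\<^sup>N\<close> read periodically.
\<close>

lemma jointly_monotone_on_iff_sub_antisymmetric: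
  assumes "N \<ge> 1"
  shows "jointly_monotone_on N A u \<longleftrightarrow> sub_antisymmetric N A (field_form N u)"
proof
  assume L: "jointly_monotone_on N A u"
  show "sub_antisymmetric N A (field_form N u)"
    unfolding sub_antisymmetric_iff
  proof
    fix x :: "nat \<Rightarrow> 'a" assume x: "x \<in> pow_set A N"
    define X where "X k = x ((k - 1) mod N + 1)" for k
    have "\<forall>i\<in>{1..2*N-1}. X i \<in> A" using x assms by (auto simp: X_def PiE_def Pi_def Suc_le_eq)
    moreover have "\<forall>i\<in>{1..N-1}. X (N + i) = X i"
    proof
      fix i assume "i \<in> {1..N-1}"
      then have "N + i - 1 = N + (i - 1)" by auto
      then show "X (N + i) = X i" by (simp add: X_def)
    qed
    ultimately have "(\<Sum>i=1..N. \<Sum>l=1..N-1. u l (X i) \<bullet> (X i - X (i + l))) \<ge> 0"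
      using L by (auto simp: jointly_monotone_on_def)
    then show "cyclic_sum N (field_form N u) x \<le> 0"
      by (subst (asm) sum_periodic_sequence[OF x assms]) (auto simp: X_def)
  qed
next
  assume R: "sub_antisymmetric N A (field_form N u)"
  show "jointly_monotone_on N A u"
    unfolding jointly_monotone_on_def
  proof (intro allI impI)
    fix X :: "nat \<Rightarrow> 'a"
    assume X: "\<forall>i\<in>{1..2 * N - 1}. X i \<in> A" and per: "\<forall>i\<in>{1..N - 1}. X (N + i) = X i"
    define x where "x = (\<lambda>i\<in>{1..N}. X i)"
    have x: "x \<in> pow_set A N" using X assms by (auto simp: x_def)
    have Xx: "X (i + 1 + l) = x ((i + l) mod N + 1)" if "i < N" "l < N" for i l
    proof (cases "i + l < N")
      case False
      then have "(i + l) mod N = i + l - N" using that by (simp add: mod_if)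
      moreover have "i + 1 + l = N + (i + l - N + 1)" using False by simp
      moreover have "i + l - N + 1 \<in> {1..N - 1}" using False that by auto
      ultimately have "X (i + 1 + l) = X (i + l - N + 1)" using per by metis
      then show ?thesis using \<open>(i + l) mod N = i + l - N\<close> that False by (auto simp: x_def)
    qed (auto simp: x_def)
    have "(\<Sum>i=1..N. \<Sum>l=1..N-1. u l (X i) \<bullet> (X i - X (i + l))) = - cyclic_sum N (field_form N u) x"
      by (rule sum_periodic_sequence[OF x assms]) (rule Xx)
    also have "\<dots> \<ge> 0" using R x by (simp add: sub_antisymmetric_iff)
    finally show "(\<Sum>i=1..N. \<Sum>l=1..N-1. u l (X i) \<bullet> (X i - X (i + l))) \<ge> 0" .
  qed
qed

lemma field_form_diag: "N \<ge> 1 \<Longrightarrow> field_form N u (diag N x) = 0"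
  by (auto simp: field_form_def diag_def intro!: sum.neutral)

lemma diag_in_pow_set: "x \<in> A \<Longrightarrow> diag N x \<in> pow_set A N"
  by (auto simp: diag_def)

lemma cyclic_shift_pow_diag: "(cyclic_shift N ^^ i) (diag N x) = diag N x"
  by (induction i) (auto simp: cyclic_shift_def diag_def fun_eq_iff)

section \<open>Concavification and the self-dual saddle function\<close>

lemma restrict_pow_set: "x \<in> pow_set A N \<Longrightarrow> (\<lambda>j\<in>{1..N}. x j) = x"
  by (rule PiE_restrict)

lemma convex_comb_in_pow_set:
  assumes "convex \<Omega>" "x \<in> pow_set \<Omega> N" "y \<in> pow_set \<Omega> N" "t \<in> {0..1}"
  shows "(\<lambda>i\<in>{1..N}. (1 - t) *\<^sub>R x i + t *\<^sub>R y i) \<in> pow_set \<Omega> N"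
  using assms by (auto simp: PiE_def Pi_def intro!: convexD)

lemma convex_last_Jensen:
  fixes \<Omega> :: "'a::real_vector set"
  assumes "convex \<Omega>" "convex_last N \<Omega> H" "N \<ge> 1" "finite I" "I \<noteq> {}"
    and "\<And>i. i \<in> I \<Longrightarrow> c i \<ge> 0" "sum c I = 1"
    and "\<And>i. i \<in> I \<Longrightarrow> Y i \<in> pow_set \<Omega> N" "\<And>i. i \<in> I \<Longrightarrow> Y i 1 = a"
  shows "H (\<lambda>j\<in>{1..N}. \<Sum>i\<in>I. c i *\<^sub>R Y i j) \<le> (\<Sum>i\<in>I. c i * H (Y i))"
  using assms(4-)
proof (induction I arbitrary: c rule: finite_ne_induct)
  case (singleton i)
  then show ?case using restrict_pow_set[of "Y i" N \<Omega>] by simp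
next
  case (insert i F)
  show ?case
  proof (cases "c i = 1")
    case True
    have "sum c F = 0" using insert.prems(2) insert.hyps True by simp
    then have z: "\<And>k. k \<in> F \<Longrightarrow> c k = 0"
      using insert.hyps(1) insert.prems(1) by (subst (asm) sum_nonneg_eq_0_iff) auto
    have "(\<lambda>j\<in>{1..N}. \<Sum>i\<in>insert i F. c i *\<^sub>R Y i j) = Y i"
      using insert.hyps True z restrict_pow_set[of "Y i" N \<Omega>] insert.prems(3)[of i] by simp
    moreover have "(\<Sum>i\<in>insert i F. c i * H (Y i)) = H (Y i)"
      using insert.hyps True z by simp
    ultimately show ?thesis by simp
  next
    case False
    define s where "s = sum c F"
    have cs: "c i = 1 - s" using insert.prems(2) insert.hyps by (simp add: s_def)
    have "s \<ge> 0" unfolding s_def using insert.prems(1) by (intro sum_nonneg) auto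
    then have s: "s > 0" "s \<le> 1" using False cs insert.prems(1)[of i] by auto
    define d where "d k = c k / s" for k
    have d: "\<And>k. k \<in> F \<Longrightarrow> d k \<ge> 0" "sum d F = 1"
      using insert.prems(1) s by (auto simp: d_def s_def sum_divide_distrib[symmetric])
    define z where "z = (\<lambda>j\<in>{1..N}. \<Sum>k\<in>F. d k *\<^sub>R Y k j)"
    have Hz: "H z \<le> (\<Sum>k\<in>F. d k * H (Y k))"
      unfolding z_def using d insert.prems by (intro insert.IH) auto
    have z: "z \<in> pow_set \<Omega> N"
      unfolding z_def using d insert.prems(3) insert.hyps(1)
      by (auto intro!: convex_sum[OF _ \<open>convex \<Omega>\<close>])
    have z1: "z 1 = Y i 1"
      using d(2) insert.prems(4) \<open>N \<ge> 1\<close> by (simp add: z_def scaleR_left.sum[symmetric])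
    have eq: "(\<lambda>j\<in>{1..N}. \<Sum>k\<in>insert i F. c k *\<^sub>R Y k j) = (\<lambda>j\<in>{1..N}. (1 - s) *\<^sub>R Y i j + s *\<^sub>R z j)"
      using insert.hyps s by (auto simp: z_def d_def cs scaleR_sum_right fun_eq_iff)
    have "H (\<lambda>j\<in>{1..N}. (1 - s) *\<^sub>R Y i j + s *\<^sub>R z j) \<le> (1 - s) * H (Y i) + s * H z"
      using assms(2) z z1 insert.prems(3)[of i] s unfolding convex_last_def by auto
    also have "\<dots> \<le> (1 - s) * H (Y i) + s * (\<Sum>k\<in>F. d k * H (Y k))"
      using Hz s by (intro add_left_mono mult_left_mono) auto
    also have "\<dots> = (\<Sum>k\<in>insert i F. c k * H (Y k))"
      using insert.hyps s by (simp add: cs d_def sum_distrib_left)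
    finally show ?thesis by (simp only: eq)
  qed
qed

definition last_decomposition ::
    "nat \<Rightarrow> 'a::real_vector set \<Rightarrow> (nat \<Rightarrow> 'a) \<Rightarrow> nat \<Rightarrow> (nat \<Rightarrow> real) \<Rightarrow> (nat \<Rightarrow> nat \<Rightarrow> 'a) \<Rightarrow> bool" where
  "last_decomposition N \<Omega> x n c Y \<longleftrightarrow>
     (\<forall>i\<in>{1..n}. c i \<ge> 0 \<and> Y i \<in> pow_set \<Omega> N \<and> Y i 1 = x 1) \<and>
     (\<Sum>i=1..n. c i) = 1 \<and> (\<forall>j\<in>{2..N}. (\<Sum>i=1..n. c i *\<^sub>R Y i j) = x j)"

lemma concavification_last_eq_Sup:
  "concavification_last N \<Omega> K x =
     Sup {ereal (\<Sum>i=1..n. c i * K (Y i)) | n c Y. last_decomposition N \<Omega> x n c Y}"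
  unfolding concavification_last_def last_decomposition_def ..

lemma concavification_last_upper:
  "last_decomposition N \<Omega> x n c Y \<Longrightarrow> ereal (\<Sum>i=1..n. c i * K (Y i)) \<le> concavification_last N \<Omega> K x"
  unfolding concavification_last_eq_Sup by (rule Sup_upper) auto

lemma concavification_last_least:
  "(\<And>n c Y. last_decomposition N \<Omega> x n c Y \<Longrightarrow> (\<Sum>i=1..n. c i * K (Y i)) \<le> b) \<Longrightarrow>
    concavification_last N \<Omega> K x \<le> ereal b"
  unfolding concavification_last_eq_Sup by (rule Sup_least) auto

lemma concavification_last_approx:
  assumes "concavification_last N \<Omega> K x = ereal r" "b < r"
  obtains n c Y where "last_decomposition N \<Omega> x n c Y" "(\<Sum>i=1..n. c i * K (Y i)) > b"
proof -
  have "ereal b < concavification_last N \<Omega> K x" using assms by simp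
  then show ?thesis using that unfolding concavification_last_eq_Sup less_Sup_iff by auto
qed

lemma last_decomposition_trivial:
  "x \<in> pow_set \<Omega> N \<Longrightarrow> last_decomposition N \<Omega> x 1 (\<lambda>_. 1) (\<lambda>_. x)"
  by (auto simp: last_decomposition_def)

lemma last_decomposition_point:
  assumes "last_decomposition N \<Omega> x n c Y" "x \<in> pow_set \<Omega> N"
  shows "(\<lambda>j\<in>{1..N}. \<Sum>i=1..n. c i *\<^sub>R Y i j) = x"
proof
  fix j
  have "(\<Sum>i=1..n. c i *\<^sub>R Y i 1) = (\<Sum>i=1..n. c i *\<^sub>R x 1)"
    using assms(1) by (intro sum.cong) (auto simp: last_decomposition_def)
  also have "\<dots> = x 1"
    using assms(1) by (simp add: last_decomposition_def scaleR_left.sum[symmetric])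
  finally have 1: "(\<Sum>i=1..n. c i *\<^sub>R Y i 1) = x 1" .
  show "(\<lambda>j\<in>{1..N}. \<Sum>i=1..n. c i *\<^sub>R Y i j) j = x j"
  proof (cases "j \<in> {1..N}")
    case True
    then consider "j = 1" | "j \<in> {2..N}" by fastforce
    then show ?thesis
      using True 1 assms(1) by cases (auto simp: last_decomposition_def)
  qed (use assms(2) in \<open>auto simp: PiE_def extensional_def\<close>)
qed

lemma sum_append:
  fixes g h :: "nat \<Rightarrow> 'b::comm_monoid_add"
  shows "(\<Sum>i=1..n+m. if i \<le> n then g i else h (i - n)) = (\<Sum>i=1..n. g i) + (\<Sum>i=1..m. h i)"
proof -
  have "{1..n+m} = {1..n} \<union> {n+1..n+m}" by auto
  then have "(\<Sum>i=1..n+m. if i \<le> n then g i else h (i - n)) =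
      (\<Sum>i=1..n. if i \<le> n then g i else h (i - n)) + (\<Sum>i=n+1..n+m. if i \<le> n then g i else h (i - n))"
    by (simp add: sum.union_disjoint)
  also have "(\<Sum>i=n+1..n+m. if i \<le> n then g i else h (i - n)) = (\<Sum>i=1..m. h i)"
    by (rule sum.reindex_bij_witness[of _ "\<lambda>i. i + n" "\<lambda>i. i - n"]) auto
  finally show ?thesis by simp
qed

text \<open>
  Concatenating weighted decompositions is what makes the concavification concave.
\<close>

lemma last_decomposition_append:
  assumes x: "last_decomposition N \<Omega> x n c Y" and y: "last_decomposition N \<Omega> y m d Z"
    and "x 1 = y 1" "t \<in> {0..1}" "N \<ge> 1"
  shows "last_decomposition N \<Omega> (\<lambda>i\<in>{1..N}. (1 - t) *\<^sub>R x i + t *\<^sub>R y i) (n + m)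
    (\<lambda>i. if i \<le> n then (1 - t) * c i else t * d (i - n)) (\<lambda>i. if i \<le> n then Y i else Z (i - n))"
proof -
  have first: "(1 - t) *\<^sub>R x 1 + t *\<^sub>R y 1 = y 1"
    using assms(3) by (simp add: scaleR_left_distrib[symmetric])
  have "(if i \<le> n then Y i else Z (i - n)) \<in> pow_set \<Omega> N
     \<and> (if i \<le> n then Y i else Z (i - n)) 1 = y 1
     \<and> (if i \<le> n then (1 - t) * c i else t * d (i - n)) \<ge> 0" if "i \<in> {1..n+m}" for i
  proof (cases "i \<le> n")
    case True
    then show ?thesis using x that assms(3,4) by (auto simp: last_decomposition_def)
  next
    case False
    then have "i - n \<in> {1..m}" using that by auto
    then show ?thesis using False y that assms(3,4) by (auto simp: last_decomposition_def)
  qed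
  moreover have "(\<Sum>i=1..n+m. if i \<le> n then (1 - t) * c i else t * d (i - n)) = 1"
    using x y by (subst sum_append) (simp add: last_decomposition_def sum_distrib_left[symmetric])
  moreover have "(\<Sum>i=1..n+m. (if i \<le> n then (1 - t) * c i else t * d (i - n)) *\<^sub>R
      (if i \<le> n then Y i else Z (i - n)) j) = (1 - t) *\<^sub>R x j + t *\<^sub>R y j" if "j \<in> {2..N}" for j
  proof -
    have "(\<Sum>i=1..n+m. (if i \<le> n then (1 - t) * c i else t * d (i - n)) *\<^sub>R
      (if i \<le> n then Y i else Z (i - n)) j) =
      (\<Sum>i=1..n+m. if i \<le> n then (1 - t) *\<^sub>R c i *\<^sub>R Y i j else t *\<^sub>R d (i - n) *\<^sub>R Z (i - n) j)"
      by (rule sum.cong) auto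
    also have "\<dots> = (\<Sum>i=1..n. (1 - t) *\<^sub>R c i *\<^sub>R Y i j) + (\<Sum>i=1..m. t *\<^sub>R d i *\<^sub>R Z i j)"
      by (rule sum_append)
    also have "\<dots> = (1 - t) *\<^sub>R x j + t *\<^sub>R y j"
      using x y that by (simp add: last_decomposition_def scaleR_sum_right[symmetric] del: scaleR_scaleR)
    finally show ?thesis .
  qed
  ultimately show ?thesis
    using first assms(5) by (auto simp: last_decomposition_def)
qed

text \<open>
  The largest function below the negated proper cyclic sum that is convex in the last variables.
  For admissible \<open>H\<close> the concavification is real on \<open>\<Omega>\<^sup>N\<close> (\<open>dual_transform_bounds\<close>), so that
  \<open>real_of_ereal\<close> loses nothing.
\<close>

definition dual_transform ::
    "nat \<Rightarrow> 'a::real_vector set \<Rightarrow> ((nat \<Rightarrow> 'a) \<Rightarrow> real) \<Rightarrow> (nat \<Rightarrow> 'a) \<Rightarrow> real" where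
  "dual_transform N \<Omega> H x = - real_of_ereal (concavification_last N \<Omega> (proper_cyclic_sum N H) x)"

text \<open>
  The class in which the saddle function is found as a fixed point of \<open>dual_transform\<close>.
\<close>

definition admissible :: "nat \<Rightarrow> 'a::real_vector set \<Rightarrow> ((nat \<Rightarrow> 'a) \<Rightarrow> real) \<Rightarrow> bool" where
  "admissible N \<Omega> H \<longleftrightarrow> convex_last N \<Omega> H \<and> sub_antisymmetric N \<Omega> H"

lemma proper_cyclic_sum_le:
  assumes "N \<ge> 1" "sub_antisymmetric N \<Omega> H" "x \<in> pow_set \<Omega> N"
  shows "proper_cyclic_sum N H x \<le> - H x"
proof -
  have "cyclic_sum N H x \<le> 0" using assms by (simp add: sub_antisymmetric_iff)
  then show ?thesis using cyclic_sum_split[OF assms(1), of H x] by simp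
qed

text \<open>
  Sub-antisymmetry bounds the proper cyclic sum by \<open>- H\<close>, which is already concave in the last
  variables, so by Jensen's inequality the concavification stays below \<open>- H\<close> and is finite.
\<close>

lemma dual_transform_bounds:
  assumes "convex \<Omega>" "N \<ge> 1" "admissible N \<Omega> H" "x \<in> pow_set \<Omega> N"
  shows "concavification_last N \<Omega> (proper_cyclic_sum N H) x = ereal (- dual_transform N \<Omega> H x)"
    and "H x \<le> dual_transform N \<Omega> H x"
    and "dual_transform N \<Omega> H x \<le> - proper_cyclic_sum N H x"
proof -
  let ?C = "concavification_last N \<Omega> (proper_cyclic_sum N H) x"
  have le: "?C \<le> ereal (- H x)"
  proof (rule concavification_last_least)
    fix n c Y assume d: "last_decomposition N \<Omega> x n c Y"
    have "n \<ge> 1" using d by (cases n) (auto simp: last_decomposition_def)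
    have "(\<Sum>i=1..n. c i * proper_cyclic_sum N H (Y i)) \<le> (\<Sum>i=1..n. c i * - H (Y i))"
      using d assms(2,3)
      by (intro sum_mono mult_left_mono proper_cyclic_sum_le[where \<Omega> = \<Omega>])
         (auto simp: last_decomposition_def admissible_def)
    also have "\<dots> = - (\<Sum>i=1..n. c i * H (Y i))" by (simp add: sum_negf)
    also have "\<dots> \<le> - H x"
      using convex_last_Jensen[OF assms(1) _ assms(2), of H "{1..n}" c Y "x 1"] assms(3) d \<open>n \<ge> 1\<close>
        last_decomposition_point[OF d assms(4)]
      by (auto simp: last_decomposition_def admissible_def)
    finally show "(\<Sum>i=1..n. c i * proper_cyclic_sum N H (Y i)) \<le> - H x" .
  qed
  have ge: "ereal (proper_cyclic_sum N H x) \<le> ?C"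
    using concavification_last_upper[OF last_decomposition_trivial[OF assms(4)], of "proper_cyclic_sum N H"]
    by simp
  obtain r where r: "?C = ereal r" using le ge by (cases ?C) auto
  show "?C = ereal (- dual_transform N \<Omega> H x)" by (simp add: dual_transform_def r)
  show "H x \<le> dual_transform N \<Omega> H x" "dual_transform N \<Omega> H x \<le> - proper_cyclic_sum N H x"
    using le ge by (auto simp: dual_transform_def r)
qed

lemma convex_last_dual_transform:
  assumes "convex \<Omega>" "N \<ge> 1" "admissible N \<Omega> H"
  shows "convex_last N \<Omega> (dual_transform N \<Omega> H)"
  unfolding convex_last_def
proof (intro ballI impI)
  fix x y t assume x: "x \<in> pow_set \<Omega> N" and y: "y \<in> pow_set \<Omega> N" and t: "t \<in> {0..1::real}" and xy: "x 1 = y 1"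
  define z where "z = (\<lambda>i\<in>{1..N}. (1 - t) *\<^sub>R x i + t *\<^sub>R y i)"
  define D where "D = dual_transform N \<Omega> H"
  let ?K = "proper_cyclic_sum N H"
  have z: "z \<in> pow_set \<Omega> N" unfolding z_def by (rule convex_comb_in_pow_set) (use assms x y t in auto)
  note C = dual_transform_bounds(1)[OF assms, folded D_def]
  have "(1 - t) * - D x + t * - D y \<le> - D z"
  proof (rule field_le_epsilon)
    fix e :: real assume "e > 0"
    obtain n c Y where 1: "last_decomposition N \<Omega> x n c Y" "(\<Sum>i=1..n. c i * ?K (Y i)) > - D x - e"
      using concavification_last_approx[OF C[OF x], of "- D x - e"] \<open>e > 0\<close> by auto
    obtain m d Z where 2: "last_decomposition N \<Omega> y m d Z" "(\<Sum>i=1..m. d i * ?K (Z i)) > - D y - e"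
      using concavification_last_approx[OF C[OF y], of "- D y - e"] \<open>e > 0\<close> by auto
    let ?c = "\<lambda>i. if i \<le> n then (1 - t) * c i else t * d (i - n)"
    let ?Y = "\<lambda>i. if i \<le> n then Y i else Z (i - n)"
    have dec: "last_decomposition N \<Omega> z (n + m) ?c ?Y"
      unfolding z_def by (rule last_decomposition_append[OF 1(1) 2(1) xy t assms(2)])
    have "(\<Sum>i=1..n+m. ?c i * ?K (?Y i)) =
        (\<Sum>i=1..n+m. if i \<le> n then (1 - t) * (c i * ?K (Y i)) else t * (d (i - n) * ?K (Z (i - n))))"
      by (rule sum.cong) auto
    also have "\<dots> = (\<Sum>i=1..n. (1 - t) * (c i * ?K (Y i))) + (\<Sum>i=1..m. t * (d i * ?K (Z i)))"
      by (rule sum_append)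
    also have "\<dots> = (1 - t) * (\<Sum>i=1..n. c i * ?K (Y i)) + t * (\<Sum>i=1..m. d i * ?K (Z i))"
      by (simp only: sum_distrib_left)
    also have "\<dots> \<ge> (1 - t) * (- D x - e) + t * (- D y - e)"
      using 1 2 t by (intro add_mono mult_left_mono) auto
    finally have "(1 - t) * (- D x - e) + t * (- D y - e) \<le> (\<Sum>i=1..n+m. ?c i * ?K (?Y i))" .
    also have "\<dots> \<le> - D z" using concavification_last_upper[OF dec, of ?K] C[OF z] by simp
    finally show "(1 - t) * - D x + t * - D y \<le> - D z + e" by (simp add: algebra_simps)
  qed
  then show "dual_transform N \<Omega> H (\<lambda>i\<in>{1..N}. (1 - t) *\<^sub>R x i + t *\<^sub>R y i)
      \<le> (1 - t) * dual_transform N \<Omega> H x + t * dual_transform N \<Omega> H y"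
    by (simp add: D_def z_def)
qed

lemma proper_cyclic_sum_mono:
  assumes "\<And>z. z \<in> pow_set \<Omega> N \<Longrightarrow> H z \<le> G z" "x \<in> pow_set \<Omega> N"
  shows "proper_cyclic_sum N H x \<le> proper_cyclic_sum N G x"
  unfolding proper_cyclic_sum_def by (intro sum_mono assms cyclic_shift_pow_in_pow_set)

lemma dual_transform_antimono:
  assumes "convex \<Omega>" "N \<ge> 1" "admissible N \<Omega> H" "admissible N \<Omega> G"
    and "\<And>z. z \<in> pow_set \<Omega> N \<Longrightarrow> H z \<le> G z" "x \<in> pow_set \<Omega> N"
  shows "dual_transform N \<Omega> G x \<le> dual_transform N \<Omega> H x"
proof -
  have "concavification_last N \<Omega> (proper_cyclic_sum N H) x \<le> ereal (- dual_transform N \<Omega> G x)"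
  proof (rule concavification_last_least)
    fix n c Y assume d: "last_decomposition N \<Omega> x n c Y"
    have "(\<Sum>i=1..n. c i * proper_cyclic_sum N H (Y i)) \<le> (\<Sum>i=1..n. c i * proper_cyclic_sum N G (Y i))"
      using d assms(5)
      by (intro sum_mono mult_left_mono proper_cyclic_sum_mono[where \<Omega> = \<Omega>])
         (auto simp: last_decomposition_def)
    also have "\<dots> \<le> - dual_transform N \<Omega> G x"
      using concavification_last_upper[OF d, of "proper_cyclic_sum N G"]
        dual_transform_bounds(1)[OF assms(1,2,4,6)] by simp
    finally show "(\<Sum>i=1..n. c i * proper_cyclic_sum N H (Y i)) \<le> - dual_transform N \<Omega> G x" .
  qed
  then show ?thesis using dual_transform_bounds(1)[OF assms(1,2,3,6)] by simp
qed

text \<open>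
  The weight \<open>1 / N\<close> is the one for which sub-antisymmetry survives: replacing \<open>H\<close> by its dual
  transform outright would in general destroy it.
\<close>

definition improve ::
    "nat \<Rightarrow> 'a::real_vector set \<Rightarrow> ((nat \<Rightarrow> 'a) \<Rightarrow> real) \<Rightarrow> (nat \<Rightarrow> 'a) \<Rightarrow> real" where
  "improve N \<Omega> H x = (1 - 1 / N) * H x + (1 / N) * dual_transform N \<Omega> H x"

lemma improve_ge:
  assumes "convex \<Omega>" "N \<ge> 1" "admissible N \<Omega> H" "x \<in> pow_set \<Omega> N"
  shows "H x \<le> improve N \<Omega> H x"
proof -
  have "(1 / N) * H x \<le> (1 / N) * dual_transform N \<Omega> H x"
    using dual_transform_bounds(2)[OF assms] by (intro mult_left_mono) auto
  then show ?thesis by (simp add: improve_def algebra_simps)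
qed

text \<open>
  The cyclic sum of the improved function is \<open>1 / N\<close> times the cyclic sum of the dual transform plus
  the proper cyclic sum of \<open>H\<close>, and the sum of these two functions is nonpositive.
\<close>

lemma admissible_improve:
  assumes "convex \<Omega>" "N \<ge> 1" "admissible N \<Omega> H"
  shows "admissible N \<Omega> (improve N \<Omega> H)"
  unfolding admissible_def
proof
  define D where "D = dual_transform N \<Omega> H"
  have D: "convex_last N \<Omega> D" unfolding D_def by (rule convex_last_dual_transform[OF assms])
  have N: "1 - 1 / real N \<ge> 0" using assms(2) by simp
  show "convex_last N \<Omega> (improve N \<Omega> H)"
    unfolding convex_last_def
  proof (intro ballI impI)
    fix x y t assume x: "x \<in> pow_set \<Omega> N" and y: "y \<in> pow_set \<Omega> N" and t: "t \<in> {0..1::real}" and xy: "x 1 = y 1"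
    define z where "z = (\<lambda>i\<in>{1..N}. (1 - t) *\<^sub>R x i + t *\<^sub>R y i)"
    have "H z \<le> (1 - t) * H x + t * H y"
      using assms(3) x y t xy unfolding z_def admissible_def convex_last_def by blast
    moreover have "D z \<le> (1 - t) * D x + t * D y"
      using D x y t xy unfolding z_def convex_last_def by blast
    ultimately have "improve N \<Omega> H z \<le> (1 - 1 / N) * ((1 - t) * H x + t * H y) + (1 / N) * ((1 - t) * D x + t * D y)"
      unfolding improve_def D_def[symmetric] using N by (intro add_mono mult_left_mono) auto
    also have "\<dots> = (1 - t) * improve N \<Omega> H x + t * improve N \<Omega> H y"
      unfolding improve_def D_def[symmetric] by (simp add: algebra_simps add_divide_distrib diff_divide_distrib)
    finally show "improve N \<Omega> H (\<lambda>i\<in>{1..N}. (1 - t) *\<^sub>R x i + t *\<^sub>R y i)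
        \<le> (1 - t) * improve N \<Omega> H x + t * improve N \<Omega> H y" by (simp only: z_def)
  qed
  show "sub_antisymmetric N \<Omega> (improve N \<Omega> H)"
    unfolding sub_antisymmetric_iff
  proof
    fix x assume x: "x \<in> pow_set \<Omega> N"
    have "cyclic_sum N (improve N \<Omega> H) x = (1 - 1 / N) * cyclic_sum N H x + (1 / N) * cyclic_sum N D x"
      unfolding improve_def D_def[symmetric] by (rule cyclic_sum_linear)
    \<comment> \<open>the count \<open>N - 1\<close> of shifts cancels against the weight \<open>1 - 1 / N\<close>\<close>
    also have "(1 - 1 / N) * cyclic_sum N H x = (1 / N) * cyclic_sum N (proper_cyclic_sum N H) x"
      using cyclic_sum_proper_cyclic_sum[OF x assms(2), of H] assms(2) by (simp add: field_simps)
    also have "(1 / N) * cyclic_sum N (proper_cyclic_sum N H) x + (1 / N) * cyclic_sum N D x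
        = (1 / N) * cyclic_sum N (\<lambda>x. 1 * proper_cyclic_sum N H x + 1 * D x) x"
      by (simp only: cyclic_sum_linear) (simp add: algebra_simps)
    also have "\<dots> \<le> 0"
    proof -
      have "1 * proper_cyclic_sum N H z + 1 * D z \<le> 0" if "z \<in> pow_set \<Omega> N" for z
        using dual_transform_bounds(3)[OF assms that] by (simp add: D_def)
      then have "cyclic_sum N (\<lambda>x. 1 * proper_cyclic_sum N H x + 1 * D x) x \<le> 0"
        unfolding cyclic_sum_def using cyclic_shift_pow_in_pow_set[OF x] by (intro sum_nonpos) auto
      then show ?thesis by (simp add: divide_nonpos_nonneg)
    qed
    finally show "cyclic_sum N (improve N \<Omega> H) x \<le> 0" .
  qed
qed

text \<open>
  Iterating \<open>improve\<close> gives an increasing sequence \<open>h\<^sub>n\<close> bounded by the negated proper cyclic sum of \<open>F\<close>.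
  The gap between \<open>h\<^sub>n\<close> and its dual transform is \<open>N (h\<^sub>n\<^sub>+\<^sub>1 - h\<^sub>n)\<close>, which tends to \<open>0\<close>; as the transform
  is antitone, the dual transform of the limit is squeezed onto the limit.
\<close>

theorem self_dual_saddle:
  assumes "convex \<Omega>" "N \<ge> 1" "admissible N \<Omega> F"
  obtains H where "admissible N \<Omega> H" "\<And>x. x \<in> pow_set \<Omega> N \<Longrightarrow> F x \<le> H x"
    "\<And>x. x \<in> pow_set \<Omega> N \<Longrightarrow>
       concavification_last N \<Omega> (proper_cyclic_sum N H) x = ereal (- H x)"
proof -
  define h where "h n = (improve N \<Omega> ^^ n) F" for n
  have h0: "h 0 = F" and hSuc: "h (Suc n) = improve N \<Omega> (h n)" for n by (auto simp: h_def)
  have adm: "admissible N \<Omega> (h n)" for n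
    by (induction n) (simp_all add: h0 hSuc assms admissible_improve[OF assms(1,2)])
  have inc: "incseq (\<lambda>n. h n x)" if "x \<in> pow_set \<Omega> N" for x
    by (rule incseq_SucI) (simp add: hSuc improve_ge[OF assms(1,2) adm that])
  have hF: "F x \<le> h n x" if "x \<in> pow_set \<Omega> N" for n x
    using incseqD[OF inc[OF that], of 0 n] by (simp add: h0)
  have bd: "h n x \<le> - proper_cyclic_sum N F x" if x: "x \<in> pow_set \<Omega> N" for n x
  proof -
    have "proper_cyclic_sum N F x \<le> proper_cyclic_sum N (h n) x"
      using hF x by (intro proper_cyclic_sum_mono[where \<Omega> = \<Omega>]) auto
    also have "\<dots> \<le> - h n x"
      using adm[of n] x assms(2) by (intro proper_cyclic_sum_le[where \<Omega> = \<Omega>]) (auto simp: admissible_def)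
    finally show ?thesis by simp
  qed
  define H where "H x = lim (\<lambda>n. h n x)" for x
  have lim: "(\<lambda>n. h n x) \<longlonglongrightarrow> H x" and le: "h n x \<le> H x" if x: "x \<in> pow_set \<Omega> N" for x n
  proof -
    obtain L where L: "(\<lambda>n. h n x) \<longlonglongrightarrow> L" "\<And>n. h n x \<le> L"
      using incseq_convergent[OF inc[OF x], of "- proper_cyclic_sum N F x"] bd[OF x] by auto
    then have "H x = L" by (simp add: H_def limI)
    then show "(\<lambda>n. h n x) \<longlonglongrightarrow> H x" "h n x \<le> H x" using L by auto
  qed
  have admH: "admissible N \<Omega> H"
    unfolding admissible_def
  proof
    show "convex_last N \<Omega> H"
      unfolding convex_last_def
    proof (intro ballI impI)
      fix x y t assume x: "x \<in> pow_set \<Omega> N" and y: "y \<in> pow_set \<Omega> N" and t: "t \<in> {0..1::real}" and xy: "x 1 = y 1"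
      have z: "(\<lambda>i\<in>{1..N}. (1 - t) *\<^sub>R x i + t *\<^sub>R y i) \<in> pow_set \<Omega> N"
        by (rule convex_comb_in_pow_set) (use assms x y t in auto)
      have "(\<lambda>n. (1 - t) * h n x + t * h n y) \<longlonglongrightarrow> (1 - t) * H x + t * H y"
        by (intro tendsto_intros lim x y)
      then show "H (\<lambda>i\<in>{1..N}. (1 - t) *\<^sub>R x i + t *\<^sub>R y i) \<le> (1 - t) * H x + t * H y"
        using adm x y t xy
        by (intro LIMSEQ_le[OF lim[OF z]]) (auto simp: admissible_def convex_last_def)
    qed
    show "sub_antisymmetric N \<Omega> H"
      unfolding sub_antisymmetric_iff
    proof
      fix x assume x: "x \<in> pow_set \<Omega> N"
      have "(\<lambda>n. cyclic_sum N (h n) x) \<longlonglongrightarrow> cyclic_sum N H x"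
        unfolding cyclic_sum_def by (intro tendsto_intros lim cyclic_shift_pow_in_pow_set[OF x])
      then show "cyclic_sum N H x \<le> 0"
        using adm x by (intro LIMSEQ_le_const2) (auto simp: admissible_def sub_antisymmetric_iff)
    qed
  qed
  have "dual_transform N \<Omega> H x = H x" if x: "x \<in> pow_set \<Omega> N" for x
  proof (rule antisym)
    show "H x \<le> dual_transform N \<Omega> H x" by (rule dual_transform_bounds(2)[OF assms(1,2) admH x])
    \<comment> \<open>the right-hand side is the dual transform of \<open>h n\<close>, by definition of \<open>improve\<close>\<close>
    have "dual_transform N \<Omega> H x \<le> h n x + N * (h (Suc n) x - h n x)" for n
    proof -
      have "dual_transform N \<Omega> H x \<le> dual_transform N \<Omega> (h n) x"
        by (rule dual_transform_antimono[OF assms(1,2) adm admH le x])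
      also have "\<dots> = h n x + N * (h (Suc n) x - h n x)"
        using assms(2) by (simp add: hSuc improve_def field_simps)
      finally show ?thesis .
    qed
    moreover have "(\<lambda>n. h n x + N * (h (Suc n) x - h n x)) \<longlonglongrightarrow> H x + N * (H x - H x)"
      by (intro tendsto_intros lim x LIMSEQ_Suc)
    ultimately show "dual_transform N \<Omega> H x \<le> H x"
      by (intro LIMSEQ_le_const[of _ "H x"]) auto
  qed
  then show ?thesis
    using that[OF admH] le[of _ 0] dual_transform_bounds(1)[OF assms(1,2) admH] by (auto simp: h0)
qed

lemma cyclic_shift_comb:
  "N \<ge> 1 \<Longrightarrow> cyclic_shift N (\<lambda>i\<in>{1..N}. (1 - t) *\<^sub>R x i + t *\<^sub>R y i) =
    (\<lambda>i\<in>{1..N}. (1 - t) *\<^sub>R cyclic_shift N x i + t *\<^sub>R cyclic_shift N y i)"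
  by (auto simp: cyclic_shift_def fun_eq_iff)

lemma cyclic_shift_pow_comb:
  assumes "N \<ge> 1"
  shows "(cyclic_shift N ^^ i) (\<lambda>i\<in>{1..N}. (1 - t) *\<^sub>R x i + t *\<^sub>R y i) =
    (\<lambda>j\<in>{1..N}. (1 - t) *\<^sub>R (cyclic_shift N ^^ i) x j + t *\<^sub>R (cyclic_shift N ^^ i) y j)"
proof (induction i)
  case (Suc i)
  then show ?case by (simp only: funpow.simps o_apply cyclic_shift_comb[OF assms])
qed simp

lemma coordinate_update_in_pow_set:
  "j \<in> {1..N} \<Longrightarrow> x \<in> pow_set A N \<Longrightarrow> z \<in> A \<Longrightarrow> x(j := z) \<in> pow_set A N"
  by (auto simp: PiE_def Pi_def extensional_def)

lemma first_update_in_pow_set: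
  "N \<ge> 1 \<Longrightarrow> x \<in> pow_set A N \<Longrightarrow> a \<in> A \<Longrightarrow> x(1 := a) \<in> pow_set A N"
  by (rule coordinate_update_in_pow_set) auto

text \<open>
  After a proper shift the first coordinate of a point is one of the last coordinates.
\<close>

lemma proper_cyclic_sum_convex_first:
  assumes "N \<ge> 1" "convex_last N \<Omega> H" "x \<in> pow_set \<Omega> N" "a \<in> \<Omega>" "b \<in> \<Omega>" "t \<in> {0..1}"
  shows "proper_cyclic_sum N H (x(1 := (1 - t) *\<^sub>R a + t *\<^sub>R b))
    \<le> (1 - t) * proper_cyclic_sum N H (x(1 := a)) + t * proper_cyclic_sum N H (x(1 := b))"
proof -
  have eq: "x(1 := (1 - t) *\<^sub>R a + t *\<^sub>R b) =
      (\<lambda>i\<in>{1..N}. (1 - t) *\<^sub>R (x(1 := a)) i + t *\<^sub>R (x(1 := b)) i)"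
    using assms(1,3) by (auto simp: fun_eq_iff PiE_def extensional_def scaleR_left_distrib[symmetric])
  have a: "x(1 := a) \<in> pow_set \<Omega> N" and b: "x(1 := b) \<in> pow_set \<Omega> N"
    using assms by (simp_all add: first_update_in_pow_set del: One_nat_def PiE_iff)
  have "H ((cyclic_shift N ^^ i) (x(1 := (1 - t) *\<^sub>R a + t *\<^sub>R b))) \<le>
      (1 - t) * H ((cyclic_shift N ^^ i) (x(1 := a))) + t * H ((cyclic_shift N ^^ i) (x(1 := b)))"
    if "i \<in> {1..N-1}" for i
  proof -
    have "i < N" using that by auto
    then have "(cyclic_shift N ^^ i) (x(1 := a)) 1 = (cyclic_shift N ^^ i) (x(1 := b)) 1"
      using that assms(1) by (subst cyclic_shift_pow_apply[OF a], simp, subst cyclic_shift_pow_apply[OF b], simp_all)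
    then show ?thesis
      unfolding eq cyclic_shift_pow_comb[OF assms(1)]
      using assms(2,6) cyclic_shift_pow_in_pow_set[OF a] cyclic_shift_pow_in_pow_set[OF b]
      unfolding convex_last_def by blast
  qed
  then have "proper_cyclic_sum N H (x(1 := (1 - t) *\<^sub>R a + t *\<^sub>R b)) \<le>
    (\<Sum>i=1..N-1. (1 - t) * H ((cyclic_shift N ^^ i) (x(1 := a))) + t * H ((cyclic_shift N ^^ i) (x(1 := b))))"
    unfolding proper_cyclic_sum_def by (rule sum_mono)
  then show ?thesis
    by (simp add: proper_cyclic_sum_def sum.distrib sum_distrib_left)
qed

text \<open>
  For fixed weights and fixed last coordinates, a competitor in the concavification depends
  convexly on the common first coordinate. Hence the concavification is convex in it, being a supremum of
  convex functions.
\<close>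

lemma concave_first_if_self_dual:
  assumes "convex \<Omega>" "N \<ge> 1" "convex_last N \<Omega> H"
    and dual: "\<And>x. x \<in> pow_set \<Omega> N \<Longrightarrow>
       concavification_last N \<Omega> (proper_cyclic_sum N H) x = ereal (- H x)"
  shows "concave_first N \<Omega> H"
  unfolding concave_first_def
proof
  fix x assume x: "x \<in> pow_set \<Omega> N"
  let ?K = "proper_cyclic_sum N H"
  have "H (x(1 := (1 - t) *\<^sub>R a + t *\<^sub>R b)) \<ge> (1 - t) * H (x(1 := a)) + t * H (x(1 := b))"
    if ab: "a \<in> \<Omega>" "b \<in> \<Omega>" and t: "0 < t" "t < 1" for t a b
  proof -
    let ?m = "(1 - t) *\<^sub>R a + t *\<^sub>R b"
    have m: "?m \<in> \<Omega>" using assms(1) ab t by (intro convexD) auto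
    note pow = first_update_in_pow_set[OF assms(2) x]
    have "concavification_last N \<Omega> ?K (x(1 := ?m)) \<le> ereal ((1 - t) * - H (x(1 := a)) + t * - H (x(1 := b)))"
    proof (rule concavification_last_least)
      fix n c Y assume d: "last_decomposition N \<Omega> (x(1 := ?m)) n c Y"
      have upd: "last_decomposition N \<Omega> (x(1 := z)) n c (\<lambda>i. (Y i)(1 := z))" if "z \<in> \<Omega>" for z
        unfolding last_decomposition_def
      proof (intro conjI ballI)
        fix i assume "i \<in> {1..n}"
        then show "(Y i)(1 := z) \<in> pow_set \<Omega> N"
          using d that by (intro first_update_in_pow_set[OF assms(2)]) (auto simp: last_decomposition_def)
      next
        fix j assume "j \<in> {2..N}"
        then show "(\<Sum>i=1..n. c i *\<^sub>R ((Y i)(1 := z)) j) = (x(1 := z)) j"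
          using d by (auto simp: last_decomposition_def)
      qed (use d in \<open>auto simp: last_decomposition_def\<close>)
      have Yi: "?K (Y i) \<le> (1 - t) * ?K ((Y i)(1 := a)) + t * ?K ((Y i)(1 := b))" if "i \<in> {1..n}" for i
      proof -
        have "Y i = (Y i)(1 := ?m)" using d that by (auto simp: last_decomposition_def fun_eq_iff)
        then show ?thesis
          using proper_cyclic_sum_convex_first[OF assms(2,3) _ ab, of "Y i" t] d that t
          by (auto simp: last_decomposition_def)
      qed
      have "(\<Sum>i=1..n. c i * ?K (Y i)) \<le>
          (\<Sum>i=1..n. c i * ((1 - t) * ?K ((Y i)(1 := a)) + t * ?K ((Y i)(1 := b))))"
        using d Yi by (intro sum_mono mult_left_mono) (auto simp: last_decomposition_def)
      also have "\<dots> = (1 - t) * (\<Sum>i=1..n. c i * ?K ((Y i)(1 := a))) + t * (\<Sum>i=1..n. c i * ?K ((Y i)(1 := b)))"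
        unfolding sum_distrib_left sum.distrib[symmetric] by (rule sum.cong) (auto simp: algebra_simps)
      also have "\<dots> \<le> (1 - t) * - H (x(1 := a)) + t * - H (x(1 := b))"
        using concavification_last_upper[OF upd[OF ab(1)], of ?K]
          concavification_last_upper[OF upd[OF ab(2)], of ?K] dual[OF pow[OF ab(1)]] dual[OF pow[OF ab(2)]] t
        by (intro add_mono mult_left_mono) auto
      finally show "(\<Sum>i=1..n. c i * ?K (Y i)) \<le> (1 - t) * - H (x(1 := a)) + t * - H (x(1 := b))" .
    qed
    then show ?thesis using dual[OF pow[OF m]] by simp
  qed
  then have "convex_on \<Omega> (\<lambda>z. - H (x(1 := z)))"
    using assms(1) by (intro convex_onI) force+
  then show "concave_on \<Omega> (\<lambda>z. H (x(1 := z)))" by (simp add: concave_on_def)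
qed

section \<open>Approximate continuity\<close>

abbreviation corner_cube :: "'a::euclidean_space \<Rightarrow> real \<Rightarrow> 'a set" where
  "corner_cube x h \<equiv> cbox x (x + h *\<^sub>R One)"

lemma content_corner_cube:
  fixes x :: "'a::euclidean_space"
  assumes "h \<ge> 0"
  shows "measure lborel (corner_cube x h) = h ^ DIM('a)"
proof -
  have "x \<in> corner_cube x h" using assms by (simp add: mem_box inner_add_left)
  then have "corner_cube x h \<noteq> {}" by blast
  then show ?thesis by (simp add: content_cbox' inner_add_left)
qed

lemma corner_cube_eventually_subset:
  fixes x :: "'a::euclidean_space"
  assumes "open S" "x \<in> S"
  shows "eventually (\<lambda>h. corner_cube x h \<subseteq> S) (at_right 0)"
proof -
  obtain e where e: "e > 0" "ball x e \<subseteq> S" using assms open_contains_ball by blast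
  have "eventually (\<lambda>h. h \<in> {0<..<e / DIM('a)}) (at_right 0)"
    using e(1) by (intro eventually_at_right_real) simp
  then show ?thesis
  proof (rule eventually_mono)
    fix h assume h: "h \<in> {0<..<e / DIM('a)}"
    have "norm (y - x) < e" if y: "y \<in> corner_cube x h" for y
    proof -
      have "norm (y - x) \<le> (\<Sum>b\<in>Basis. \<bar>(y - x) \<bullet> b\<bar>)" by (rule norm_le_l1)
      also have "\<dots> \<le> (\<Sum>b\<in>(Basis::'a set). h)"
        using y by (intro sum_mono) (force simp: mem_box inner_add_left inner_diff_left)
      also have "\<dots> < e" using h by (simp add: field_simps)
      finally show ?thesis .
    qed
    then show "corner_cube x h \<subseteq> S" using e(2) by (auto simp: dist_norm norm_minus_commute)
  qed
qed

text \<open>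
  By Lebesgue's differentiation theorem the set fills the cube with corner \<open>x\<close> up to a fraction smaller
  than \<open>c ^ DIM('a)\<close>, which is the share of the subcube.
\<close>

lemma corner_cubes_meet_set:
  fixes E :: "'a::euclidean_space set"
  assumes E: "E \<in> sets lebesgue" and c: "c > 0"
  obtains Z where "negligible Z"
    "\<And>x. x \<in> E - Z \<Longrightarrow> \<exists>\<delta>>0. \<forall>h a. 0 < h \<and> h < \<delta> \<and>
        corner_cube a (c * h) \<subseteq> corner_cube x h \<longrightarrow>
        \<not> negligible (corner_cube a (c * h) \<inter> E)"
proof -
  have meas: "E \<inter> cbox a b \<in> lmeasurable" for a b
    using E by (metis Int_commute fmeasurable_Int_fmeasurable lmeasurable_cbox)
  have int: "indicat_real E integrable_on cbox a b" for a b
    by (simp add: integrable_on_indicator meas)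
  obtain Z where Z: "negligible Z" "\<And>x e. x \<notin> Z \<Longrightarrow> 0 < e \<Longrightarrow> \<exists>d>0. \<forall>h. 0 < h \<and> h < d \<longrightarrow>
      norm (integral (corner_cube x h) (indicat_real E) /\<^sub>R h ^ DIM('a) - indicat_real E x) < e"
    using integrable_ccontinuous_explicit[of "indicat_real E"] int by auto
  show ?thesis
  proof (rule that[OF Z(1)])
    fix x assume x: "x \<in> E - Z"
    have "c ^ DIM('a) > 0" using c by simp
    then obtain d where d: "d > 0" "\<And>h. 0 < h \<Longrightarrow> h < d \<Longrightarrow>
        \<bar>integral (corner_cube x h) (indicat_real E) / h ^ DIM('a) - 1\<bar> < c ^ DIM('a)"
      using Z(2)[of x "c ^ DIM('a)"] x by (auto simp: divide_inverse mult.commute)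
    have "\<not> negligible (corner_cube a (c * h) \<inter> E)"
      if h: "0 < h" "h < d" and sub: "corner_cube a (c * h) \<subseteq> corner_cube x h" for h a
    proof
      let ?Q = "corner_cube x h" and ?C = "corner_cube a (c * h)"
      assume neg: "negligible (?C \<inter> E)"
      have "measure lebesgue (E \<inter> ?Q) \<le> measure lebesgue ((?Q - ?C) \<union> (?C \<inter> E))"
        using meas sub neg
        by (intro measure_mono_fmeasurable fmeasurable.Un fmeasurable.Diff) (auto simp: negligible_imp_measurable)
      also have "\<dots> \<le> measure lebesgue (?Q - ?C) + measure lebesgue (?C \<inter> E)"
        using neg by (intro measure_Un_le) (auto simp: negligible_imp_sets)
      also have "measure lebesgue (?C \<inter> E) = 0" by (rule negligible_imp_measure0[OF neg])
      also have "measure lebesgue (?Q - ?C) = h ^ DIM('a) - (c * h) ^ DIM('a)"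
        using sub h c by (subst measurable_measure_Diff) (auto simp: content_corner_cube)
      finally have "measure lebesgue (E \<inter> ?Q) \<le> (1 - c ^ DIM('a)) * h ^ DIM('a)"
        by (simp add: algebra_simps power_mult_distrib)
      then have "measure lebesgue (E \<inter> ?Q) / h ^ DIM('a) \<le> 1 - c ^ DIM('a)"
        using h by (simp add: divide_le_eq)
      moreover have "integral ?Q (indicat_real E) = measure lebesgue (E \<inter> ?Q)"
        by (rule integral_indicator[OF meas])
      ultimately have "integral ?Q (indicat_real E) / h ^ DIM('a) \<le> 1 - c ^ DIM('a)" by simp
      then show False using d(2)[OF h] by linarith
    qed
    then show "\<exists>\<delta>>0. \<forall>h a. 0 < h \<and> h < \<delta> \<and>
        corner_cube a (c * h) \<subseteq> corner_cube x h \<longrightarrow>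
        \<not> negligible (corner_cube a (c * h) \<inter> E)"
      using \<open>d > 0\<close> by blast
  qed
qed

text \<open>
  A quantitative form of non-porosity of \<open>E\<close> at \<open>x\<close>, weaker than being a density point. Only cubes in the
  positive and in the negative orthant at \<open>x\<close> are tested; this is enough for convex hulls, because any
  nonzero linear functional is negative somewhere on one of the two orthants, near a coordinate axis.
\<close>

definition meets_small_cubes :: "real \<Rightarrow> 'a::euclidean_space \<Rightarrow> 'a set \<Rightarrow> bool" where
  "meets_small_cubes c x E \<longleftrightarrow> (\<exists>\<delta>>0. \<forall>h a. 0 < h \<and> h < \<delta> \<and>
        (corner_cube a (c * h) \<subseteq> corner_cube x h \<or>
         corner_cube a (c * h) \<subseteq> cbox (x - h *\<^sub>R One) x) \<longrightarrow>
        \<not> negligible (corner_cube a (c * h) \<inter> E))"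

text \<open>
  The negative orthant follows by reflecting the set at the origin.
\<close>

lemma almost_all_points_meet_small_cubes:
  fixes E :: "'a::euclidean_space set"
  assumes E: "E \<in> sets lebesgue" and c: "c > 0"
  obtains Z where "negligible Z" "\<And>x. x \<in> E - Z \<Longrightarrow> meets_small_cubes c x E"
proof -
  obtain Z1 where Z1: "negligible Z1"
    "\<And>x. x \<in> E - Z1 \<Longrightarrow> \<exists>\<delta>>0. \<forall>h a. 0 < h \<and> h < \<delta> \<and>
        corner_cube a (c * h) \<subseteq> corner_cube x h \<longrightarrow>
        \<not> negligible (corner_cube a (c * h) \<inter> E)"
    using corner_cubes_meet_set[OF assms] by metis
  have E': "uminus ` E \<in> sets lebesgue"
    using E by (intro differentiable_image_in_sets_lebesgue) (auto intro!: derivative_intros simp: differentiable_on_def)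
  obtain Z2 where Z2: "negligible Z2"
    "\<And>x. x \<in> uminus ` E - Z2 \<Longrightarrow> \<exists>\<delta>>0. \<forall>h a. 0 < h \<and> h < \<delta> \<and>
        corner_cube a (c * h) \<subseteq> corner_cube x h \<longrightarrow>
        \<not> negligible (corner_cube a (c * h) \<inter> uminus ` E)"
    using corner_cubes_meet_set[OF E' c] by metis
  have neg_image: "negligible (uminus ` T)" if "negligible T" for T :: "'a set"
    by (rule negligible_differentiable_image_negligible[OF _ that]) (auto intro!: derivative_intros simp: differentiable_on_def)
  have reflect: "uminus ` cbox a b = cbox (-b) (-a)" for a b :: 'a
  proof -
    have "x \<in> uminus ` cbox a b \<longleftrightarrow> - x \<in> cbox a b" for x by (metis image_iff minus_minus)
    moreover have "- x \<in> cbox a b \<longleftrightarrow> x \<in> cbox (-b) (-a)" for x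
      unfolding mem_box inner_minus_left by (metis minus_le_iff le_minus_iff)
    ultimately show ?thesis by blast
  qed
  show ?thesis
  proof (rule that[of "Z1 \<union> uminus ` Z2"])
    show "negligible (Z1 \<union> uminus ` Z2)" using Z1 Z2 neg_image by auto
    fix x assume x: "x \<in> E - (Z1 \<union> uminus ` Z2)"
    obtain d1 where d1: "d1 > 0" "\<And>h a. 0 < h \<Longrightarrow> h < d1 \<Longrightarrow> corner_cube a (c * h) \<subseteq> corner_cube x h \<Longrightarrow>
        \<not> negligible (corner_cube a (c * h) \<inter> E)"
      using Z1(2)[of x] x by auto
    have "- x \<in> uminus ` E - Z2" using x by (metis DiffE DiffI UnI2 image_eqI minus_minus)
    then obtain d2 where d2: "d2 > 0" "\<And>h a. 0 < h \<Longrightarrow> h < d2 \<Longrightarrow> corner_cube a (c * h) \<subseteq> cbox (- x) (- x + h *\<^sub>R One) \<Longrightarrow>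
        \<not> negligible (corner_cube a (c * h) \<inter> uminus ` E)"
      using Z2(2)[of "- x"] by auto
    have "\<not> negligible (corner_cube a (c * h) \<inter> E)"
      if h: "0 < h" "h < d2" and sub: "corner_cube a (c * h) \<subseteq> cbox (x - h *\<^sub>R One) x" for h a
    proof -
      define a' where "a' = - (a + (c * h) *\<^sub>R One)"
      have C: "cbox a' (a' + (c * h) *\<^sub>R One) = uminus ` corner_cube a (c * h)"
        unfolding reflect a'_def by simp
      have "uminus ` cbox (x - h *\<^sub>R One) x = cbox (- x) (- x + h *\<^sub>R One)"
        unfolding reflect by (simp add: algebra_simps)
      then have "\<not> negligible (uminus ` corner_cube a (c * h) \<inter> uminus ` E)"
        using d2(2)[OF h, of a'] sub unfolding C by (metis image_mono)
      moreover have "uminus ` corner_cube a (c * h) \<inter> uminus ` E = uminus ` (corner_cube a (c * h) \<inter> E)"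
        by (rule image_Int[symmetric]) simp
      ultimately show ?thesis using neg_image by metis
    qed
    then show "meets_small_cubes c x E"
      unfolding meets_small_cubes_def
      using d1 d2(1) by (intro exI[of _ "min d1 d2"]) auto
  qed
qed

lemma meets_small_cubes_mono:
  assumes "meets_small_cubes c x E" "E \<subseteq> F"
  shows "meets_small_cubes c x F"
proof -
  have "\<not> negligible (Q \<inter> E) \<Longrightarrow> \<not> negligible (Q \<inter> F)" for Q
    using assms(2) negligible_subset[of "Q \<inter> F" "Q \<inter> E"] by blast
  then show ?thesis using assms(1) unfolding meets_small_cubes_def by metis
qed

lemma meets_small_cubes_Diff:
  assumes "meets_small_cubes c x E" "negligible Z"
  shows "meets_small_cubes c x (E - Z)"
proof -
  have "\<not> negligible (Q \<inter> E) \<Longrightarrow> \<not> negligible (Q \<inter> (E - Z))" for Q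
    using assms(2) negligible_subset[of "Q \<inter> (E - Z) \<union> Z" "Q \<inter> E"] by (auto simp: negligible_Un_eq)
  then show ?thesis using assms(1) unfolding meets_small_cubes_def by metis
qed

text \<open>
  Testing the preimages of a countable basis leaves only countably many null sets to be removed.
\<close>

theorem approximate_continuity:
  fixes U :: "'a::euclidean_space \<Rightarrow> 'b::second_countable_topology"
  assumes S: "S \<in> sets lebesgue" and U: "U \<in> borel_measurable (lebesgue_on S)" and c: "c > 0"
  obtains Z where "negligible Z"
    "\<And>x B. x \<in> S - Z \<Longrightarrow> open B \<Longrightarrow> U x \<in> B \<Longrightarrow> meets_small_cubes c x {y \<in> S. U y \<in> B}"
proof -
  obtain \<B> :: "'b set set" where \<B>: "countable \<B>" "topological_basis \<B>"
    using ex_countable_basis by blast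
  have E: "{y \<in> S. U y \<in> B} \<in> sets lebesgue" if "B \<in> \<B>" for B
  proof -
    have "open B" using \<B>(2) that by (rule topological_basis_open)
    then have "U -` B \<inter> space (lebesgue_on S) \<in> sets (lebesgue_on S)"
      using U by (intro measurable_sets[of U _ borel]) auto
    moreover have "U -` B \<inter> space (lebesgue_on S) = {y \<in> S. U y \<in> B}" by auto
    ultimately show ?thesis using S by (simp add: sets_restrict_space_iff)
  qed
  have "\<forall>B\<in>\<B>. \<exists>Z. negligible Z \<and>
      (\<forall>x\<in>{y \<in> S. U y \<in> B} - Z. meets_small_cubes c x {y \<in> S. U y \<in> B})"
  proof
    fix B assume "B \<in> \<B>"
    show "\<exists>Z. negligible Z \<and>
      (\<forall>x\<in>{y \<in> S. U y \<in> B} - Z. meets_small_cubes c x {y \<in> S. U y \<in> B})"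
      by (rule almost_all_points_meet_small_cubes[OF E[OF \<open>B \<in> \<B>\<close>] c]) blast
  qed
  from bchoice[OF this] obtain Z where Z: "\<And>B. B \<in> \<B> \<Longrightarrow> negligible (Z B)"
    "\<And>B x. B \<in> \<B> \<Longrightarrow> x \<in> {y \<in> S. U y \<in> B} - Z B \<Longrightarrow> meets_small_cubes c x {y \<in> S. U y \<in> B}"
    by blast
  show ?thesis
  proof (rule that[of "\<Union>(Z ` \<B>)"])
    show "negligible (\<Union>(Z ` \<B>))" using Z(1) \<B>(1) by (intro negligible_countable_Union) auto
    fix x B assume x: "x \<in> S - \<Union>(Z ` \<B>)" and B: "open B" "U x \<in> B"
    obtain B' where B': "B' \<in> \<B>" "U x \<in> B'" "B' \<subseteq> B"
      using topological_basisE[OF \<B>(2) B] by blast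
    have "meets_small_cubes c x {y \<in> S. U y \<in> B'}" using Z(2)[OF B'(1)] x B'(1,2) by blast
    then show "meets_small_cubes c x {y \<in> S. U y \<in> B}"
      by (rule meets_small_cubes_mono) (use B' in auto)
  qed
qed

lemma meets_small_cubes_near:
  fixes x :: "'a::euclidean_space"
  assumes "meets_small_cubes c x E" "c > 0" "c \<le> 1" "e > 0"
  shows "\<not> negligible (E \<inter> ball x e)"
proof -
  obtain d where d: "d > 0" "\<And>h a. 0 < h \<Longrightarrow> h < d \<Longrightarrow>
      corner_cube a (c * h) \<subseteq> corner_cube x h \<Longrightarrow>
      \<not> negligible (corner_cube a (c * h) \<inter> E)"
    using assms(1) unfolding meets_small_cubes_def by metis
  have "eventually (\<lambda>h. corner_cube x h \<subseteq> ball x e \<and> h \<in> {0<..<d}) (at_right 0)"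
    using assms(4) d(1) by (intro eventually_conj corner_cube_eventually_subset eventually_at_right_real) auto
  from eventually_happens[OF this] obtain h where h: "corner_cube x h \<subseteq> ball x e" "0 < h" "h < d"
    by auto
  have "c * h \<le> h" using assms(3) h by simp
  then have sub: "corner_cube x (c * h) \<subseteq> corner_cube x h"
    by (intro subset_box_imp) (auto simp: inner_add_left)
  then have "\<not> negligible (corner_cube x (c * h) \<inter> E)" using d(2)[OF h(2,3)] by blast
  moreover have "corner_cube x (c * h) \<inter> E \<subseteq> E \<inter> ball x e" using sub h(1) by blast
  ultimately show ?thesis using negligible_subset by blast
qed

text \<open>
  If \<open>z\<close> were outside the hull, a hyperplane through \<open>z\<close> would have the points of \<open>E\<close> near \<open>x\<close> on one side.
  Take the coordinate direction \<open>i\<close> in which its normal is largest: a subcube shifted by \<open>h / 2\<close> along \<open>i\<close>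
  into the appropriate orthant lies strictly on the other side, yet it meets \<open>E\<close>.
\<close>

lemma meets_small_cubes_convex_hull:
  fixes x :: "'a::euclidean_space"
  assumes "meets_small_cubes (1 / (4 * DIM('a))) x E"
  obtains \<delta> :: real where "\<delta> > 0" "\<And>r z. 0 < r \<Longrightarrow> r < \<delta> \<Longrightarrow> norm (z - x) \<le> r \<Longrightarrow>
     z \<in> convex hull (E \<inter> cball x (8 * real DIM('a) ^ 2 * r))"
proof -
  define D where "D = real DIM('a)"
  have D: "D \<ge> 1" by (simp add: D_def Suc_leI)
  obtain d where d: "d > 0" and cubes: "\<forall>h a. 0 < h \<and> h < d \<and>
        (corner_cube a (1 / (4 * DIM('a)) * h) \<subseteq> corner_cube x h \<or>
         corner_cube a (1 / (4 * DIM('a)) * h) \<subseteq> cbox (x - h *\<^sub>R One) x) \<longrightarrow>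
        \<not> negligible (corner_cube a (1 / (4 * DIM('a)) * h) \<inter> E)"
    using assms unfolding meets_small_cubes_def by (elim exE conjE) (rule that)
  have meet: "corner_cube a (h / (4 * D)) \<inter> E \<noteq> {}"
    if "0 < h" "h < d" "corner_cube a (h / (4 * D)) \<subseteq> corner_cube x h \<or>
         corner_cube a (h / (4 * D)) \<subseteq> cbox (x - h *\<^sub>R One) x" for h a
  proof -
    have "1 / (4 * DIM('a)) * h = h / (4 * D)" by (simp add: D_def)
    then have "\<not> negligible (corner_cube a (h / (4 * D)) \<inter> E)"
      using cubes[rule_format, of h a] that by simp
    then show ?thesis by (metis negligible_empty)
  qed
  show ?thesis
  proof (rule that[of "d / (8 * D)"])
    show "d / (8 * D) > 0" using d D by simp
    fix r z assume r: "0 < r" "r < d / (8 * D)" and z: "norm (z - x) \<le> r"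
    \<comment> \<open>large enough that a functional moves by at most \<open>h / 8\<close> times its largest coefficient between \<open>x\<close> and \<open>z\<close>,
        against more than \<open>h / 4\<close> between \<open>x\<close> and the subcube\<close>
    define h where "h = 8 * D * r"
    define s where "s = h / (4 * D)"
    have h: "0 < h" "h < d" using r D by (auto simp: h_def field_simps)
    have s: "0 < s" "s \<le> h / 4" "D * s = h / 4"
      using h D by (auto simp: s_def field_simps)
    have pick: "\<exists>w\<in>E. w \<in> cball x (8 * D\<^sup>2 * r) \<and> (w - x) \<bullet> i * sg \<ge> h / 2 \<and>
        (\<forall>j\<in>Basis. j \<noteq> i \<longrightarrow> \<bar>(w - x) \<bullet> j\<bar> \<le> s)"
      if i: "i \<in> Basis" and sg: "sg = 1 \<or> sg = (-1)" for i sg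
    proof -
      define p where "p = (if sg = 1 then x + (h / 2) *\<^sub>R i else x - (h / 2) *\<^sub>R i - s *\<^sub>R One)"
      have pj: "(p - x) \<bullet> j = (if sg = 1 then (if j = i then h / 2 else 0) else - (if j = i then h / 2 else 0) - s)"
        if "j \<in> Basis" for j
        using that i sg by (auto simp: p_def inner_diff_left inner_add_left inner_Basis)
      have sub1: "corner_cube p s \<subseteq> corner_cube x h" if "sg = 1"
      proof (rule subset_box_imp, intro ballI)
        fix j :: 'a assume j: "j \<in> Basis"
        show "x \<bullet> j \<le> p \<bullet> j \<and> (p + s *\<^sub>R One) \<bullet> j \<le> (x + h *\<^sub>R One) \<bullet> j"
          using pj[OF j] that h s j by (auto simp: inner_diff_left inner_add_left split: if_splits)
      qed
      have sub2: "corner_cube p s \<subseteq> cbox (x - h *\<^sub>R One) x" if "sg = -1"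
      proof (rule subset_box_imp, intro ballI)
        fix j :: 'a assume j: "j \<in> Basis"
        show "(x - h *\<^sub>R One) \<bullet> j \<le> p \<bullet> j \<and> (p + s *\<^sub>R One) \<bullet> j \<le> x \<bullet> j"
          using pj[OF j] that h s j by (auto simp: inner_diff_left inner_add_left split: if_splits)
      qed
      obtain w where w: "w \<in> corner_cube p s" "w \<in> E"
        using meet[OF h, of p] sub1 sub2 sg unfolding s_def by blast
      have wj: "(p - x) \<bullet> j \<le> (w - x) \<bullet> j \<and> (w - x) \<bullet> j \<le> (p - x) \<bullet> j + s" if "j \<in> Basis" for j
        using w(1) that by (auto simp: mem_box inner_diff_left inner_add_left)
      have "norm (w - x) \<le> (\<Sum>b\<in>Basis. \<bar>(w - x) \<bullet> b\<bar>)" by (rule norm_le_l1)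
      also have "\<dots> \<le> (\<Sum>b\<in>(Basis::'a set). h)"
      proof (rule sum_mono)
        fix b :: 'a assume "b \<in> Basis"
        then show "\<bar>(w - x) \<bullet> b\<bar> \<le> h" using wj[of b] pj[of b] h s by (auto split: if_splits)
      qed
      also have "\<dots> = 8 * D\<^sup>2 * r" by (simp add: h_def D_def power2_eq_square)
      finally have "w \<in> cball x (8 * D\<^sup>2 * r)" by (simp add: dist_norm norm_minus_commute)
      moreover have "(w - x) \<bullet> i * sg \<ge> h / 2"
        using wj[OF i] pj[OF i] sg by auto
      moreover have "\<bar>(w - x) \<bullet> j\<bar> \<le> s" if "j \<in> Basis" "j \<noteq> i" for j
        using wj[OF that(1)] pj[OF that(1)] sg that(2) s by (auto split: if_splits)
      ultimately show ?thesis using w(2) by blast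
    qed
    let ?G = "E \<inter> cball x (8 * D\<^sup>2 * r)"
    have "z \<in> convex hull ?G"
    proof (rule ccontr)
      assume nz: "z \<notin> convex hull ?G"
      obtain i0 :: 'a where "i0 \<in> Basis" using nonempty_Basis by blast
      then have "?G \<noteq> {}" using pick[of i0 1] by blast
      then obtain a b where ab: "a \<noteq> 0" "\<forall>w\<in>{z}. a \<bullet> w \<le> b" "\<forall>w\<in>convex hull ?G. b \<le> a \<bullet> w"
        using separating_hyperplane_sets[of "{z}" "convex hull ?G"] nz by auto
      have sep: "a \<bullet> (z - x) \<le> a \<bullet> (w - x)" if "w \<in> ?G" for w
        using ab(2,3) hull_inc[OF that, of convex] by (force simp: inner_diff_right)
      define \<alpha> where "\<alpha> = Max ((\<lambda>j. \<bar>a \<bullet> j\<bar>) ` Basis)"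
      have le: "\<bar>a \<bullet> j\<bar> \<le> \<alpha>" if "j \<in> Basis" for j
        unfolding \<alpha>_def using that by (intro Max_ge) auto
      have "\<alpha> \<in> (\<lambda>j. \<bar>a \<bullet> j\<bar>) ` Basis" unfolding \<alpha>_def by (intro Max_in) auto
      then obtain i where i: "i \<in> Basis" "\<bar>a \<bullet> i\<bar> = \<alpha>" by auto
      have "\<alpha> > 0"
      proof (rule ccontr)
        assume "\<not> \<alpha> > 0"
        then have "a \<bullet> j = 0" if "j \<in> Basis" for j using le[OF that] by simp
        then show False using ab(1) by (metis euclidean_all_zero_iff)
      qed
      define sg where "sg = - sgn (a \<bullet> i)"
      have sg: "sg = 1 \<or> sg = -1" "a \<bullet> i = - sg * \<alpha>"
        using \<open>\<alpha> > 0\<close> i(2) by (auto simp: sg_def sgn_real_def abs_if split: if_splits)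
      obtain w where w: "w \<in> ?G" "(w - x) \<bullet> i * sg \<ge> h / 2"
          "\<And>j. j \<in> Basis \<Longrightarrow> j \<noteq> i \<Longrightarrow> \<bar>(w - x) \<bullet> j\<bar> \<le> s"
        using pick[OF i(1) sg(1)] by blast
      have "a \<bullet> (w - x) = (\<Sum>j\<in>Basis. (a \<bullet> j) * ((w - x) \<bullet> j))" by (rule euclidean_inner)
      also have "\<dots> = (a \<bullet> i) * ((w - x) \<bullet> i) + (\<Sum>j\<in>Basis - {i}. (a \<bullet> j) * ((w - x) \<bullet> j))"
        by (rule sum.remove) (use i in auto)
      also have "(a \<bullet> i) * ((w - x) \<bullet> i) = - (\<alpha> * ((w - x) \<bullet> i * sg))" by (simp add: sg(2))
      also have "- (\<alpha> * ((w - x) \<bullet> i * sg)) \<le> - (\<alpha> * (h / 2))" using w(2) \<open>\<alpha> > 0\<close> by simp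
      also have "(\<Sum>j\<in>Basis - {i}. (a \<bullet> j) * ((w - x) \<bullet> j)) \<le> (\<Sum>j\<in>Basis - {i}. \<alpha> * s)"
      proof (rule sum_mono)
        fix j assume j: "j \<in> Basis - {i}"
        have "(a \<bullet> j) * ((w - x) \<bullet> j) \<le> \<bar>a \<bullet> j\<bar> * \<bar>(w - x) \<bullet> j\<bar>" by (metis abs_ge_self abs_mult)
        also have "\<dots> \<le> \<alpha> * s" using j le w(3) \<open>\<alpha> > 0\<close> by (intro mult_mono) auto
        finally show "(a \<bullet> j) * ((w - x) \<bullet> j) \<le> \<alpha> * s" .
      qed
      also have "(\<Sum>j\<in>Basis - {i}. \<alpha> * s) = (D - 1) * (\<alpha> * s)"
        using i(1) by (simp add: D_def card_Diff_singleton of_nat_diff Suc_leI)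
      also have "- (\<alpha> * (h / 2)) + (D - 1) * (\<alpha> * s) < - (\<alpha> * h / 4)"
      proof -
        have "(D - 1) * (\<alpha> * s) = \<alpha> * (D * s) - \<alpha> * s" by (simp add: algebra_simps)
        also have "\<dots> < \<alpha> * (h / 4)" unfolding s(3) using s(1) \<open>\<alpha> > 0\<close> by simp
        finally show ?thesis by (simp add: algebra_simps)
      qed
      finally have up: "a \<bullet> (w - x) < - (\<alpha> * h / 4)" by simp
      have "a \<bullet> (z - x) = (\<Sum>j\<in>Basis. (a \<bullet> j) * ((z - x) \<bullet> j))" by (rule euclidean_inner)
      then have "- (a \<bullet> (z - x)) \<le> \<bar>\<Sum>j\<in>Basis. (a \<bullet> j) * ((z - x) \<bullet> j)\<bar>" by linarith
      also have "\<dots> \<le> (\<Sum>j\<in>Basis. \<bar>(a \<bullet> j) * ((z - x) \<bullet> j)\<bar>)" by (rule sum_abs)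
      also have "\<dots> \<le> (\<Sum>j\<in>(Basis::'a set). \<alpha> * r)"
      proof (rule sum_mono)
        fix j :: 'a assume j: "j \<in> Basis"
        have "\<bar>(z - x) \<bullet> j\<bar> \<le> r" using Basis_le_norm[OF j, of "z - x"] z by simp
        then show "\<bar>(a \<bullet> j) * ((z - x) \<bullet> j)\<bar> \<le> \<alpha> * r"
          unfolding abs_mult using le[OF j] \<open>\<alpha> > 0\<close> by (intro mult_mono) auto
      qed
      also have "\<dots> = \<alpha> * h / 8" by (simp add: h_def D_def)
      finally have "- (\<alpha> * h / 8) \<le> a \<bullet> (z - x)" by simp
      moreover have "\<alpha> * h > 0" using \<open>\<alpha> > 0\<close> h by simp
      ultimately show False using sep[OF w(1)] up by linarith
    qed
    then show "z \<in> convex hull (E \<inter> cball x (8 * real DIM('a) ^ 2 * r))" by (simp add: D_def)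
  qed
qed

section \<open>Extending jointly monotone fields to the whole domain\<close>

text \<open>
  The values \<open>w\<close> at the limit point need not be those of \<open>u\<close>: this serves the extension by cluster
  values as well as the passage from distinct to coinciding points.
\<close>

lemma cyclic_sum_field_form_limit:
  assumes "N \<ge> 1" "x \<in> pow_set \<Omega> N" "\<And>n. a n \<in> pow_set A N"
    and "\<And>j. j \<in> {1..N} \<Longrightarrow> (\<lambda>n. a n j) \<longlonglongrightarrow> x j"
    and "\<And>j l. j \<in> {1..N} \<Longrightarrow> l \<in> {1..N-1} \<Longrightarrow> (\<lambda>n. u l (a n j)) \<longlonglongrightarrow> w l (x j)"
    and "\<And>n. cyclic_sum N (field_form N u) (a n) \<le> 0"
  shows "cyclic_sum N (field_form N w) x \<le> 0"
proof -
  have m: "(i + l) mod N + 1 \<in> {1..N}" for i l using assms(1) by (auto simp: Suc_le_eq)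
  have "(\<lambda>n. cyclic_sum N (field_form N u) (a n)) \<longlonglongrightarrow> cyclic_sum N (field_form N w) x"
    unfolding cyclic_sum_field_form[OF assms(2,1)] cyclic_sum_field_form[OF assms(3,1)]
    by (intro tendsto_sum tendsto_inner tendsto_diff assms(4,5) m) auto
  then show ?thesis using assms(6) by (intro LIMSEQ_le_const2) auto
qed

lemma common_convergent_subsequence:
  fixes v :: "nat \<Rightarrow> nat \<Rightarrow> 'a::euclidean_space"
  assumes "\<And>l. l \<in> {1..M} \<Longrightarrow> bounded (range (v l))"
  shows "\<exists>r. strict_mono r \<and> (\<forall>l\<in>{1..M}. convergent (v l \<circ> r))"
  using assms
proof (induction M)
  case 0
  then show ?case by (intro exI[of _ id]) (auto simp: strict_mono_def)
next
  case (Suc M)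
  have "\<exists>r. strict_mono r \<and> (\<forall>l\<in>{1..M}. convergent (v l \<circ> r))"
    by (rule Suc.IH) (use Suc.prems in auto)
  then obtain r where r: "strict_mono r" "\<And>l. l \<in> {1..M} \<Longrightarrow> convergent (v l \<circ> r)" by blast
  have "bounded (range (v (Suc M) \<circ> r))"
    by (rule bounded_subset[OF Suc.prems[of "Suc M"]]) auto
  then obtain L s where s: "strict_mono s" "((v (Suc M) \<circ> r) \<circ> s) \<longlonglongrightarrow> L"
    using bounded_imp_convergent_subsequence by blast
  have "convergent (v l \<circ> (r \<circ> s))" if "l \<in> {1..Suc M}" for l
  proof (cases "l = Suc M")
    case True
    then show ?thesis using s(2) by (auto simp: convergent_def o_assoc)
  next
    case False
    then have "convergent ((v l \<circ> r) \<circ> s)" using that r(2)[of l] s(1) by (intro convergent_subseq_convergent[of "v l \<circ> r" s]) auto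
    then show ?thesis by (simp only: o_assoc)
  qed
  then show ?case using strict_mono_o[OF r(1) s(1)] by (intro exI[of _ "r \<circ> s"]) blast
qed

text \<open>
  Off \<open>A\<close>, the value of \<open>w\<close> is a simultaneous cluster value of the bounded fields along a sequence in \<open>A\<close>.
  Monotonicity is a closed condition on points and values, so it survives.
\<close>

lemma jointly_monotone_extension:
  fixes u :: "nat \<Rightarrow> 'a::euclidean_space \<Rightarrow> 'a"
  assumes "N \<ge> 1" "A \<subseteq> \<Omega>" "\<Omega> \<subseteq> closure A" "sub_antisymmetric N A (field_form N u)"
    and bd: "\<And>l. l \<in> {1..N-1} \<Longrightarrow> bounded (u l ` A)"
  obtains w where "\<And>l x. x \<in> A \<Longrightarrow> w l x = u l x" "\<And>l. l \<in> {1..N-1} \<Longrightarrow> bounded (w l ` \<Omega>)"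
    "sub_antisymmetric N \<Omega> (field_form N w)"
proof -
  have "\<forall>x\<in>\<Omega>. \<exists>p. (\<forall>n. fst p n \<in> A) \<and> fst p \<longlonglongrightarrow> x \<and>
      (\<forall>l\<in>{1..N-1}. (\<lambda>n. u l (fst p n)) \<longlonglongrightarrow> snd p l) \<and> (x \<in> A \<longrightarrow> snd p = (\<lambda>l. u l x))"
  proof
    fix x assume "x \<in> \<Omega>"
    show "\<exists>p. (\<forall>n. fst p n \<in> A) \<and> fst p \<longlonglongrightarrow> x \<and>
      (\<forall>l\<in>{1..N-1}. (\<lambda>n. u l (fst p n)) \<longlonglongrightarrow> snd p l) \<and> (x \<in> A \<longrightarrow> snd p = (\<lambda>l. u l x))"
    proof (cases "x \<in> A")
      case True
      then show ?thesis by (intro exI[of _ "(\<lambda>n. x, \<lambda>l. u l x)"]) auto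
    next
      case False
      have "x \<in> closure A" using \<open>x \<in> \<Omega>\<close> assms(3) by blast
      then obtain a where a: "\<And>n. a n \<in> A" "a \<longlonglongrightarrow> x"
        unfolding closure_sequential by blast
      have "bounded (range (\<lambda>n. u l (a n)))" if "l \<in> {1..N-1}" for l
        by (rule bounded_subset[OF bd[OF that]]) (use a in auto)
      then obtain r where r: "strict_mono r" "\<forall>l\<in>{1..N-1}. convergent ((\<lambda>n. u l (a n)) \<circ> r)"
        using common_convergent_subsequence[of "N-1" "\<lambda>l n. u l (a n)"] by auto
      then have "\<forall>l\<in>{1..N-1}. (\<lambda>n. u l ((a \<circ> r) n)) \<longlonglongrightarrow> lim (\<lambda>n. u l ((a \<circ> r) n))"
        by (auto simp: convergent_LIMSEQ_iff o_def)
      then show ?thesis using a r LIMSEQ_subseq_LIMSEQ[OF a(2) r(1)] False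
        by (intro exI[of _ "(a \<circ> r, \<lambda>l. lim (\<lambda>n. u l ((a \<circ> r) n)))"]) auto
    qed
  qed
  from bchoice[OF this] obtain p where p: "\<And>x n. x \<in> \<Omega> \<Longrightarrow> fst (p x) n \<in> A" "\<And>x. x \<in> \<Omega> \<Longrightarrow> fst (p x) \<longlonglongrightarrow> x"
      "\<And>x l. x \<in> \<Omega> \<Longrightarrow> l \<in> {1..N-1} \<Longrightarrow> (\<lambda>n. u l (fst (p x) n)) \<longlonglongrightarrow> snd (p x) l"
      "\<And>x. x \<in> \<Omega> \<Longrightarrow> x \<in> A \<Longrightarrow> snd (p x) = (\<lambda>l. u l x)"
    by blast
  show ?thesis
  proof (rule that[of "\<lambda>l x. snd (p x) l"])
    show "snd (p x) l = u l x" if "x \<in> A" for l x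
      using p(4)[of x] that assms(2) by auto
    show "bounded ((\<lambda>x. snd (p x) l) ` \<Omega>)" if l: "l \<in> {1..N-1}" for l
    proof (rule bounded_subset[OF bounded_closure[OF bd[OF l]]])
      show "(\<lambda>x. snd (p x) l) ` \<Omega> \<subseteq> closure (u l ` A)"
      proof
        fix v assume "v \<in> (\<lambda>x. snd (p x) l) ` \<Omega>"
        then obtain x where x: "x \<in> \<Omega>" "v = snd (p x) l" by auto
        have "\<And>n. u l (fst (p x) n) \<in> u l ` A" using p(1) x(1) by blast
        then show "v \<in> closure (u l ` A)"
          unfolding closure_sequential x(2) using p(3)[OF x(1) l]
          by (intro exI[of _ "\<lambda>n. u l (fst (p x) n)"]) blast
      qed
    qed
    show "sub_antisymmetric N \<Omega> (field_form N (\<lambda>l x. snd (p x) l))"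
      unfolding sub_antisymmetric_iff
    proof
      fix x assume x: "x \<in> pow_set \<Omega> N"
      have xj: "x j \<in> \<Omega>" if "j \<in> {1..N}" for j using x that by (auto simp: PiE_def)
      define a where "a n = (\<lambda>j\<in>{1..N}. fst (p (x j)) n)" for n
      have a: "a n \<in> pow_set A N" for n using p(1) xj by (auto simp: a_def)
      show "cyclic_sum N (field_form N (\<lambda>l x. snd (p x) l)) x \<le> 0"
      proof (rule cyclic_sum_field_form_limit[where a = a and u = u, OF assms(1) x a])
        show "cyclic_sum N (field_form N u) (a n) \<le> 0" for n
          using a assms(4) by (simp add: sub_antisymmetric_iff)
      qed (use p xj in \<open>auto simp: a_def\<close>)
    qed
  qed
qed

section \<open>The gradient on the diagonal\<close>

lemma field_form_comb:
  assumes "N \<ge> 1" "x 1 = y 1"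
  shows "field_form N u (\<lambda>i\<in>{1..N}. (1 - t) *\<^sub>R x i + t *\<^sub>R y i) =
    (1 - t) * field_form N u x + t * field_form N u y"
proof -
  have first: "(\<lambda>i\<in>{1..N}. (1 - t) *\<^sub>R x i + t *\<^sub>R y i) 1 = y 1"
    using assms by (simp add: scaleR_left_distrib[symmetric])
  show ?thesis
    unfolding field_form_def first sum_distrib_left sum.distrib[symmetric]
    by (rule sum.cong) (auto simp: assms(2)[unfolded One_nat_def] inner_simps algebra_simps)
qed

lemma convex_last_field_form: "N \<ge> 1 \<Longrightarrow> convex_last N \<Omega> (field_form N u)"
  unfolding convex_last_def by (simp add: field_form_comb del: One_nat_def)

text \<open>
  For each \<open>l\<close> the differences telescope around the cycle.
\<close>

lemma cyclic_sum_constant_field: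
  assumes "x \<in> pow_set A N" "N \<ge> 1"
  shows "cyclic_sum N (field_form N (\<lambda>l _. p l)) x = 0"
proof -
  have shift: "(\<Sum>i<N. x ((i + l) mod N + 1)) = (\<Sum>i<N. x (i + 1))" for l
  proof (induction l)
    case (Suc l)
    define g where "g i = x ((i + l) mod N + 1)" for i
    have "(\<Sum>i<N. x ((i + Suc l) mod N + 1)) = (\<Sum>i<N. g ((i + 1) mod N))"
      by (simp add: g_def mod_simps)
    also have "\<dots> = (\<Sum>i<N. g i)" by (rule sum_mod_shift)
    finally show ?case using Suc by (simp add: g_def)
  qed simp
  have "cyclic_sum N (field_form N (\<lambda>l _. p l)) x =
      (\<Sum>l=1..N-1. p l \<bullet> ((\<Sum>i<N. x ((i + l) mod N + 1)) - (\<Sum>i<N. x (i + 1))))"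
    unfolding cyclic_sum_field_form[OF assms] sum_subtractf[symmetric] inner_sum_right
    by (rule sum.swap)
  then show ?thesis by (simp only: shift) simp
qed

lemma convex_last_coordinate:
  assumes "convex \<Omega>" "convex_last N \<Omega> g" "y \<in> pow_set \<Omega> N" "j \<in> {2..N}"
  shows "convex_on \<Omega> (\<lambda>z. g (y(j := z)))"
proof (rule convex_onI[OF _ assms(1)])
  fix t v w assume t: "0 < t" "t < (1::real)" and vw: "v \<in> \<Omega>" "w \<in> \<Omega>"
  have pow: "y(j := z) \<in> pow_set \<Omega> N" if "z \<in> \<Omega>" for z
    using coordinate_update_in_pow_set[OF _ assms(3) that] assms(4) by auto
  have "y(j := (1 - t) *\<^sub>R v + t *\<^sub>R w) = (\<lambda>i\<in>{1..N}. (1 - t) *\<^sub>R (y(j := v)) i + t *\<^sub>R (y(j := w)) i)"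
    using assms(3,4) by (auto simp: fun_eq_iff PiE_def extensional_def scaleR_left_distrib[symmetric])
  then show "g (y(j := (1 - t) *\<^sub>R v + t *\<^sub>R w)) \<le> (1 - t) * g (y(j := v)) + t * g (y(j := w))"
    using assms(2)[unfolded convex_last_def, rule_format, of "y(j := v)" "y(j := w)" t] pow vw t assms(4)
    by simp
qed

text \<open>
  Convexity is used in one coordinate at a time: the bound passes from \<open>G\<close> to its hull in the
  coordinates \<open>2, \<dots>, k\<close> by induction on \<open>k\<close>.
\<close>

lemma convex_last_bound_on_hull:
  assumes "convex \<Omega>" "convex_last N \<Omega> g" "G \<subseteq> \<Omega>"
    and bound: "\<And>y. y \<in> pow_set \<Omega> N \<Longrightarrow> y 1 = a \<Longrightarrow> (\<And>j. j \<in> {2..N} \<Longrightarrow> y j \<in> G) \<Longrightarrow> g y \<le> b"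
    and y: "y \<in> pow_set \<Omega> N" "y 1 = a" "\<And>j. j \<in> {2..N} \<Longrightarrow> y j \<in> convex hull G"
  shows "g y \<le> b"
proof -
  have "g y \<le> b" if "y \<in> pow_set \<Omega> N" "y 1 = a" "\<And>j. j \<in> {2..N} \<Longrightarrow> y j \<in> (if j \<le> k then convex hull G else G)" for k y
    using that
  proof (induction k arbitrary: y)
    case 0
    then show ?case by (intro bound) auto
  next
    case (Suc k)
    show ?case
    proof (cases "Suc k \<in> {2..N}")
      case True
      have "g (y(Suc k := z)) \<le> b" if z: "z \<in> G" for z
      proof (rule Suc.IH)
        show "y(Suc k := z) \<in> pow_set \<Omega> N"
          using Suc.prems(1) True assms(3) z by (intro coordinate_update_in_pow_set) auto
        show "(y(Suc k := z)) j \<in> (if j \<le> k then convex hull G else G)" if "j \<in> {2..N}" for j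
          using Suc.prems(3)[of j] that z by (auto split: if_splits)
      qed (use True Suc.prems(2) in auto)
      moreover have "convex_on (convex hull G) (\<lambda>z. g (y(Suc k := z)))"
        using convex_last_coordinate[OF assms(1,2) Suc.prems(1) True] hull_minimal[OF assms(3), of convex] assms(1)
        by (auto intro: convex_on_subset)
      ultimately have "g (y(Suc k := y (Suc k))) \<le> b"
        using convex_on_convex_hull_bound[of G "\<lambda>z. g (y(Suc k := z))" b] Suc.prems(3)[OF True] by auto
      then show ?thesis by simp
    next
      case False
      show ?thesis
      proof (rule Suc.IH[OF Suc.prems(1,2)])
        fix j assume "j \<in> {2..N}"
        then show "y j \<in> (if j \<le> k then convex hull G else G)"
          using Suc.prems(3)[of j] False by (auto split: if_splits simp: le_Suc_eq)
      qed
    qed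
  qed
  from this[of y N] show ?thesis using y by auto
qed

text \<open>
  The diagonal is fixed by the shift, so sub-antisymmetry forces \<open>H \<le> 0\<close> there, while the form
  \<open>F\<^sub>w\<close> below \<open>H\<close> vanishes there.
\<close>

lemma zero_on_diag:
  assumes "N \<ge> 1" "x \<in> \<Omega>" "sub_antisymmetric N \<Omega> H" "\<And>y. y \<in> pow_set \<Omega> N \<Longrightarrow> field_form N w y \<le> H y"
  shows "H (diag N x) = 0"
proof -
  note d = diag_in_pow_set[OF assms(2), of N]
  have "N * H (diag N x) = cyclic_sum N H (diag N x)"
    using assms(1) by (simp add: cyclic_sum_def cyclic_shift_pow_diag of_nat_diff)
  also have "\<dots> \<le> 0" using assms(3) d by (simp add: sub_antisymmetric_iff)
  finally have "H (diag N x) \<le> 0" using assms(1) by (simp add: mult_le_0_iff)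
  moreover have "H (diag N x) \<ge> 0" using assms(4)[OF d] field_form_diag[OF assms(1), of w x] by simp
  ultimately show ?thesis by simp
qed

text \<open>
  Sub-antisymmetry of \<open>H\<close> and \<open>F\<^sub>w \<le> H\<close> on the proper shifts bound the gap by the negated cyclic sum of \<open>F\<^sub>w\<close>.
  That sum does not change if a constant field \<open>p\<close> is subtracted, and what remains is a product
  of two small factors.
\<close>

lemma gap_le_at_close_points:
  fixes w :: "nat \<Rightarrow> 'a::euclidean_space \<Rightarrow> 'a"
  assumes "N \<ge> 1" "sub_antisymmetric N \<Omega> H"
    and "\<And>y. y \<in> pow_set \<Omega> N \<Longrightarrow> field_form N w y \<le> H y"
    and y: "y \<in> pow_set \<Omega> N" and "\<eta> \<ge> 0" "\<rho> \<ge> 0"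
    and close: "\<And>j l. j \<in> {1..N} \<Longrightarrow> l \<in> {1..N-1} \<Longrightarrow> norm (w l (y j) - p l) \<le> \<eta>"
    and near: "\<And>j. j \<in> {1..N} \<Longrightarrow> norm (y j - x) \<le> \<rho>"
  shows "H y - field_form N w y \<le> real N ^ 2 * \<eta> * (2 * \<rho>)"
proof -
  have m: "(i + l) mod N + 1 \<in> {1..N}" for i l using assms(1) by (auto simp: Suc_le_eq)
  have "H y + proper_cyclic_sum N (field_form N w) y \<le> H y + proper_cyclic_sum N H y"
    using proper_cyclic_sum_mono[OF assms(3) y] by simp
  also have "\<dots> = cyclic_sum N H y" by (rule cyclic_sum_split[OF assms(1), symmetric])
  also have "\<dots> \<le> 0" using assms(2) y by (simp add: sub_antisymmetric_iff)
  finally have "H y - field_form N w y \<le> - cyclic_sum N (field_form N w) y"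
    using cyclic_sum_split[OF assms(1), of "field_form N w" y] by simp
  also have "\<dots> = cyclic_sum N (field_form N (\<lambda>l _. p l)) y - cyclic_sum N (field_form N w) y"
    by (simp add: cyclic_sum_constant_field[OF y assms(1)])
  also have "\<dots> = (\<Sum>i<N. \<Sum>l=1..N-1. (p l - w l (y (i + 1))) \<bullet> (y ((i + l) mod N + 1) - y (i + 1)))"
    unfolding cyclic_sum_field_form[OF y assms(1)] sum_subtractf[symmetric] inner_diff_left ..
  also have "\<dots> \<le> (\<Sum>i<N. \<Sum>l=1..N-1. \<eta> * (2 * \<rho>))"
  proof (intro sum_mono)
    fix i l assume il: "i \<in> {..<N}" "l \<in> {1..N-1}"
    have "norm (p l - w l (y (i + 1))) \<le> \<eta>"
      using close[of "i + 1" l] il by (simp add: norm_minus_commute)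
    moreover have "norm (y ((i + l) mod N + 1) - y (i + 1)) \<le> norm (y ((i + l) mod N + 1) - x) + norm (y (i + 1) - x)"
      using norm_triangle_ineq4[of "y ((i + l) mod N + 1) - x" "y (i + 1) - x"] by simp
    then have "norm (y ((i + l) mod N + 1) - y (i + 1)) \<le> 2 * \<rho>"
      using near[OF m[of i l]] near[of "i + 1"] il by simp
    ultimately have "norm (p l - w l (y (i + 1))) * norm (y ((i + l) mod N + 1) - y (i + 1)) \<le> \<eta> * (2 * \<rho>)"
      using assms(5,6) by (intro mult_mono) auto
    then show "(p l - w l (y (i + 1))) \<bullet> (y ((i + l) mod N + 1) - y (i + 1)) \<le> \<eta> * (2 * \<rho>)"
      using norm_cauchy_schwarz order_trans by blast
  qed
  also have "\<dots> = real N * real (N - 1) * (\<eta> * (2 * \<rho>))"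
    using assms(1) by (simp add: of_nat_diff)
  also have "\<dots> \<le> real N * real N * (\<eta> * (2 * \<rho>))"
    using assms(5,6) by (intro mult_right_mono mult_left_mono) auto
  finally show ?thesis by (simp add: power2_eq_square algebra_simps)
qed

theorem has_gradient_last_at_approximate_continuity:
  fixes w :: "nat \<Rightarrow> 'a::euclidean_space \<Rightarrow> 'a"
  assumes "N \<ge> 1" "convex \<Omega>" "x \<in> \<Omega>" "admissible N \<Omega> H"
    and ge: "\<And>y. y \<in> pow_set \<Omega> N \<Longrightarrow> field_form N w y \<le> H y"
    and approx: "\<And>\<epsilon>. \<epsilon> > 0 \<Longrightarrow> meets_small_cubes (1 / (4 * DIM('a))) x
      {y \<in> \<Omega>. \<forall>l\<in>{1..N-1}. norm (w l y - w l x) < \<epsilon>}"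
  shows "has_gradient_last N \<Omega> H x (\<lambda>l. w l x)"
  unfolding has_gradient_last_def
proof (intro allI impI)
  fix \<epsilon> :: real assume "\<epsilon> > 0"
  define C where "C = 8 * real DIM('a) ^ 2"
  have "1 \<le> real DIM('a) ^ 2" by (intro one_le_power) (simp add: Suc_leI)
  then have C: "C \<ge> 1" unfolding C_def by linarith
  \<comment> \<open>chosen to give \<open>\<epsilon> * r\<close> in \<open>gap_le_at_close_points\<close> with radius \<open>C * r\<close>\<close>
  define \<eta> where "\<eta> = \<epsilon> / (2 * C * N\<^sup>2)"
  have \<eta>: "\<eta> > 0" "real N ^ 2 * \<eta> * (2 * C) = \<epsilon>"
    using \<open>\<epsilon> > 0\<close> C assms(1) by (auto simp: \<eta>_def field_simps)
  define E where "E = {y \<in> \<Omega>. \<forall>l\<in>{1..N-1}. norm (w l y - w l x) < \<eta>}"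
  obtain \<delta> where \<delta>: "\<delta> > 0" "\<And>r z. 0 < r \<Longrightarrow> r < \<delta> \<Longrightarrow> norm (z - x) \<le> r \<Longrightarrow>
     z \<in> convex hull (E \<inter> cball x (C * r))"
    using meets_small_cubes_convex_hull[OF approx[OF \<eta>(1), folded E_def]] unfolding C_def by blast
  define g where "g y = H y - field_form N w y" for y
  have conv: "convex_last N \<Omega> g"
    unfolding convex_last_def
  proof (intro ballI impI)
    fix y z t assume "y \<in> pow_set \<Omega> N" "z \<in> pow_set \<Omega> N" "t \<in> {0..1::real}" "y 1 = z 1"
    then have "H (\<lambda>i\<in>{1..N}. (1 - t) *\<^sub>R y i + t *\<^sub>R z i) \<le> (1 - t) * H y + t * H z"
      using assms(4) unfolding admissible_def convex_last_def by blast
    then show "g (\<lambda>i\<in>{1..N}. (1 - t) *\<^sub>R y i + t *\<^sub>R z i) \<le> (1 - t) * g y + t * g z"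
      unfolding g_def field_form_comb[where x = y and y = z, OF assms(1) \<open>y 1 = z 1\<close>] by (simp add: algebra_simps)
  qed
  have sub: "sub_antisymmetric N \<Omega> H" using assms(4) by (simp add: admissible_def)
  have diag0: "H (diag N x) = 0" by (rule zero_on_diag[OF assms(1,3) sub ge])
  have "\<bar>H y - H (diag N x) - (\<Sum>l=1..N-1. w l x \<bullet> (y (l + 1) - x))\<bar>
      \<le> \<epsilon> * L2_set (\<lambda>l. norm (y (l + 1) - x)) {1..N-1}"
    if y: "y \<in> pow_set \<Omega> N" "y 1 = x" "L2_set (\<lambda>l. norm (y (l + 1) - x)) {1..N-1} < \<delta>" for y
  proof -
    define r where "r = L2_set (\<lambda>l. norm (y (l + 1) - x)) {1..N-1}"
    have yr: "norm (y j - x) \<le> r" if "j \<in> {1..N}" for j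
    proof (cases "j = 1")
      case True
      then show ?thesis using y(2) by (simp add: r_def L2_set_nonneg)
    next
      case False
      then have "j - 1 \<in> {1..N-1}" "j - 1 + 1 = j" using that by auto
      then show ?thesis
        unfolding r_def using member_le_L2_set[of "{1..N-1}" "j - 1" "\<lambda>l. norm (y (l + 1) - x)"] by simp
    qed
    have g_eq: "g y = H y - H (diag N x) - (\<Sum>l=1..N-1. w l x \<bullet> (y (l + 1) - x))"
      by (simp add: g_def diag0 field_form_def y(2)[unfolded One_nat_def])
    have "g y \<le> \<epsilon> * r"
    proof (cases "r = 0")
      case True
      then have "y = diag N x"
        using yr y(1) by (auto simp: diag_def fun_eq_iff PiE_def extensional_def)
      then show ?thesis using True diag0 field_form_diag[OF assms(1), of w x] by (simp add: g_def)
    next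
      case False
      then have r: "0 < r" "r < \<delta>" using y(3) L2_set_nonneg[of _ "{1..N-1}"] by (auto simp: r_def less_le)
      show ?thesis
      proof (rule convex_last_bound_on_hull[OF assms(2) conv _ _ y(1,2)])
        show "E \<inter> cball x (C * r) \<subseteq> \<Omega>" by (auto simp: E_def)
        show "y j \<in> convex hull (E \<inter> cball x (C * r))" if "j \<in> {2..N}" for j
          using \<delta>(2)[OF r yr[of j]] that by auto
        fix z assume z: "z \<in> pow_set \<Omega> N" "z 1 = x" "\<And>j. j \<in> {2..N} \<Longrightarrow> z j \<in> E \<inter> cball x (C * r)"
        have xE: "x \<in> E \<inter> cball x (C * r)" using assms(3) \<eta>(1) r C by (auto simp: E_def)
        have zE: "z j \<in> E \<inter> cball x (C * r)" if "j \<in> {1..N}" for j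
        proof (cases "j = 1")
          case True
          then show ?thesis using xE z(2) by simp
        next
          case False
          then show ?thesis using z(3)[of j] that by auto
        qed
        have "g z \<le> real N ^ 2 * \<eta> * (2 * (C * r))"
          unfolding g_def
        proof (rule gap_le_at_close_points[OF assms(1) sub ge z(1), where p = "\<lambda>l. w l x" and x = x])
          show "norm (w l (z j) - w l x) \<le> \<eta>" if "j \<in> {1..N}" "l \<in> {1..N-1}" for j l
            using zE[OF that(1)] that(2) by (auto simp: E_def less_imp_le)
          show "norm (z j - x) \<le> C * r" if "j \<in> {1..N}" for j
            using zE[OF that] by (simp add: dist_norm norm_minus_commute)
        qed (use \<eta> r C in auto)
        also have "\<dots> = \<epsilon> * r" using \<eta>(2) by (metis mult.assoc)
        finally show "g z \<le> \<epsilon> * r" .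
      qed
    qed
    moreover have "g y \<ge> 0" using ge[OF y(1)] by (simp add: g_def)
    ultimately show ?thesis unfolding g_eq r_def by simp
  qed
  then show "\<exists>\<delta>>0. \<forall>y\<in>pow_set \<Omega> N.
        y 1 = x \<and> L2_set (\<lambda>l. norm (y (l + 1) - x)) {1..N-1} < \<delta> \<longrightarrow>
        \<bar>H y - H (diag N x) - (\<Sum>l=1..N-1. w l x \<bullet> (y (l + 1) - x))\<bar>
          \<le> \<epsilon> * L2_set (\<lambda>l. norm (y (l + 1) - x)) {1..N-1}"
    using \<delta>(1) by blast
qed

text \<open>
  The slope at the diagonal point bounds a convex function from below along each segment.
\<close>

lemma field_form_le_if_gradient:
  fixes \<Omega> :: "'a::euclidean_space set"
  assumes "N \<ge> 1" "convex \<Omega>" "x \<in> \<Omega>" "convex_last N \<Omega> H" "H (diag N x) = 0"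
    and grad: "has_gradient_last N \<Omega> H x (\<lambda>l. u l x)" and y: "y \<in> pow_set \<Omega> N" "y 1 = x"
  shows "field_form N u y \<le> H y"
proof -
  define L where "L = L2_set (\<lambda>l. norm (y (l + 1) - x)) {1..N-1}"
  have L: "L \<ge> 0" by (simp add: L_def L2_set_nonneg)
  have step: "field_form N u y \<le> H y + \<epsilon> * L" if "\<epsilon> > 0" for \<epsilon>
  proof -
    obtain \<delta> where \<delta>: "\<delta> > 0" "\<And>y. y \<in> pow_set \<Omega> N \<Longrightarrow>
        y 1 = x \<Longrightarrow> L2_set (\<lambda>l. norm (y (l + 1) - x)) {1..N-1} < \<delta> \<Longrightarrow>
        \<bar>H y - H (diag N x) - (\<Sum>l=1..N-1. u l x \<bullet> (y (l + 1) - x))\<bar>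
          \<le> \<epsilon> * L2_set (\<lambda>l. norm (y (l + 1) - x)) {1..N-1}"
      using grad \<open>\<epsilon> > 0\<close> unfolding has_gradient_last_def by blast
    \<comment> \<open>a point of the segment close enough to the diagonal for the expansion to apply; the \<open>+ 1\<close> covers \<open>L = 0\<close>\<close>
    define t where "t = min 1 (\<delta> / (2 * (L + 1)))"
    have t: "0 < t" "t \<le> 1" "t * L < \<delta>"
    proof -
      show "0 < t" "t \<le> 1" using \<delta>(1) L by (auto simp: t_def)
      have "t * L \<le> \<delta> / (2 * (L + 1)) * L" using L by (intro mult_right_mono) (auto simp: t_def)
      also have "\<dots> < \<delta>"
      proof -
        have "0 < L * \<delta> + \<delta> * 2" using L \<delta>(1) by (intro add_nonneg_pos) auto
        then show ?thesis using L by (simp add: field_simps)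
      qed
      finally show "t * L < \<delta>" .
    qed
    define z where "z = (\<lambda>i\<in>{1..N}. (1 - t) *\<^sub>R diag N x i + t *\<^sub>R y i)"
    have dx: "diag N x 1 = y 1" using assms(1) y(2) by (simp add: diag_def)
    have z: "z \<in> pow_set \<Omega> N"
      unfolding z_def using t by (intro convex_comb_in_pow_set[OF assms(2) diag_in_pow_set[OF assms(3)] y(1)]) auto
    have z1: "z 1 = x"
      using assms(1) y(2) by (simp add: z_def diag_def scaleR_left_distrib[symmetric])
    have zl: "z (l + 1) - x = t *\<^sub>R (y (l + 1) - x)" if "l \<in> {1..N-1}" for l
      using that by (auto simp: z_def diag_def algebra_simps)
    have zL: "L2_set (\<lambda>l. norm (z (l + 1) - x)) {1..N-1} = t * L"
      unfolding L_def L2_set_right_distrib[OF less_imp_le[OF t(1)]]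
      by (rule L2_set_cong) (use zl t in auto)
    have "t * field_form N u y = (\<Sum>l=1..N-1. u l x \<bullet> (z (l + 1) - x))"
      unfolding field_form_def sum_distrib_left y(2) by (rule sum.cong) (simp_all add: zl del: One_nat_def)
    also have "\<dots> \<le> H z + \<epsilon> * (t * L)"
      using \<delta>(2)[OF z z1, unfolded zL] t(3) assms(5) by linarith
    also have "H z \<le> (1 - t) * H (diag N x) + t * H y"
      using assms(4)[unfolded convex_last_def, rule_format, of "diag N x" y t] t y(1)
        diag_in_pow_set[OF assms(3), of N] dx by (simp add: z_def)
    finally have "t * field_form N u y \<le> t * (H y + \<epsilon> * L)" using assms(5) by (simp add: algebra_simps)
    then show ?thesis using t(1) by simp
  qed
  show ?thesis
  proof (rule field_le_epsilon)
    fix e :: real assume "e > 0"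
    then have "field_form N u y \<le> H y + e / (L + 1) * L" using L by (intro step) auto
    also have "e / (L + 1) * L \<le> e" using L \<open>e > 0\<close> by (simp add: field_simps)
    finally show "field_form N u y \<le> H y + e" by simp
  qed
qed

section \<open>Normalized Lebesgue measure and periodic maps\<close>

lemma common_bound:
  fixes \<Omega> :: "'a::real_normed_vector set" and w :: "nat \<Rightarrow> 'a \<Rightarrow> 'a"
  assumes "bounded \<Omega>" "\<And>l. l \<in> {1..N-1} \<Longrightarrow> bounded (w l ` \<Omega>)"
  obtains C where "0 \<le> C" "\<And>x. x \<in> \<Omega> \<Longrightarrow> norm x \<le> C"
    "\<And>l x. l \<in> {1..N-1} \<Longrightarrow> x \<in> \<Omega> \<Longrightarrow> norm (w l x) \<le> C"
proof -
  have "bounded (\<Omega> \<union> (\<Union>l\<in>{1..N-1}. w l ` \<Omega>))"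
    using assms by (intro bounded_Un[THEN iffD2] conjI bounded_UN) auto
  then obtain C where C: "\<And>y. y \<in> \<Omega> \<union> (\<Union>l\<in>{1..N-1}. w l ` \<Omega>) \<Longrightarrow> norm y \<le> C" by (auto simp: bounded_iff)
  show ?thesis
  proof (rule that[of "max C 0"])
    show "norm x \<le> max C 0" if "x \<in> \<Omega>" for x using C[of x] that by (simp add: le_max_iff_disj)
    show "norm (w l x) \<le> max C 0" if "l \<in> {1..N-1}" "x \<in> \<Omega>" for l x
    proof -
      have "w l x \<in> \<Omega> \<union> (\<Union>l\<in>{1..N-1}. w l ` \<Omega>)" using that by blast
      from C[OF this] show ?thesis by simp
    qed
  qed simp
qed

lemma field_form_le:
  assumes "N \<ge> 1" "x \<in> pow_set \<Omega> N" "0 \<le> C" "\<And>x. x \<in> \<Omega> \<Longrightarrow> norm x \<le> C"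
    "\<And>l x. l \<in> {1..N-1} \<Longrightarrow> x \<in> \<Omega> \<Longrightarrow> norm (w l x) \<le> C"
  shows "\<bar>field_form N w x\<bar> \<le> real N * (C * (2 * C))"
proof -
  have x: "x j \<in> \<Omega>" if "j \<in> {1..N}" for j using assms(2) that by (auto simp: PiE_def)
  have "\<bar>field_form N w x\<bar> \<le> (\<Sum>l=1..N-1. \<bar>w l (x 1) \<bullet> (x (l + 1) - x 1)\<bar>)"
    unfolding field_form_def by (rule sum_abs)
  also have "\<dots> \<le> (\<Sum>l=1..N-1. C * (2 * C))"
  proof (rule sum_mono)
    fix l assume l: "l \<in> {1..N-1}"
    have "norm (x (l + 1) - x 1) \<le> norm (x (l + 1)) + norm (x 1)" by (rule norm_triangle_ineq4)
    also have "\<dots> \<le> C + C" using l assms(1) by (intro add_mono assms(4) x) auto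
    finally have "norm (x (l + 1) - x 1) \<le> 2 * C" by simp
    moreover have "norm (w l (x 1)) \<le> C" using l assms(1) by (intro assms(5) x) auto
    ultimately have "norm (w l (x 1)) * norm (x (l + 1) - x 1) \<le> C * (2 * C)"
      using assms(3) by (intro mult_mono) auto
    then show "\<bar>w l (x 1) \<bullet> (x (l + 1) - x 1)\<bar> \<le> C * (2 * C)"
      using Cauchy_Schwarz_ineq2 order_trans by blast
  qed
  also have "\<dots> \<le> real N * (C * (2 * C))" using assms(3) by (simp add: mult_right_mono)
  finally show ?thesis .
qed

locale bounded_fields =
  fixes N :: nat and \<Omega> :: "'a::euclidean_space set" and \<mu> :: "'a measure" and u :: "nat \<Rightarrow> 'a \<Rightarrow> 'a"
  assumes N: "N \<ge> 2"
    and nonempty: "\<Omega> \<noteq> {}" and open_domain: "open \<Omega>" and bounded_domain: "bounded \<Omega>"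
    and convex_domain: "convex \<Omega>"
    and mu: "\<mu> = normalized_lebesgue \<Omega>"
    and u_measurable: "\<And>l. l \<in> {1..N-1} \<Longrightarrow> u l \<in> borel_measurable (lebesgue_on \<Omega>)"
    and u_bounded: "\<And>l. l \<in> {1..N-1} \<Longrightarrow> bounded (u l ` \<Omega>)"
begin

lemma N1: "N \<ge> 1" using N by simp

lemma domain_lmeasurable: "\<Omega> \<in> lmeasurable"
  using open_domain bounded_domain by (rule lmeasurable_open[rotated])

lemma domain_measure_pos: "measure lebesgue \<Omega> > 0"
  using open_not_negligible[OF open_domain nonempty] domain_lmeasurable
  by (simp add: negligible_iff_measure0 zero_less_measure_iff)

lemma emeasure_lebesgue_on_domain:
  "emeasure (lebesgue_on \<Omega>) \<Omega> = ennreal (measure lebesgue \<Omega>)"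
  using domain_lmeasurable by (simp add: emeasure_restrict_space emeasure_eq_measure2 fmeasurableD)

lemma space_mu: "space \<mu> = \<Omega>"
  by (simp add: mu normalized_lebesgue_def)

lemma sets_mu: "sets \<mu> = sets (lebesgue_on \<Omega>)"
  by (simp add: mu normalized_lebesgue_def)

lemma in_sets_mu: "A \<in> sets \<mu> \<longleftrightarrow> A \<in> sets lebesgue \<and> A \<subseteq> \<Omega>"
  using domain_lmeasurable by (auto simp: sets_mu sets_restrict_space_iff fmeasurableD)

lemma measurable_mu: "f \<in> measurable \<mu> M \<longleftrightarrow> f \<in> measurable (lebesgue_on \<Omega>) M"
  by (simp add: measurable_cong_sets[OF sets_mu refl])

lemma prob_space_mu: "prob_space \<mu>"
  unfolding mu normalized_lebesgue_def
  by (rule prob_space_uniform_measure) (use emeasure_lebesgue_on_domain domain_measure_pos in auto)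

lemma emeasure_mu:
  assumes "A \<in> sets \<mu>"
  shows "emeasure \<mu> A = emeasure lebesgue A / emeasure lebesgue \<Omega>"
proof -
  have A: "A \<subseteq> \<Omega>" "A \<in> sets lebesgue" using assms in_sets_mu by auto
  then have "emeasure \<mu> A = emeasure (lebesgue_on \<Omega>) A / emeasure (lebesgue_on \<Omega>) \<Omega>"
    using assms unfolding sets_mu
    by (simp add: mu normalized_lebesgue_def Int_absorb1)
  then show ?thesis using A domain_lmeasurable by (simp add: emeasure_restrict_space fmeasurableD)
qed

lemma AE_mu_iff: "(AE x in \<mu>. P x) \<longleftrightarrow> (\<exists>Z. negligible Z \<and> (\<forall>x\<in>\<Omega> - Z. P x))"
proof -
  have "(AE x in \<mu>. P x) \<longleftrightarrow> (AE x in lebesgue_on \<Omega>. x \<in> \<Omega> \<longrightarrow> P x)"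
    unfolding mu normalized_lebesgue_def
    by (rule AE_uniform_measure) (use emeasure_lebesgue_on_domain domain_measure_pos in auto)
  also have "\<dots> \<longleftrightarrow> (AE x in lebesgue. x \<in> \<Omega> \<longrightarrow> P x)"
    using domain_lmeasurable by (subst AE_restrict_space_iff) (auto simp: fmeasurableD)
  also have "\<dots> \<longleftrightarrow> (\<exists>Z. negligible Z \<and> (\<forall>x\<in>\<Omega> - Z. P x))"
  proof
    assume "AE x in lebesgue. x \<in> \<Omega> \<longrightarrow> P x"
    then obtain Z where "Z \<in> null_sets lebesgue" "{x \<in> space lebesgue. \<not> (x \<in> \<Omega> \<longrightarrow> P x)} \<subseteq> Z"
      by (auto simp: eventually_ae_filter)
    then show "\<exists>Z. negligible Z \<and> (\<forall>x\<in>\<Omega> - Z. P x)"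
      by (intro exI[of _ Z]) (auto simp: negligible_iff_null_sets)
  next
    assume "\<exists>Z. negligible Z \<and> (\<forall>x\<in>\<Omega> - Z. P x)"
    then show "AE x in lebesgue. x \<in> \<Omega> \<longrightarrow> P x"
      by (auto simp: negligible_iff_null_sets intro!: AE_I')
  qed
  finally show ?thesis .
qed

lemma u_mu [measurable]: "l \<in> {1..N-1} \<Longrightarrow> u l \<in> borel_measurable \<mu>"
  using u_measurable by (simp add: measurable_mu)

lemma id_mu [measurable]: "(\<lambda>x. x) \<in> borel_measurable \<mu>"
  unfolding measurable_mu by (intro measurable_restrict_space1 measurable_completion) simp

text \<open>
  A common bound for \<open>\<Omega>\<close> and the fields, fixed once for all integrability arguments.
\<close>

definition bound :: real where
  "bound = (SOME C. 0 \<le> C \<and> (\<forall>x\<in>\<Omega>. norm x \<le> C) \<and> (\<forall>l\<in>{1..N-1}. \<forall>x\<in>\<Omega>. norm (u l x) \<le> C))"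

lemma bound: "0 \<le> bound" "x \<in> \<Omega> \<Longrightarrow> norm x \<le> bound" "l \<in> {1..N-1} \<Longrightarrow> x \<in> \<Omega> \<Longrightarrow> norm (u l x) \<le> bound"
proof -
  obtain C where "0 \<le> C \<and> (\<forall>x\<in>\<Omega>. norm x \<le> C) \<and> (\<forall>l\<in>{1..N-1}. \<forall>x\<in>\<Omega>. norm (u l x) \<le> C)"
    by (rule common_bound[where w = u and N = N, OF bounded_domain u_bounded]) blast+
  then have "0 \<le> bound \<and> (\<forall>x\<in>\<Omega>. norm x \<le> bound) \<and> (\<forall>l\<in>{1..N-1}. \<forall>x\<in>\<Omega>. norm (u l x) \<le> bound)"
    unfolding bound_def by (rule someI)
  then show "0 \<le> bound" "x \<in> \<Omega> \<Longrightarrow> norm x \<le> bound" "l \<in> {1..N-1} \<Longrightarrow> x \<in> \<Omega> \<Longrightarrow> norm (u l x) \<le> bound"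
    by auto
qed

lemma field_form_bounded:
  "x \<in> pow_set \<Omega> N \<Longrightarrow> \<bar>field_form N u x\<bar> \<le> real N * (bound * (2 * bound))"
  by (rule field_form_le[OF N1 _ bound])

abbreviation product_space :: "(nat \<Rightarrow> 'a) measure" where
  "product_space \<equiv> Pi\<^sub>M {1..N} (\<lambda>_. \<mu>)"

lemma space_product: "space product_space = pow_set \<Omega> N"
  by (simp add: space_PiM space_mu)

lemma measurable_field_form: "field_form N u \<in> borel_measurable product_space"
proof -
  have c: "(\<lambda>x. x j) \<in> measurable product_space \<mu>" if "j \<in> {1..N}" for j
    by (rule measurable_component_singleton[OF that])
  have cb: "(\<lambda>x. x j) \<in> borel_measurable product_space" if "j \<in> {1..N}" for j
    using measurable_compose[OF c[OF that] id_mu] .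
  have ub: "(\<lambda>x. u l (x j)) \<in> borel_measurable product_space" if "j \<in> {1..N}" "l \<in> {1..N-1}" for j l
    using measurable_compose[OF c[OF that(1)] u_mu[OF that(2)]] .
  show ?thesis
    unfolding field_form_def[abs_def]
    by (intro borel_measurable_sum borel_measurable_inner borel_measurable_diff ub cb) (use N1 in auto)
qed

lemma measurable_cyclic_shift: "cyclic_shift N \<in> measurable product_space product_space"
  unfolding cyclic_shift_def[abs_def]
proof (rule measurable_restrict)
  fix i assume "i \<in> {1..N}"
  then show "(\<lambda>x. if i = N then x 1 else x (i + 1)) \<in> measurable product_space \<mu>"
    by (cases "i = N") (auto intro!: measurable_component_singleton)
qed

lemma sym_plan_integral_shift:
  fixes h :: "(nat \<Rightarrow> 'a) \<Rightarrow> real"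
  assumes p: "p \<in> sym_plans N \<mu>" and h: "h \<in> borel_measurable product_space"
    and B: "\<And>x. x \<in> pow_set \<Omega> N \<Longrightarrow> \<bar>h x\<bar> \<le> B"
  shows "integrable p (\<lambda>x. h ((cyclic_shift N ^^ i) x)) \<and>
    (\<integral>x. h ((cyclic_shift N ^^ i) x) \<partial>p) = (\<integral>x. h x \<partial>p)"
proof (induction i)
  have sets_p: "sets p = sets product_space" and "prob_space p" and inv: "shift_invariant N p"
    using p by (auto simp: sym_plans_def)
  interpret P: prob_space p by fact
  have space_p: "space p = pow_set \<Omega> N" using sets_eq_imp_space_eq[OF sets_p] space_product by simp
  have meas: "(\<lambda>x. h ((cyclic_shift N ^^ i) x)) \<in> borel_measurable p" for i
  proof -
    have "(cyclic_shift N ^^ i) \<in> measurable product_space product_space"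
    proof (induction i)
      case (Suc i)
      then show ?case using measurable_comp[OF Suc measurable_cyclic_shift] by (simp add: o_def)
    qed simp
    from measurable_compose[OF this h] show ?thesis
      by (simp add: measurable_cong_sets[OF sets_p refl])
  qed
  have int: "integrable p (\<lambda>x. h ((cyclic_shift N ^^ i) x))" for i
    using B[OF cyclic_shift_pow_in_pow_set]
    by (intro P.integrable_const_bound[where B = B] meas AE_I2) (auto simp: space_p)
  {
    case 0
    show ?case using int[of 0] by simp
  next
    case (Suc i)
    have "(\<integral>x. h ((cyclic_shift N ^^ i) x) \<partial>p) = (\<integral>x. h ((cyclic_shift N ^^ i) (cyclic_shift N x)) \<partial>p)"
      using inv int[of i] unfolding shift_invariant_def by blast
    then show ?case using Suc int[of "Suc i"] by (simp add: funpow_Suc_right del: funpow.simps)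
  }
qed

text \<open>
  The first coordinate avoids a null set because the first marginal is \<open>\<mu>\<close>; invariance under the shift moves
  this to the other coordinates.
\<close>

lemma sym_plan_AE_coordinates:
  assumes p: "p \<in> sym_plans N \<mu>" and Z: "negligible Z"
  shows "AE x in p. \<forall>j\<in>{1..N}. x j \<notin> Z"
proof -
  have sets_p: "sets p = sets product_space" and "prob_space p" and marg: "distr p \<mu> (\<lambda>x. x 1) = \<mu>"
    using p by (auto simp: sym_plans_def)
  interpret P: prob_space p by fact
  have space_p: "space p = pow_set \<Omega> N" using sets_eq_imp_space_eq[OF sets_p] space_product by simp
  have c: "(\<lambda>x. x j) \<in> measurable p \<mu>" if "j \<in> {1..N}" for j
    using measurable_component_singleton[OF that, of "\<lambda>_. \<mu>"] by (simp add: measurable_cong_sets[OF sets_p refl])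
  have Zs: "Z \<inter> \<Omega> \<in> sets \<mu>" using Z domain_lmeasurable by (auto simp: in_sets_mu negligible_imp_sets fmeasurableD)
  define h :: "(nat \<Rightarrow> 'a) \<Rightarrow> real" where "h x = indicator (Z \<inter> \<Omega>) (x 1)" for x
  have h: "h \<in> borel_measurable product_space"
  proof -
    have "(\<lambda>x. x 1) \<in> measurable product_space \<mu>" using N1 by (intro measurable_component_singleton) auto
    from measurable_compose[OF this borel_measurable_indicator[OF Zs]] show ?thesis by (simp only: h_def[abs_def])
  qed
  have "AE x in \<mu>. x \<notin> Z \<inter> \<Omega>" unfolding AE_mu_iff using Z by (intro exI[of _ Z]) auto
  then have "AE x in distr p \<mu> (\<lambda>x. x 1). x \<notin> Z \<inter> \<Omega>" by (simp only: marg)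
  then have "AE x in p. x 1 \<notin> Z \<inter> \<Omega>"
  proof (subst (asm) AE_distr_iff)
    show "(\<lambda>x. x 1) \<in> measurable p \<mu>" using N1 by (intro c) auto
    show "{x \<in> space \<mu>. x \<notin> Z \<inter> \<Omega>} \<in> sets \<mu>"
      using sets.compl_sets[OF Zs] by (simp add: set_diff_eq)
  qed
  then have h0: "(\<integral>x. h x \<partial>p) = 0"
    by (intro integral_eq_zero_AE) (auto simp: h_def)
  have "AE x in p. x j \<notin> Z" if j: "j \<in> {1..N}" for j
  proof -
    have "integrable p (\<lambda>x. h ((cyclic_shift N ^^ (j - 1)) x))"
      "(\<integral>x. h ((cyclic_shift N ^^ (j - 1)) x) \<partial>p) = 0"
      using sym_plan_integral_shift[OF p h, of 1 "j - 1"] h0 by (auto simp: h_def)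
    then have "AE x in p. h ((cyclic_shift N ^^ (j - 1)) x) = 0"
      by (subst (asm) integral_nonneg_eq_0_iff_AE) (auto simp: h_def)
    then show ?thesis
    proof (rule AE_mp, intro AE_I2 impI)
      fix x assume x: "x \<in> space p" and hx: "h ((cyclic_shift N ^^ (j - 1)) x) = 0"
      have "j - 1 < N" "j - 1 + 1 = j" using j by auto
      then have "(cyclic_shift N ^^ (j - 1)) x 1 = x j"
        using x j N1 by (subst cyclic_shift_pow_apply[where A = \<Omega>]) (auto simp: space_p)
      then show "x j \<notin> Z" using hx x j by (auto simp: h_def space_p indicator_def split: if_splits)
    qed
  qed
  then show ?thesis by (intro AE_finite_allI) auto
qed

lemma sym_plan_field_form_nonpos:
  assumes p: "p \<in> sym_plans N \<mu>" and Z: "negligible Z" and sub: "sub_antisymmetric N (\<Omega> - Z) (field_form N u)"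
  shows "(\<integral>x. field_form N u x \<partial>p) \<le> 0"
proof -
  note shift = sym_plan_integral_shift[OF p measurable_field_form field_form_bounded]
  have sp: "space p = pow_set \<Omega> N"
    using p sets_eq_imp_space_eq[of p product_space] space_product by (simp add: sym_plans_def)
  have "N * (\<integral>x. field_form N u x \<partial>p) = (\<Sum>i<N. \<integral>x. field_form N u ((cyclic_shift N ^^ i) x) \<partial>p)"
    using shift by simp
  also have "\<dots> = (\<integral>x. cyclic_sum N (field_form N u) x \<partial>p)"
    unfolding cyclic_sum_lessThan[OF N1] using shift by (intro Bochner_Integration.integral_sum[symmetric]) auto
  also have "\<dots> = - (\<integral>x. - cyclic_sum N (field_form N u) x \<partial>p)" by simp
  also have "\<dots> \<le> 0"
  proof (subst neg_le_0_iff_le, rule integral_nonneg_AE)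
    show "AE x in p. 0 \<le> - cyclic_sum N (field_form N u) x"
      using sym_plan_AE_coordinates[OF p Z]
    proof (rule AE_mp, intro AE_I2 impI)
      fix x assume "x \<in> space p" "\<forall>j\<in>{1..N}. x j \<notin> Z"
      then have "x \<in> pow_set (\<Omega> - Z) N" by (auto simp: sp PiE_def)
      then show "0 \<le> - cyclic_sum N (field_form N u) x" using sub by (simp add: sub_antisymmetric_iff)
    qed
  qed
  finally show ?thesis using N1 by (simp add: mult_le_0_iff)
qed

subsection \<open>Periodic maps as symmetric plans\<close>

definition orbit :: "('a \<Rightarrow> 'a) \<Rightarrow> 'a \<Rightarrow> nat \<Rightarrow> 'a" where
  "orbit S x = (\<lambda>i\<in>{1..N}. (S ^^ (i - 1)) x)"

lemma orbit_id: "orbit id = diag N"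
  by (auto simp: orbit_def diag_def fun_eq_iff)

lemma id_periodic: "id \<in> N_periodic_maps N \<mu>"
  by (simp add: N_periodic_maps_def measure_preserving_maps_def distr_id[folded id_def])

lemma measurable_iterate:
  assumes "S \<in> N_periodic_maps N \<mu>"
  shows "S ^^ k \<in> measurable \<mu> \<mu>"
proof (induction k)
  case (Suc k)
  have "S \<in> measurable \<mu> \<mu>" using assms by (auto simp: N_periodic_maps_def measure_preserving_maps_def)
  from measurable_comp[OF Suc this] show ?case by (simp only: funpow.simps)
qed simp

lemma iterate_in_domain: "S \<in> N_periodic_maps N \<mu> \<Longrightarrow> x \<in> \<Omega> \<Longrightarrow> (S ^^ k) x \<in> \<Omega>"
  using measurable_space[OF measurable_iterate, of S x k] by (simp add: space_mu)

lemma measurable_orbit: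
  assumes "S \<in> N_periodic_maps N \<mu>"
  shows "orbit S \<in> measurable \<mu> product_space"
  unfolding orbit_def[abs_def] by (intro measurable_restrict measurable_iterate assms)

text \<open>
  Shifting the orbit of \<open>x\<close> gives the orbit of \<open>S x\<close>, since the last entry \<open>x\<close> equals \<open>S\<^sup>N x\<close> almost
  everywhere; so invariance of the plan is invariance of \<open>\<mu>\<close> under \<open>S\<close>.
\<close>

lemma orbit_plan:
  assumes S: "S \<in> N_periodic_maps N \<mu>"
  shows "distr \<mu> product_space (orbit S) \<in> sym_plans N \<mu>"
proof -
  interpret prob_space \<mu> by (rule prob_space_mu)
  let ?p = "distr \<mu> product_space (orbit S)"
  have T: "orbit S \<in> measurable \<mu> product_space" by (rule measurable_orbit[OF S])
  have S': "S \<in> measurable \<mu> \<mu>" "distr \<mu> \<mu> S = \<mu>" "AE x in \<mu>. (S ^^ N) x = x"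
    using S by (auto simp: N_periodic_maps_def measure_preserving_maps_def)
  have "shift_invariant N ?p"
    unfolding shift_invariant_def
  proof (intro allI impI)
    fix h :: "(nat \<Rightarrow> 'a) \<Rightarrow> real" assume "integrable ?p h"
    then have h: "h \<in> borel_measurable product_space" by auto
    have hs: "(\<lambda>x. h (cyclic_shift N x)) \<in> borel_measurable product_space"
      using measurable_compose[OF measurable_cyclic_shift h] .
    have "(\<integral>x. h (cyclic_shift N x) \<partial>?p) = (\<integral>x. h (cyclic_shift N (orbit S x)) \<partial>\<mu>)"
      by (rule integral_distr[OF T hs])
    also have "\<dots> = (\<integral>x. h (orbit S (S x)) \<partial>\<mu>)"
    proof (rule integral_cong_AE)
      show "(\<lambda>x. h (cyclic_shift N (orbit S x))) \<in> borel_measurable \<mu>" using measurable_compose[OF T hs] .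
      show "(\<lambda>x. h (orbit S (S x))) \<in> borel_measurable \<mu>"
        using measurable_compose[OF S'(1) measurable_compose[OF T h]] .
      show "AE x in \<mu>. h (cyclic_shift N (orbit S x)) = h (orbit S (S x))"
        using S'(3)
      proof (rule AE_mp, intro AE_I2 impI)
        fix x assume x: "(S ^^ N) x = x"
        have "(S ^^ (i - 1)) (S x) = (S ^^ i) x" if "i \<ge> 1" for i
          using that by (cases i) (auto simp: funpow_swap1)
        then have "cyclic_shift N (orbit S x) = orbit S (S x)"
          using x N1 by (auto simp: cyclic_shift_def orbit_def fun_eq_iff)
        then show "h (cyclic_shift N (orbit S x)) = h (orbit S (S x))" by simp
      qed
    qed
    also have "\<dots> = (\<integral>x. h (orbit S x) \<partial>distr \<mu> \<mu> S)"
      using measurable_compose[OF T h] by (intro integral_distr[OF S'(1), symmetric])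
    also have "\<dots> = (\<integral>x. h x \<partial>?p)" unfolding S'(2) by (rule integral_distr[OF T h, symmetric])
    finally show "(\<integral>x. h x \<partial>?p) = (\<integral>x. h (cyclic_shift N x) \<partial>?p)" by simp
  qed
  moreover have "distr ?p \<mu> (\<lambda>x. x 1) = \<mu>"
  proof -
    have "(\<lambda>x. x 1) \<in> measurable product_space \<mu>" using N1 by (intro measurable_component_singleton) auto
    then have "distr ?p \<mu> (\<lambda>x. x 1) = distr \<mu> \<mu> ((\<lambda>x. x 1) \<circ> orbit S)" by (rule distr_distr[OF _ T])
    also have "(\<lambda>x. x 1) \<circ> orbit S = (\<lambda>x. x)" using N1 by (auto simp: orbit_def)
    finally show ?thesis by (simp add: distr_id)
  qed
  ultimately show ?thesis using prob_space_distr[OF T] by (simp add: sym_plans_def)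
qed

definition polar_integral :: "('a \<Rightarrow> 'a) \<Rightarrow> real" where
  "polar_integral S = (\<integral>x. (\<Sum>l=1..N-1. u l x \<bullet> (x - (S ^^ l) x)) \<partial>\<mu>)"

lemma polar_integral_eq_plan:
  assumes S: "S \<in> N_periodic_maps N \<mu>"
  shows "polar_integral S = - (\<integral>x. field_form N u x \<partial>distr \<mu> product_space (orbit S))"
proof -
  have "(\<integral>x. field_form N u x \<partial>distr \<mu> product_space (orbit S)) = (\<integral>x. field_form N u (orbit S x) \<partial>\<mu>)"
    by (rule integral_distr[OF measurable_orbit[OF S] measurable_field_form])
  also have "\<dots> = (\<integral>x. - (\<Sum>l=1..N-1. u l x \<bullet> (x - (S ^^ l) x)) \<partial>\<mu>)"
  proof (rule Bochner_Integration.integral_cong[OF refl])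
    fix x
    show "field_form N u (orbit S x) = - (\<Sum>l=1..N-1. u l x \<bullet> (x - (S ^^ l) x))"
      unfolding field_form_def sum_negf[symmetric]
      by (rule sum.cong) (use N1 in \<open>auto simp: orbit_def inner_diff_right\<close>)
  qed
  finally show ?thesis by (simp add: polar_integral_def)
qed

lemma polar_integral_id: "polar_integral id = 0"
  by (simp add: polar_integral_def)

lemma field_form_sum_negated: "(\<Sum>l=1..N-1. u l (x 1) \<bullet> (x 1 - x (l + 1))) = - field_form N u x"
  unfolding field_form_def sum_negf[symmetric] by (rule sum.cong) (auto simp: inner_diff_right)

theorem monge_kantorovich_if_monotone:
  assumes "negligible Z" "sub_antisymmetric N (\<Omega> - Z) (field_form N u)"
  shows "(INF p\<in>sym_plans N \<mu>. ereal (\<integral>x. - field_form N u x \<partial>p)) = 0"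
    "distr \<mu> product_space (diag N) \<in> sym_plans N \<mu>"
    "(\<integral>x. - field_form N u x \<partial>distr \<mu> product_space (diag N)) = 0"
proof -
  show d: "distr \<mu> product_space (diag N) \<in> sym_plans N \<mu>"
    using orbit_plan[OF id_periodic] by (simp add: orbit_id)
  show z: "(\<integral>x. - field_form N u x \<partial>distr \<mu> product_space (diag N)) = 0"
    using polar_integral_eq_plan[OF id_periodic] polar_integral_id by (simp add: orbit_id)
  show "(INF p\<in>sym_plans N \<mu>. ereal (\<integral>x. - field_form N u x \<partial>p)) = 0"
  proof (rule antisym)
    show "(INF p\<in>sym_plans N \<mu>. ereal (\<integral>x. - field_form N u x \<partial>p)) \<le> 0"
      using INF_lower[OF d, of "\<lambda>p. ereal (\<integral>x. - field_form N u x \<partial>p)"] z by (simp add: zero_ereal_def)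
    show "0 \<le> (INF p\<in>sym_plans N \<mu>. ereal (\<integral>x. - field_form N u x \<partial>p))"
      using sym_plan_field_form_nonpos[OF _ assms] by (intro INF_greatest) simp
  qed
qed

lemma polar_if_monge_kantorovich:
  assumes "(INF p\<in>sym_plans N \<mu>. ereal (\<integral>x. - field_form N u x \<partial>p)) = 0" and S: "S \<in> N_periodic_maps N \<mu>"
  shows "polar_integral S \<ge> 0"
  using INF_lower[OF orbit_plan[OF S], of "\<lambda>p. ereal (\<integral>x. - field_form N u x \<partial>p)"] assms(1)
    polar_integral_eq_plan[OF S] by simp

text \<open>
  The identity contributes the value \<open>0\<close>, so only the sign of the other values matters.
\<close>

lemma INF_affine_polar_iff:
  assumes "k > 0"
  shows "(INF S\<in>N_periodic_maps N \<mu>. ereal (c + k * polar_integral S)) = ereal c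
    \<longleftrightarrow> (\<forall>S\<in>N_periodic_maps N \<mu>. polar_integral S \<ge> 0)" (is "?I = _ \<longleftrightarrow> ?R")
proof
  assume I: "?I = ereal c"
  show ?R
  proof
    fix S assume "S \<in> N_periodic_maps N \<mu>"
    from INF_lower[OF this, of "\<lambda>S. ereal (c + k * polar_integral S)"] I assms
    show "polar_integral S \<ge> 0" by (simp add: zero_le_mult_iff)
  qed
next
  assume ?R
  then show "?I = ereal c"
    using INF_lower[OF id_periodic, of "\<lambda>S. ereal (c + k * polar_integral S)"] assms
    by (intro antisym INF_greatest) (auto simp: polar_integral_id)
qed

lemma polar_iff_INF:
  "(INF S\<in>N_periodic_maps N \<mu>. ereal (polar_integral S)) = 0 \<longleftrightarrow> (\<forall>S\<in>N_periodic_maps N \<mu>. polar_integral S \<ge> 0)"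
  using INF_affine_polar_iff[of 1 0] by (simp add: zero_ereal_def)

lemma integrable_bounded:
  fixes f :: "'a \<Rightarrow> real"
  assumes "f \<in> borel_measurable \<mu>" "\<And>x. x \<in> \<Omega> \<Longrightarrow> \<bar>f x\<bar> \<le> B"
  shows "integrable \<mu> f"
proof -
  interpret prob_space \<mu> by (rule prob_space_mu)
  show ?thesis using assms by (intro integrable_const_bound[where B = B] AE_I2) (auto simp: space_mu)
qed

lemma measurable_iterate_borel:
  "S \<in> N_periodic_maps N \<mu> \<Longrightarrow> (S ^^ l) \<in> borel_measurable \<mu>"
  using measurable_compose[OF measurable_iterate id_mu] by simp

lemma integrable_inner_iterate:
  assumes "S \<in> N_periodic_maps N \<mu>" "l \<in> {1..N-1}"
  shows "integrable \<mu> (\<lambda>x. u l x \<bullet> (S ^^ k) x)"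
proof (rule integrable_bounded)
  show "(\<lambda>x. u l x \<bullet> (S ^^ k) x) \<in> borel_measurable \<mu>"
    using u_mu[OF assms(2)] measurable_iterate_borel[OF assms(1)] by measurable
  show "\<bar>u l x \<bullet> (S ^^ k) x\<bar> \<le> bound * bound" if "x \<in> \<Omega>" for x
  proof -
    have "\<bar>u l x \<bullet> (S ^^ k) x\<bar> \<le> norm (u l x) * norm ((S ^^ k) x)" by (rule Cauchy_Schwarz_ineq2)
    also have "\<dots> \<le> bound * bound"
      using bound(1) bound(2)[OF iterate_in_domain[OF assms(1) that, of k]] bound(3)[OF assms(2) that]
      by (intro mult_mono) auto
    finally show ?thesis .
  qed
qed

definition correlation :: "('a \<Rightarrow> 'a) \<Rightarrow> real" where
  "correlation S = (\<integral>x. (\<Sum>l=1..N-1. u l x \<bullet> (S ^^ l) x) \<partial>\<mu>)"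

lemma polar_integral_eq_correlation:
  assumes S: "S \<in> N_periodic_maps N \<mu>"
  shows "polar_integral S = correlation id - correlation S"
proof -
  have "integrable \<mu> (\<lambda>x. \<Sum>l=1..N-1. u l x \<bullet> (R ^^ l) x)" if "R \<in> N_periodic_maps N \<mu>" for R
    by (intro Bochner_Integration.integrable_sum integrable_inner_iterate that)
  from Bochner_Integration.integral_diff[OF this[OF id_periodic] this[OF S]]
  show ?thesis by (simp add: correlation_def polar_integral_def inner_diff_right sum_subtractf)
qed

text \<open>
  In the expansion of the squares, \<open>|S\<^sup>l x|\<^sup>2\<close> and \<open>|x|\<^sup>2\<close> have the same integral.
\<close>

lemma quadratic_cost:
  assumes S: "S \<in> N_periodic_maps N \<mu>"
  shows "(\<integral>x. (\<Sum>l=1..N-1. (norm (u l x - (S ^^ l) x))\<^sup>2) \<partial>\<mu>)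
     = (\<Sum>l=1..N-1. \<integral>x. (norm (u l x - x))\<^sup>2 \<partial>\<mu>) + 2 * polar_integral S"
proof -
  have pres: "distr \<mu> \<mu> (S ^^ l) = \<mu>" for l
  proof (induction l)
    case 0
    then show ?case by (simp add: id_def distr_id)
  next
    case (Suc l)
    have S': "S \<in> measurable \<mu> \<mu>" "distr \<mu> \<mu> S = \<mu>"
      using S by (auto simp: N_periodic_maps_def measure_preserving_maps_def)
    have "distr \<mu> \<mu> (S ^^ Suc l) = distr (distr \<mu> \<mu> (S ^^ l)) \<mu> S"
      using distr_distr[OF S'(1) measurable_iterate[OF S, of l]] by (simp only: funpow.simps)
    then show ?case by (simp only: Suc S'(2))
  qed
  define q where "q x = (norm x)\<^sup>2" for x :: 'a
  have q: "q \<in> borel_measurable \<mu>" unfolding q_def[abs_def] using id_mu by measurable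
  have "integrable \<mu> (\<lambda>x. q ((R ^^ l) x))" if "R \<in> N_periodic_maps N \<mu>" for R l
  proof (rule integrable_bounded)
    show "(\<lambda>x. q ((R ^^ l) x)) \<in> borel_measurable \<mu>" using measurable_compose[OF measurable_iterate[OF that] q] .
    show "\<bar>q ((R ^^ l) x)\<bar> \<le> bound\<^sup>2" if "x \<in> \<Omega>" for x
      using bound(2)[OF iterate_in_domain[OF \<open>R \<in> _\<close> that, of l]] bound(1)
      by (simp add: q_def power_mono)
  qed
  note intq = this[OF S] this[OF id_periodic, simplified]
  have q_inv: "(\<integral>x. q ((S ^^ l) x) \<partial>\<mu>) = (\<integral>x. q x \<partial>\<mu>)" for l
    using integral_distr[OF measurable_iterate[OF S] q, of l] by (simp add: pres)
  have intu: "integrable \<mu> (\<lambda>x. (norm (u l x - x))\<^sup>2)" if l: "l \<in> {1..N-1}" for l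
  proof (rule integrable_bounded)
    show "(\<lambda>x. (norm (u l x - x))\<^sup>2) \<in> borel_measurable \<mu>" using u_mu[OF l] id_mu by measurable
    show "\<bar>(norm (u l x - x))\<^sup>2\<bar> \<le> (bound + bound)\<^sup>2" if "x \<in> \<Omega>" for x
    proof -
      have "norm (u l x - x) \<le> bound + bound"
        using norm_triangle_ineq4[of "u l x" x] bound(2)[OF that] bound(3)[OF l that] by linarith
      from power_mono[OF this norm_ge_zero, of 2] show ?thesis by simp
    qed
  qed
  have inti: "integrable \<mu> (\<lambda>x. u l x \<bullet> (x - (S ^^ l) x))" if "l \<in> {1..N-1}" for l
    using integrable_inner_iterate[OF id_periodic that, of l] integrable_inner_iterate[OF S that, of l]
    by (simp add: inner_diff_right)
  have expand: "(norm (u l x - (S ^^ l) x))\<^sup>2 =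
      (norm (u l x - x))\<^sup>2 + 2 * (u l x \<bullet> (x - (S ^^ l) x)) + (q ((S ^^ l) x) - q x)" for l x
    by (simp add: q_def power2_norm_eq_inner inner_diff_left inner_diff_right inner_commute)
  have "(\<integral>x. (\<Sum>l=1..N-1. (norm (u l x - (S ^^ l) x))\<^sup>2) \<partial>\<mu>)
     = (\<Sum>l=1..N-1. \<integral>x. (norm (u l x - x))\<^sup>2 + 2 * (u l x \<bullet> (x - (S ^^ l) x)) + (q ((S ^^ l) x) - q x) \<partial>\<mu>)"
    unfolding expand by (rule Bochner_Integration.integral_sum) (use intq intu inti in auto)
  also have "\<dots> = (\<Sum>l=1..N-1. (\<integral>x. (norm (u l x - x))\<^sup>2 \<partial>\<mu>) + 2 * (\<integral>x. u l x \<bullet> (x - (S ^^ l) x) \<partial>\<mu>))"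
    using intq intu inti q_inv by (intro sum.cong) auto
  also have "\<dots> = (\<Sum>l=1..N-1. \<integral>x. (norm (u l x - x))\<^sup>2 \<partial>\<mu>) + 2 * polar_integral S"
    unfolding polar_integral_def using inti
    by (subst Bochner_Integration.integral_sum) (auto simp: sum.distrib sum_distrib_left)
  finally show ?thesis .
qed

lemma quadratic_iff_polar:
  "(INF S\<in>N_periodic_maps N \<mu>. ereal (\<integral>x. (\<Sum>l=1..N-1. (norm (u l x - (S ^^ l) x))\<^sup>2) \<partial>\<mu>))
      = ereal (\<Sum>l=1..N-1. \<integral>x. (norm (u l x - x))\<^sup>2 \<partial>\<mu>)
    \<longleftrightarrow> (\<forall>S\<in>N_periodic_maps N \<mu>. polar_integral S \<ge> 0)"
proof -
  define c where "c = (\<Sum>l=1..N-1. \<integral>x. (norm (u l x - x))\<^sup>2 \<partial>\<mu>)"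
  have "(INF S\<in>N_periodic_maps N \<mu>. ereal (\<integral>x. (\<Sum>l=1..N-1. (norm (u l x - (S ^^ l) x))\<^sup>2) \<partial>\<mu>))
     = (INF S\<in>N_periodic_maps N \<mu>. ereal (c + 2 * polar_integral S))"
    by (rule INF_cong[OF refl]) (simp only: quadratic_cost c_def)
  then show ?thesis using INF_affine_polar_iff[of 2 c] by (simp only: c_def)
qed

lemma SUP_correlation_iff_polar:
  "(SUP S\<in>N_periodic_maps N \<mu>. ereal (correlation S)) = ereal (correlation id)
    \<longleftrightarrow> (\<forall>S\<in>N_periodic_maps N \<mu>. polar_integral S \<ge> 0)"
proof
  assume I: "(SUP S\<in>N_periodic_maps N \<mu>. ereal (correlation S)) = ereal (correlation id)"
  show "\<forall>S\<in>N_periodic_maps N \<mu>. polar_integral S \<ge> 0"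
  proof
    fix S assume S: "S \<in> N_periodic_maps N \<mu>"
    from SUP_upper[OF this, of "\<lambda>S. ereal (correlation S)"] I
    show "polar_integral S \<ge> 0" by (simp add: polar_integral_eq_correlation[OF S])
  qed
next
  assume P: "\<forall>S\<in>N_periodic_maps N \<mu>. polar_integral S \<ge> 0"
  show "(SUP S\<in>N_periodic_maps N \<mu>. ereal (correlation S)) = ereal (correlation id)"
  proof (intro antisym SUP_least)
    fix S assume S: "S \<in> N_periodic_maps N \<mu>"
    then show "ereal (correlation S) \<le> ereal (correlation id)"
      using P polar_integral_eq_correlation[OF S] by fastforce
  next
    show "ereal (correlation id) \<le> (SUP S\<in>N_periodic_maps N \<mu>. ereal (correlation S))"
      by (rule SUP_upper[OF id_periodic])
  qed
qed

end

section \<open>Rotating small cubes: the polar condition implies monotonicity\<close>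

lemma mem_translation_iff: "x \<in> (+) a ` C \<longleftrightarrow> x - a \<in> C" for x a :: "'a::ab_group_add"
  by (metis add_diff_cancel_left' diff_add_cancel add.commute image_iff)

lemma emeasure_lebesgue_translation:
  "emeasure lebesgue ((+) a ` S) = emeasure lebesgue S" for S :: "'a::euclidean_space set"
  using emeasure_lebesgue_affine[of 1 a S] by (simp add: add.commute cong: image_cong_simp)

lemma injective_choice_of_infinite:
  assumes "\<And>j. j \<in> {1..M::nat} \<Longrightarrow> infinite (B j)"
  shows "\<exists>y. inj_on y {1..M} \<and> (\<forall>j\<in>{1..M}. y j \<in> B j)"
  using assms
proof (induction M)
  case (Suc M)
  have "\<exists>y. inj_on y {1..M} \<and> (\<forall>j\<in>{1..M}. y j \<in> B j)" by (rule Suc.IH) (use Suc.prems in auto)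
  then obtain y where y: "inj_on y {1..M}" "\<And>j. j \<in> {1..M} \<Longrightarrow> y j \<in> B j" by blast
  have "infinite (B (Suc M) - y ` {1..M})" using Suc.prems[of "Suc M"] by simp
  then obtain z where z: "z \<in> B (Suc M)" "z \<notin> y ` {1..M}" by (metis DiffE finite.emptyI ex_in_conv)
  have eq: "{1..Suc M} = insert (Suc M) {1..M}" by auto
  have "(y(Suc M := z)) ` ({1..M} - {Suc M}) = y ` {1..M}" by (intro image_cong) auto
  then have "inj_on (y(Suc M := z)) {1..Suc M}"
    unfolding eq inj_on_insert using inj_on_fun_updI[OF y(1) z(2)] z(2) by simp
  moreover have "(y(Suc M := z)) j \<in> B j" if "j \<in> {1..Suc M}" for j
    using y(2)[of j] z(1) that by (cases "j = Suc M") auto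
  ultimately show ?case by blast
qed auto

lemma LIMSEQ_if_dist_less_inverse:
  assumes "\<And>n. dist (f n) l < 1 / Suc n"
  shows "f \<longlonglongrightarrow> l"
  unfolding tendsto_dist_iff[of f]
proof (rule tendsto_sandwich[where f = "\<lambda>_. 0" and h = "\<lambda>n. 1 / real (Suc n)"])
  show "(\<lambda>n. 1 / real (Suc n)) \<longlonglongrightarrow> 0" by (rule LIMSEQ_Suc[OF lim_1_over_n])
  show "eventually (\<lambda>n. dist (f n) l \<le> 1 / real (Suc n)) sequentially"
    using assms by (intro always_eventually allI less_imp_le)
qed auto

context bounded_fields
begin

text \<open>
  Moves the translate \<open>y\<^sub>j + C\<close> onto the next one, cyclically in \<open>j < N\<close>, and fixes all other points. The
  block index is unique only for disjoint translates, which is the setting of the lemmas below.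
\<close>

definition block_rotation :: "(nat \<Rightarrow> 'a) \<Rightarrow> 'a set \<Rightarrow> 'a \<Rightarrow> 'a" where
  "block_rotation y C x = (if \<exists>j<N. x - y j \<in> C
     then let j = THE j. j < N \<and> x - y j \<in> C in x - y j + y ((j + 1) mod N) else x)"

context
  fixes y :: "nat \<Rightarrow> 'a" and C :: "'a set"
  assumes C: "C \<in> sets lebesgue"
    and blocks: "\<And>j. j < N \<Longrightarrow> (+) (y j) ` C \<subseteq> \<Omega>"
    and disj: "disjoint_family_on (\<lambda>j. (+) (y j) ` C) {..<N}"
begin

lemma block_unique: "i < N \<Longrightarrow> j < N \<Longrightarrow> x - y i \<in> C \<Longrightarrow> x - y j \<in> C \<Longrightarrow> i = j"
  using disj unfolding disjoint_family_on_def mem_translation_iff[symmetric] by blast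

lemma block_rotation_in:
  assumes "j < N" "x - y j \<in> C"
  shows "block_rotation y C x = x - y j + y ((j + 1) mod N)"
proof -
  have "(THE j. j < N \<and> x - y j \<in> C) = j" using assms block_unique by blast
  then show ?thesis using assms by (auto simp: block_rotation_def Let_def)
qed

lemma block_rotation_pow_in:
  assumes "j < N" "x - y j \<in> C"
  shows "(block_rotation y C ^^ l) x = x - y j + y ((j + l) mod N)"
proof (induction l)
  case (Suc l)
  have "(j + l) mod N < N" "x - y j + y ((j + l) mod N) - y ((j + l) mod N) \<in> C"
    using N1 assms by auto
  from block_rotation_in[OF this] Suc show ?case by (simp add: mod_Suc_eq)
qed (use assms in simp)

lemma block_rotation_out: "(\<And>j. j < N \<Longrightarrow> x - y j \<notin> C) \<Longrightarrow> block_rotation y C x = x"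
  by (auto simp: block_rotation_def)

lemma block_rotation_pow_out:
  assumes "\<And>j. j < N \<Longrightarrow> x - y j \<notin> C"
  shows "(block_rotation y C ^^ l) x = x"
  by (induction l) (simp_all add: block_rotation_out assms)

lemma block_rotation_period: "(block_rotation y C ^^ N) x = x"
proof (cases "\<exists>j<N. x - y j \<in> C")
  case True
  then obtain j where "j < N" "x - y j \<in> C" by blast
  then show ?thesis by (simp add: block_rotation_pow_in)
next
  case False
  then show ?thesis by (intro block_rotation_pow_out) auto
qed

lemma block_rotation_domain:
  assumes "x \<in> \<Omega>"
  shows "block_rotation y C x \<in> \<Omega>"
proof (cases "\<exists>j<N. x - y j \<in> C")
  case True
  then obtain j where j: "j < N" "x - y j \<in> C" by blast
  have "block_rotation y C x \<in> (+) (y ((j + 1) mod N)) ` C"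
    unfolding mem_translation_iff block_rotation_in[OF j] using j by simp
  then show ?thesis using blocks[of "(j + 1) mod N"] N1 by auto
next
  case False
  then show ?thesis using block_rotation_out[of x] assms by auto
qed

text \<open>
  The preimage splits into the fixed part and one translated piece in each block; so its measurability
  and its measure can be read off piece by piece.
\<close>

lemma block_rotation_vimage:
  assumes B: "B \<in> sets \<mu>"
  defines "Q \<equiv> (\<lambda>j. (+) (y j) ` C)"
  defines "T \<equiv> (\<lambda>j. (+) (y j - y ((j + 1) mod N)) ` (B \<inter> Q ((j + 1) mod N)))"
  shows "block_rotation y C -` B \<inter> \<Omega> = (B - (\<Union>j<N. Q j)) \<union> (\<Union>j<N. T j)"
    and "\<And>j. j < N \<Longrightarrow> T j \<subseteq> Q j"
proof -
  have T: "x \<in> T j \<longleftrightarrow> x - y j \<in> C \<and> x - y j + y ((j + 1) mod N) \<in> B" for x j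
    unfolding T_def Q_def mem_translation_iff Int_iff by (auto simp: algebra_simps)
  have Q: "x \<in> Q j \<longleftrightarrow> x - y j \<in> C" for x j unfolding Q_def mem_translation_iff ..
  show "T j \<subseteq> Q j" if "j < N" for j using T Q by blast
  have Bsub: "B \<subseteq> \<Omega>" using B in_sets_mu by blast
  show "block_rotation y C -` B \<inter> \<Omega> = (B - (\<Union>j<N. Q j)) \<union> (\<Union>j<N. T j)"
  proof (intro set_eqI)
    fix x
    show "x \<in> block_rotation y C -` B \<inter> \<Omega> \<longleftrightarrow> x \<in> (B - (\<Union>j<N. Q j)) \<union> (\<Union>j<N. T j)"
    proof (cases "\<exists>j<N. x - y j \<in> C")
      case True
      then obtain j where j: "j < N" "x - y j \<in> C" by blast
      have "x \<in> \<Omega>" using blocks[OF j(1)] mem_translation_iff[of x "y j" C] j(2) by blast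
      moreover have "x \<in> (\<Union>i<N. T i) \<longleftrightarrow> x \<in> T j" using T j block_unique by blast
      moreover have "x \<in> (\<Union>i<N. Q i)" using Q j by blast
      ultimately show ?thesis using j by (simp add: T block_rotation_in)
    next
      case False
      then have "block_rotation y C x = x" by (intro block_rotation_out) auto
      then show ?thesis using False T Q Bsub by auto
    qed
  qed
qed

lemma block_rotation_periodic: "block_rotation y C \<in> N_periodic_maps N \<mu>"
proof -
  define Q where "Q = (\<lambda>j. (+) (y j) ` C)"
  have Q: "Q j \<in> sets lebesgue" for j unfolding Q_def by (rule lebesgue_sets_translation[OF C])
  have meas: "block_rotation y C -` B \<inter> \<Omega> \<in> sets \<mu>"
    and em: "emeasure lebesgue (block_rotation y C -` B \<inter> \<Omega>) = emeasure lebesgue B"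
    if B: "B \<in> sets \<mu>" for B
  proof -
    have Bl: "B \<in> sets lebesgue" using B by (simp add: in_sets_mu)
    define T where "T = (\<lambda>j. (+) (y j - y ((j + 1) mod N)) ` (B \<inter> Q ((j + 1) mod N)))"
    have T: "T j \<in> sets lebesgue" for j
      unfolding T_def using Bl Q by (intro lebesgue_sets_translation) auto
    have v: "block_rotation y C -` B \<inter> \<Omega> = (B - (\<Union>j<N. Q j)) \<union> (\<Union>j<N. T j)"
      "\<And>j. j < N \<Longrightarrow> T j \<subseteq> Q j"
      unfolding T_def Q_def by (rule block_rotation_vimage[OF B])+
    have "block_rotation y C -` B \<inter> \<Omega> \<in> sets lebesgue"
      unfolding v(1) using Bl Q T by (intro sets.Un sets.Diff sets.finite_UN) auto
    then show "block_rotation y C -` B \<inter> \<Omega> \<in> sets \<mu>" by (simp add: in_sets_mu)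
    have disjQ: "disjoint_family_on Q {..<N}" using disj by (simp add: Q_def)
    have disjT: "disjoint_family_on T {..<N}"
      using disjQ v(2) unfolding disjoint_family_on_def by blast
    have disjB: "disjoint_family_on (\<lambda>j. B \<inter> Q j) {..<N}"
      using disjQ unfolding disjoint_family_on_def by blast
    have "emeasure lebesgue (block_rotation y C -` B \<inter> \<Omega>)
        = emeasure lebesgue (B - (\<Union>j<N. Q j)) + emeasure lebesgue (\<Union>j<N. T j)"
      unfolding v(1)
    proof (rule plus_emeasure[symmetric])
      show "(B - (\<Union>j<N. Q j)) \<inter> (\<Union>j<N. T j) = {}" using v(2) by blast
    qed (use Bl Q T in auto)
    also have "emeasure lebesgue (\<Union>j<N. T j) = (\<Sum>j<N. emeasure lebesgue (T j))"
      using T disjT by (intro sum_emeasure[symmetric]) auto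
    also have "\<dots> = (\<Sum>j<N. emeasure lebesgue (B \<inter> Q ((j + 1) mod N)))"
      by (simp only: T_def emeasure_lebesgue_translation)
    also have "\<dots> = (\<Sum>j<N. emeasure lebesgue (B \<inter> Q j))" by (rule sum_mod_shift)
    also have "\<dots> = emeasure lebesgue (\<Union>j<N. B \<inter> Q j)"
      using Bl Q disjB by (intro sum_emeasure) auto
    also have "emeasure lebesgue (B - (\<Union>j<N. Q j)) + \<dots> = emeasure lebesgue ((B - (\<Union>j<N. Q j)) \<union> (\<Union>j<N. B \<inter> Q j))"
      using Bl Q by (intro plus_emeasure) auto
    also have "(B - (\<Union>j<N. Q j)) \<union> (\<Union>j<N. B \<inter> Q j) = B" by auto
    finally show "emeasure lebesgue (block_rotation y C -` B \<inter> \<Omega>) = emeasure lebesgue B" .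
  qed
  have m: "block_rotation y C \<in> measurable \<mu> \<mu>"
    using meas block_rotation_domain by (intro measurableI) (auto simp: space_mu)
  have "distr \<mu> \<mu> (block_rotation y C) = \<mu>"
  proof (rule measure_eqI)
    fix B assume "B \<in> sets (distr \<mu> \<mu> (block_rotation y C))"
    then have B: "B \<in> sets \<mu>" by simp
    show "emeasure (distr \<mu> \<mu> (block_rotation y C)) B = emeasure \<mu> B"
      unfolding emeasure_distr[OF m B] space_mu emeasure_mu[OF B] emeasure_mu[OF meas[OF B]] em[OF B] ..
  qed simp
  then show ?thesis
    using m block_rotation_period by (simp add: N_periodic_maps_def measure_preserving_maps_def)
qed

lemma block_rotation_displacement:
  assumes "x \<in> \<Omega>"
  shows "(\<Sum>l=1..N-1. u l x \<bullet> (x - (block_rotation y C ^^ l) x)) =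
    (\<Sum>j<N. \<Sum>l=1..N-1. (indicator ((+) (y j) ` C) x *\<^sub>R u l x) \<bullet> (y j - y ((j + l) mod N)))"
proof (cases "\<exists>j<N. x - y j \<in> C")
  case True
  then obtain j where j: "j < N" "x - y j \<in> C" by blast
  have "(\<Sum>i<N. \<Sum>l=1..N-1. (indicator ((+) (y i) ` C) x *\<^sub>R u l x) \<bullet> (y i - y ((i + l) mod N)))
     = (\<Sum>i<N. if i = j then (\<Sum>l=1..N-1. u l x \<bullet> (y j - y ((j + l) mod N))) else 0)"
  proof (rule sum.cong[OF refl])
    fix i assume "i \<in> {..<N}"
    then have "i \<noteq> j \<Longrightarrow> x \<notin> (+) (y i) ` C"
      unfolding mem_translation_iff using j block_unique by blast
    moreover have "x \<in> (+) (y j) ` C" unfolding mem_translation_iff by (rule j)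
    ultimately show "(\<Sum>l=1..N-1. (indicator ((+) (y i) ` C) x *\<^sub>R u l x) \<bullet> (y i - y ((i + l) mod N)))
      = (if i = j then (\<Sum>l=1..N-1. u l x \<bullet> (y j - y ((j + l) mod N))) else 0)"
      by (cases "i = j") (simp_all add: indicator_def)
  qed
  also have "\<dots> = (\<Sum>l=1..N-1. u l x \<bullet> (y j - y ((j + l) mod N)))" using j(1) by simp
  finally show ?thesis by (simp add: block_rotation_pow_in[OF j])
next
  case False
  then have out: "x - y j \<notin> C" if "j < N" for j using that by blast
  then have "x \<notin> (+) (y j) ` C" if "j < N" for j unfolding mem_translation_iff using that by blast
  then show ?thesis using block_rotation_pow_out[OF out] by simp
qed

end

lemma integral_mu:
  fixes f :: "'a \<Rightarrow> 'b::euclidean_space"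
  assumes f: "f \<in> borel_measurable \<mu>"
  shows "(\<integral>x. f x \<partial>\<mu>) = (\<integral>x. f x \<partial>lebesgue_on \<Omega>) /\<^sub>R measure lebesgue \<Omega>"
proof -
  let ?c = "1 / measure lebesgue \<Omega>"
  have "\<mu> = density (lebesgue_on \<Omega>) (\<lambda>x. ennreal ?c)"
    unfolding mu normalized_lebesgue_def uniform_measure_def
  proof (rule density_cong)
    show "AE x in lebesgue_on \<Omega>. indicator \<Omega> x / emeasure (lebesgue_on \<Omega>) \<Omega> = ennreal ?c"
    proof (rule AE_I2)
      fix x assume "x \<in> space (lebesgue_on \<Omega>)"
      then have "x \<in> \<Omega>" by simp
      then show "indicator \<Omega> x / emeasure (lebesgue_on \<Omega>) \<Omega> = ennreal ?c"
        using divide_ennreal[of 1 "measure lebesgue \<Omega>"] domain_measure_pos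
        by (simp add: emeasure_lebesgue_on_domain)
    qed
    have [measurable]: "\<Omega> \<in> sets (lebesgue_on \<Omega>)" by simp
    show "(\<lambda>x. indicator \<Omega> x / emeasure (lebesgue_on \<Omega>) \<Omega>) \<in> borel_measurable (lebesgue_on \<Omega>)" by measurable
  qed simp
  then have "(\<integral>x. f x \<partial>\<mu>) = (\<integral>x. f x \<partial>density (lebesgue_on \<Omega>) (\<lambda>x. ennreal ?c))" by simp
  also have "\<dots> = (\<integral>x. ?c *\<^sub>R f x \<partial>lebesgue_on \<Omega>)"
    using f domain_measure_pos by (intro integral_density) (auto simp: measurable_mu)
  finally show ?thesis by (simp add: divide_inverse)
qed

lemma u_integrable: "l \<in> {1..N-1} \<Longrightarrow> integrable (lebesgue_on \<Omega>) (u l)"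
proof -
  assume l: "l \<in> {1..N-1}"
  interpret finite_measure "lebesgue_on \<Omega>"
    by (rule finite_measureI) (use emeasure_lebesgue_on_domain in simp)
  show ?thesis
    using u_measurable[OF l] bound(3)[OF l] by (intro integrable_const_bound[where B = bound] AE_I2) auto
qed

abbreviation u0 :: "nat \<Rightarrow> 'a \<Rightarrow> 'a" where
  "u0 l \<equiv> (\<lambda>x. if x \<in> \<Omega> then u l x else 0)"

lemma u0_integrable_on: "l \<in> {1..N-1} \<Longrightarrow> u0 l integrable_on cbox a b"
proof -
  assume l: "l \<in> {1..N-1}"
  have "u l integrable_on \<Omega>"
    using integrable_on_lebesgue_on[OF u_integrable[OF l]] domain_lmeasurable by (simp add: fmeasurableD)
  then have "u0 l integrable_on UNIV" by (simp add: Henstock_Kurzweil_Integration.integrable_restrict_UNIV)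
  then show ?thesis by (rule integrable_on_subcbox) simp
qed

lemma integral_block:
  assumes l: "l \<in> {1..N-1}" and Q: "Q \<in> sets lebesgue" "Q \<subseteq> \<Omega>"
  shows "(\<integral>x. indicator Q x *\<^sub>R u l x \<partial>\<mu>) = integral Q (u0 l) /\<^sub>R measure lebesgue \<Omega>"
    and "integrable \<mu> (\<lambda>x. indicator Q x *\<^sub>R u l x)"
proof -
  interpret prob_space \<mu> by (rule prob_space_mu)
  have Qm: "Q \<in> sets \<mu>" "Q \<in> sets (lebesgue_on \<Omega>)" using Q by (auto simp: in_sets_mu sets_mu[symmetric])
  have m: "(\<lambda>x. indicator Q x *\<^sub>R u l x) \<in> borel_measurable \<mu>"
    using u_mu[OF l] Qm(1) by measurable
  have i: "integrable (lebesgue_on \<Omega>) (\<lambda>x. indicator Q x *\<^sub>R u l x)"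
    using integrable_mult_indicator[OF Qm(2) u_integrable[OF l]] .
  show "integrable \<mu> (\<lambda>x. indicator Q x *\<^sub>R u l x)"
    using bound(3)[OF l] bound(1)
    by (intro integrable_const_bound[where B = bound] AE_I2 m) (auto simp: space_mu indicator_def)
  have "(\<integral>x. indicator Q x *\<^sub>R u l x \<partial>\<mu>) = (\<integral>x. indicator Q x *\<^sub>R u l x \<partial>lebesgue_on \<Omega>) /\<^sub>R measure lebesgue \<Omega>"
    by (rule integral_mu[OF m])
  also have "(\<integral>x. indicator Q x *\<^sub>R u l x \<partial>lebesgue_on \<Omega>) = integral \<Omega> (\<lambda>x. indicator Q x *\<^sub>R u l x)"
    using domain_lmeasurable by (intro lebesgue_integral_eq_integral i) (simp add: fmeasurableD)
  also have "\<dots> = integral \<Omega> (\<lambda>x. if x \<in> Q then u0 l x else 0)"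
    by (rule integral_cong) (auto simp: indicator_def)
  also have "\<dots> = integral (Q \<inter> \<Omega>) (u0 l)" by (rule Henstock_Kurzweil_Integration.integral_restrict_Int)
  finally show "(\<integral>x. indicator Q x *\<^sub>R u l x \<partial>\<mu>) = integral Q (u0 l) /\<^sub>R measure lebesgue \<Omega>"
    using Q(2) by (simp add: Int_absorb2)
qed

lemma eventually_disjoint_cubes_in_domain:
  assumes "\<And>j. j < N \<Longrightarrow> y j \<in> \<Omega>" "inj_on y {..<N}"
  shows "eventually (\<lambda>h. (\<forall>j\<in>{..<N}. corner_cube (y j) h \<subseteq> \<Omega>) \<and>
    disjoint_family_on (\<lambda>j. corner_cube (y j) h) {..<N}) (at_right 0)"
  unfolding disjoint_family_on_def
proof (intro eventually_conj eventually_ball_finite ballI)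
  fix j assume "j \<in> {..<N}"
  then show "eventually (\<lambda>h. corner_cube (y j) h \<subseteq> \<Omega>) (at_right 0)"
    by (intro corner_cube_eventually_subset open_domain assms) auto
next
  fix i j assume ij: "i \<in> {..<N}" "j \<in> {..<N}"
  show "eventually (\<lambda>h. i \<noteq> j \<longrightarrow> corner_cube (y i) h \<inter> corner_cube (y j) h = {}) (at_right 0)"
  proof (cases "i = j")
    case False
    then have "y i \<noteq> y j" using ij inj_onD[OF assms(2)] by blast
    from hausdorff[OF this] obtain U V where UV: "open U" "open V" "y i \<in> U" "y j \<in> V" "U \<inter> V = {}"
      by (elim exE conjE)
    show ?thesis
      using corner_cube_eventually_subset[OF UV(1,3)] corner_cube_eventually_subset[OF UV(2,4)]
      by eventually_elim (use UV(5) in blast)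
  qed simp
qed auto

text \<open>
  The displacement of the \<open>j\<close>-th cube is the constant \<open>y\<^sub>j - y\<^sub>j\<^sub>+\<^sub>l\<close>, so the polar integral of the rotation
  of cubes of side \<open>h\<close> involves \<open>u\<close> only through its averages over the cubes. Dividing by \<open>h ^ DIM('a)\<close> and
  letting \<open>h\<close> tend to \<open>0\<close> gives the claim.
\<close>

lemma polar_at_distinct_points:
  assumes polar: "\<And>S. S \<in> N_periodic_maps N \<mu> \<Longrightarrow> polar_integral S \<ge> 0"
    and y: "\<And>j. j < N \<Longrightarrow> y j \<in> \<Omega>" "inj_on y {..<N}"
    and avg: "\<And>j l. j < N \<Longrightarrow> l \<in> {1..N-1} \<Longrightarrow>
      ((\<lambda>h. integral (corner_cube (y j) h) (u0 l) /\<^sub>R h ^ DIM('a)) \<longlongrightarrow> u l (y j)) (at_right 0)"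
  shows "(\<Sum>j<N. \<Sum>l=1..N-1. u l (y j) \<bullet> (y j - y ((j + l) mod N))) \<ge> 0"
proof -
  define F where "F h = (\<Sum>j<N. \<Sum>l=1..N-1.
      (integral (corner_cube (y j) h) (u0 l) /\<^sub>R h ^ DIM('a)) \<bullet> (y j - y ((j + l) mod N)))" for h
  have nonneg: "F h \<ge> 0" if h: "0 < h" and inside: "\<forall>j\<in>{..<N}. corner_cube (y j) h \<subseteq> \<Omega>"
    and disjoint: "disjoint_family_on (\<lambda>j. corner_cube (y j) h) {..<N}" for h
  proof -
    define C where "C = cbox 0 (h *\<^sub>R (One :: 'a))"
    have Q: "(+) (y j) ` C = corner_cube (y j) h" for j
      using cbox_translation[of "y j" 0 "h *\<^sub>R One"] by (simp add: C_def)
    have C: "C \<in> sets lebesgue" by (simp add: C_def)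
    have blocks: "\<And>j. j < N \<Longrightarrow> (+) (y j) ` C \<subseteq> \<Omega>" unfolding Q using inside by blast
    have disj: "disjoint_family_on (\<lambda>j. (+) (y j) ` C) {..<N}" unfolding Q by (rule disjoint)
    let ?S = "block_rotation y C"
    have S: "?S \<in> N_periodic_maps N \<mu>" by (rule block_rotation_periodic[OF C blocks disj])
    have Qs: "(+) (y j) ` C \<in> sets lebesgue" for j by (simp add: Q)
    have int: "integrable \<mu> (\<lambda>x. (indicator ((+) (y j) ` C) x *\<^sub>R u l x) \<bullet> (y j - y ((j + l) mod N)))"
      if "j < N" "l \<in> {1..N-1}" for j l
      by (intro integrable_inner_left impI integral_block(2)[OF that(2) Qs blocks[OF that(1)]])
    have "polar_integral ?S = (\<integral>x. (\<Sum>j<N. \<Sum>l=1..N-1.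
        (indicator ((+) (y j) ` C) x *\<^sub>R u l x) \<bullet> (y j - y ((j + l) mod N))) \<partial>\<mu>)"
      unfolding polar_integral_def
      by (rule Bochner_Integration.integral_cong[OF refl])
         (use block_rotation_displacement[OF C blocks disj] in \<open>auto simp: space_mu\<close>)
    also have "\<dots> = (\<Sum>j<N. \<Sum>l=1..N-1. \<integral>x. (indicator ((+) (y j) ` C) x *\<^sub>R u l x) \<bullet> (y j - y ((j + l) mod N)) \<partial>\<mu>)"
    proof (subst Bochner_Integration.integral_sum)
      show "integrable \<mu> (\<lambda>x. \<Sum>l=1..N-1. (indicator ((+) (y j) ` C) x *\<^sub>R u l x) \<bullet> (y j - y ((j + l) mod N)))"
        if "j \<in> {..<N}" for j
        using that by (intro Bochner_Integration.integrable_sum int) auto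
      show "(\<Sum>j<N. \<integral>x. (\<Sum>l=1..N-1. (indicator ((+) (y j) ` C) x *\<^sub>R u l x) \<bullet> (y j - y ((j + l) mod N))) \<partial>\<mu>)
        = (\<Sum>j<N. \<Sum>l=1..N-1. \<integral>x. (indicator ((+) (y j) ` C) x *\<^sub>R u l x) \<bullet> (y j - y ((j + l) mod N)) \<partial>\<mu>)"
        by (intro sum.cong refl Bochner_Integration.integral_sum int) auto
    qed
    also have "\<dots> = (\<Sum>j<N. \<Sum>l=1..N-1. (integral (corner_cube (y j) h) (u0 l) /\<^sub>R measure lebesgue \<Omega>) \<bullet> (y j - y ((j + l) mod N)))"
    proof (intro sum.cong refl)
      fix j l assume jl: "j \<in> {..<N}" "l \<in> {1..N-1}"
      then have b: "(+) (y j) ` C \<subseteq> \<Omega>" using blocks by auto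
      show "(\<integral>x. (indicator ((+) (y j) ` C) x *\<^sub>R u l x) \<bullet> (y j - y ((j + l) mod N)) \<partial>\<mu>)
        = (integral (corner_cube (y j) h) (u0 l) /\<^sub>R measure lebesgue \<Omega>) \<bullet> (y j - y ((j + l) mod N))"
        unfolding integral_inner_left[OF integral_block(2)[OF jl(2) Qs b]] integral_block(1)[OF jl(2) Qs b]
        by (simp only: Q)
    qed
    also have "\<dots> = (h ^ DIM('a) / measure lebesgue \<Omega>) * F h"
      unfolding F_def sum_distrib_left
      by (intro sum.cong refl) (use h in \<open>simp add: field_simps\<close>)
    finally have "(h ^ DIM('a) / measure lebesgue \<Omega>) * F h \<ge> 0" using polar[OF S] by simp
    moreover have "0 < h ^ DIM('a) / measure lebesgue \<Omega>" using h domain_measure_pos by simp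
    ultimately show ?thesis by (metis linorder_not_le mult_pos_neg)
  qed
  have "eventually (\<lambda>h. ((\<forall>j\<in>{..<N}. corner_cube (y j) h \<subseteq> \<Omega>) \<and>
      disjoint_family_on (\<lambda>j. corner_cube (y j) h) {..<N}) \<and> 0 < h) (at_right 0)"
    by (rule eventually_conj[OF eventually_disjoint_cubes_in_domain eventually_at_right_less]) (use y in auto)
  then have "eventually (\<lambda>h. F h \<ge> 0) (at_right 0)"
    by (rule eventually_mono) (use nonneg in blast)
  moreover have "(F \<longlongrightarrow> (\<Sum>j<N. \<Sum>l=1..N-1. u l (y j) \<bullet> (y j - y ((j + l) mod N)))) (at_right 0)"
    unfolding F_def by (intro tendsto_sum tendsto_inner avg tendsto_const) auto
  ultimately show ?thesis by (intro tendsto_lowerbound[of F _ "at_right 0"]) auto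
qed

lemma cube_averages:
  obtains Z where "negligible Z" "\<And>x l. x \<in> \<Omega> - Z \<Longrightarrow> l \<in> {1..N-1} \<Longrightarrow>
      ((\<lambda>h. integral (corner_cube x h) (u0 l) /\<^sub>R h ^ DIM('a)) \<longlongrightarrow> u l x) (at_right 0)"
proof -
  define average where "average l h x = integral (corner_cube x h) (u0 l) /\<^sub>R h ^ DIM('a)" for l h x
  define good where "good l x \<longleftrightarrow> (\<forall>e>0. \<exists>d>0. \<forall>h. 0 < h \<and> h < d \<longrightarrow> norm (average l h x - u0 l x) < e)" for l x
  have "\<forall>l\<in>{1..N-1}. \<exists>Z. negligible Z \<and> (\<forall>x. x \<notin> Z \<longrightarrow> good l x)"
  proof
    fix l assume l: "l \<in> {1..N-1}"
    show "\<exists>Z. negligible Z \<and> (\<forall>x. x \<notin> Z \<longrightarrow> good l x)"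
      unfolding good_def average_def
      by (rule integrable_ccontinuous_explicit[OF u0_integrable_on[OF l]]) blast
  qed
  from bchoice[OF this] obtain Z where Z: "\<And>l. l \<in> {1..N-1} \<Longrightarrow> negligible (Z l)"
    "\<And>l x. l \<in> {1..N-1} \<Longrightarrow> x \<notin> Z l \<Longrightarrow> good l x"
    by blast
  show ?thesis
  proof (rule that[of "\<Union>l\<in>{1..N-1}. Z l"])
    show "negligible (\<Union>l\<in>{1..N-1}. Z l)" using Z(1) by (intro negligible_Union) auto
    fix x l assume x: "x \<in> \<Omega> - (\<Union>l\<in>{1..N-1}. Z l)" and l: "l \<in> {1..N-1}"
    show "((\<lambda>h. integral (corner_cube x h) (u0 l) /\<^sub>R h ^ DIM('a)) \<longlongrightarrow> u l x) (at_right 0)"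
    proof (rule tendstoI)
      fix e :: real assume "e > 0"
      have "x \<notin> Z l" using x l by blast
      then have "good l x" by (rule Z(2)[OF l])
      with \<open>e > 0\<close> obtain d where d: "d > 0" "\<And>h. 0 < h \<Longrightarrow> h < d \<Longrightarrow> norm (average l h x - u0 l x) < e"
        unfolding good_def by blast
      have "eventually (\<lambda>h. h \<in> {0<..<d}) (at_right 0)" using d(1) by (rule eventually_at_right_real)
      then show "eventually (\<lambda>h. dist (integral (corner_cube x h) (u0 l) /\<^sub>R h ^ DIM('a)) (u l x) < e) (at_right 0)"
        by (rule eventually_mono) (use d(2) x in \<open>auto simp: average_def dist_norm\<close>)
    qed
  qed
qed

text \<open>
  All fields are handled at once as a single map into the product space, which is second countable.
\<close>

lemma fields_approximately_continuous:
  assumes "c > 0"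
  obtains Z where "negligible Z" "\<And>x \<epsilon>. x \<in> \<Omega> - Z \<Longrightarrow> \<epsilon> > 0 \<Longrightarrow>
    meets_small_cubes c x {y \<in> \<Omega>. \<forall>l\<in>{1..N-1}. norm (u l y - u l x) < \<epsilon>}"
proof -
  define U :: "'a \<Rightarrow> nat \<Rightarrow> 'a" where "U x l = (if l \<in> {1..N-1} then u l x else 0)" for x l
  have U: "U \<in> borel_measurable (lebesgue_on \<Omega>)"
  proof (rule measurable_coordinatewise_then_product)
    fix l show "(\<lambda>x. U x l) \<in> borel_measurable (lebesgue_on \<Omega>)"
      using u_measurable by (cases "l \<in> {1..N-1}") (auto simp: U_def)
  qed
  have dom: "\<Omega> \<in> sets lebesgue" using domain_lmeasurable by (simp add: fmeasurableD)
  obtain Z where Z: "negligible Z" "\<And>x B. x \<in> \<Omega> - Z \<Longrightarrow> open B \<Longrightarrow> U x \<in> B \<Longrightarrow> meets_small_cubes c x {y \<in> \<Omega>. U y \<in> B}"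
    using approximate_continuity[OF dom U assms] by blast
  show ?thesis
  proof (rule that[OF Z(1)])
    fix x \<epsilon> assume x: "x \<in> \<Omega> - Z" and "\<epsilon> > (0::real)"
    define B where "B = (\<Inter>l\<in>{1..N-1}. {v :: nat \<Rightarrow> 'a. norm (v l - u l x) < \<epsilon>})"
    have "open B"
      unfolding B_def
      by (intro open_INT ballI open_Collect_less continuous_on_norm continuous_on_diff
          continuous_on_product_coordinates continuous_on_const) auto
    moreover have "U x \<in> B" using \<open>\<epsilon> > 0\<close> by (auto simp: B_def U_def)
    ultimately have "meets_small_cubes c x {y \<in> \<Omega>. U y \<in> B}" by (rule Z(2)[OF x])
    then show "meets_small_cubes c x {y \<in> \<Omega>. \<forall>l\<in>{1..N-1}. norm (u l y - u l x) < \<epsilon>}"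
      by (rule meets_small_cubes_mono) (auto simp: B_def U_def)
  qed
qed

text \<open>
  Points that are not distinct are approximated by distinct ones: the sets of nearby points with
  nearby field values are not negligible, hence infinite, so an injective choice exists.
\<close>

theorem monotone_if_polar:
  assumes polar: "\<And>S. S \<in> N_periodic_maps N \<mu> \<Longrightarrow> polar_integral S \<ge> 0"
  obtains Z where "negligible Z" "sub_antisymmetric N (\<Omega> - Z) (field_form N u)"
proof -
  obtain Z1 where Z1: "negligible Z1" "\<And>x l. x \<in> \<Omega> - Z1 \<Longrightarrow> l \<in> {1..N-1} \<Longrightarrow>
      ((\<lambda>h. integral (corner_cube x h) (u0 l) /\<^sub>R h ^ DIM('a)) \<longlongrightarrow> u l x) (at_right 0)"
    using cube_averages by blast
  obtain Z2 where Z2: "negligible Z2" "\<And>x \<epsilon>. x \<in> \<Omega> - Z2 \<Longrightarrow> \<epsilon> > 0 \<Longrightarrow>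
    meets_small_cubes 1 x {y \<in> \<Omega>. \<forall>l\<in>{1..N-1}. norm (u l y - u l x) < \<epsilon>}"
    using fields_approximately_continuous[of 1] by auto
  define A where "A = \<Omega> - (Z1 \<union> Z2)"
  have neg: "negligible (Z1 \<union> Z2)" using Z1 Z2 by simp
  have distinct: "cyclic_sum N (field_form N u) x \<le> 0" if x: "x \<in> pow_set A N" "inj_on x {1..N}" for x
  proof -
    have xA: "x (j + 1) \<in> A" if "j < N" for j using x(1) that by (auto simp: PiE_def Pi_def)
    have "(\<Sum>j<N. \<Sum>l=1..N-1. u l (x (j + 1)) \<bullet> (x (j + 1) - x ((j + l) mod N + 1))) \<ge> 0"
    proof (rule polar_at_distinct_points[OF polar, where y = "\<lambda>j. x (j + 1)"])
      show "inj_on (\<lambda>j. x (j + 1)) {..<N}"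
      proof (rule inj_onI)
        fix i j assume "i \<in> {..<N}" "j \<in> {..<N}" "x (i + 1) = x (j + 1)"
        then show "i = j" using inj_onD[OF x(2), of "i + 1" "j + 1"] by simp
      qed
    qed (use xA Z1(2) in \<open>auto simp: A_def\<close>)
    then have "- (\<Sum>j<N. \<Sum>l=1..N-1. u l (x (j + 1)) \<bullet> (x ((j + l) mod N + 1) - x (j + 1))) \<ge> 0"
      by (simp add: sum_negf[symmetric] inner_diff_right)
    then show ?thesis by (simp add: cyclic_sum_field_form[OF x(1) N1])
  qed
  have "cyclic_sum N (field_form N u) x \<le> 0" if x: "x \<in> pow_set A N" for x
  proof -
    have xA: "x j \<in> A" if "j \<in> {1..N}" for j using x that by (auto simp: PiE_def)
    define B where "B n j = {y \<in> A. \<forall>l\<in>{1..N-1}. norm (u l y - u l (x j)) < 1 / Suc n} \<inter> ball (x j) (1 / Suc n)" for n j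
    have "infinite (B n j)" if "j \<in> {1..N}" for n j
    proof -
      have "meets_small_cubes 1 (x j) {y \<in> \<Omega>. \<forall>l\<in>{1..N-1}. norm (u l y - u l (x j)) < 1 / Suc n}"
        using xA[OF that] by (intro Z2(2)) (auto simp: A_def)
      from meets_small_cubes_Diff[OF this neg]
      have "meets_small_cubes 1 (x j) {y \<in> A. \<forall>l\<in>{1..N-1}. norm (u l y - u l (x j)) < 1 / Suc n}"
        by (rule meets_small_cubes_mono) (auto simp: A_def)
      from meets_small_cubes_near[OF this, of "1 / Suc n"] have "\<not> negligible (B n j)"
        by (simp add: B_def)
      then show ?thesis using negligible_finite by blast
    qed
    then have "\<forall>n. \<exists>y. inj_on y {1..N} \<and> (\<forall>j\<in>{1..N}. y j \<in> B n j)"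
      by (intro allI injective_choice_of_infinite)
    from choice[OF this] obtain y where y: "\<And>n. inj_on (y n) {1..N}" "\<And>n j. j \<in> {1..N} \<Longrightarrow> y n j \<in> B n j"
      by blast
    define a where "a n = (\<lambda>j\<in>{1..N}. y n j)" for n
    have a: "a n \<in> pow_set A N" for n using y(2) by (auto simp: a_def B_def)
    show ?thesis
    proof (rule cyclic_sum_field_form_limit[where a = a and u = u, OF N1 x a])
      show "cyclic_sum N (field_form N u) (a n) \<le> 0" for n
        using y(1)[of n] by (intro distinct a) (simp only: a_def inj_on_restrict_eq)
      show "(\<lambda>n. a n j) \<longlonglongrightarrow> x j" if j: "j \<in> {1..N}" for j
        using y(2)[OF j] j by (intro LIMSEQ_if_dist_less_inverse) (auto simp: a_def B_def dist_commute)
      show "(\<lambda>n. u l (a n j)) \<longlonglongrightarrow> u l (x j)" if j: "j \<in> {1..N}" and l: "l \<in> {1..N-1}" for j l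
        using y(2)[OF j] j l by (intro LIMSEQ_if_dist_less_inverse) (auto simp: a_def B_def dist_norm)
    qed
  qed
  then show ?thesis using that[OF neg] by (simp add: sub_antisymmetric_iff A_def)
qed

end

section \<open>Continuity of bounded saddle functions\<close>

text \<open>
  The slope from the centre of the ball is compared with the slopes to the two antipodal points \<open>x + e\<close>
  and \<open>x - e\<close> on its boundary sphere. The constant depends only on the bound and the radius, which
  is what joint continuity in several variables needs.
\<close>

lemma convex_on_center_estimate:
  fixes g :: "'a::real_normed_vector \<Rightarrow> real"
  assumes g: "convex_on S g" and r: "r > 0" "cball x r \<subseteq> S" and M: "\<And>z. z \<in> S \<Longrightarrow> \<bar>g z\<bar> \<le> M"
    and z: "dist z x \<le> r"
  shows "\<bar>g z - g x\<bar> \<le> 2 * M / r * dist z x"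
proof (cases "z = x")
  case False
  define t where "t = dist z x / r"
  have t: "0 < t" "t \<le> 1" using False r z by (auto simp: t_def)
  define e where "e = (z - x) /\<^sub>R t"
  have ne: "norm e = r" using t r False by (simp add: e_def t_def dist_norm)
  have xin: "x \<in> S" and v: "x + e \<in> S" and w: "x - e \<in> S" and zin: "z \<in> S"
    using r ne z by (auto intro!: subsetD[OF r(2)] simp: dist_norm norm_minus_commute)
  have z_eq: "z = (1 - t) *\<^sub>R x + t *\<^sub>R (x + e)" using t by (simp add: e_def algebra_simps)
  have "g z \<le> (1 - t) * g x + t * g (x + e)"
    using convex_onD[OF g _ _ xin v, of t] t unfolding z_eq[symmetric] by simp
  then have up: "g z - g x \<le> t * (g (x + e) - g x)" by (simp add: algebra_simps)
  \<comment> \<open>the weight that writes \<open>x\<close> as a convex combination of \<open>z\<close> and \<open>x - e\<close>\<close>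
  define s where "s = t / (1 + t)"
  have s: "0 \<le> s" "s \<le> 1" "(1 - s) * (1 + t) = 1" "s * (1 + t) = t" using t by (auto simp: s_def field_simps)
  have "(1 + t) *\<^sub>R ((1 - s) *\<^sub>R z + s *\<^sub>R (x - e)) = ((1 - s) * (1 + t)) *\<^sub>R z + (s * (1 + t)) *\<^sub>R (x - e)"
    by (simp add: algebra_simps)
  also have "\<dots> = z + t *\<^sub>R (x - e)" by (simp only: s scaleR_one)
  also have "\<dots> = (1 + t) *\<^sub>R x" using t by (simp add: e_def algebra_simps)
  finally have x_eq: "(1 - s) *\<^sub>R z + s *\<^sub>R (x - e) = x" using t by simp
  have "g x \<le> (1 - s) * g z + s * g (x - e)"
    using convex_onD[OF g s(1,2) zin w] by (simp only: x_eq)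
  then have "(1 + t) * g x \<le> (1 + t) * ((1 - s) * g z + s * g (x - e))"
    using t by (intro mult_left_mono) auto
  also have "\<dots> = ((1 - s) * (1 + t)) * g z + (s * (1 + t)) * g (x - e)" by (simp add: algebra_simps)
  also have "\<dots> = g z + t * g (x - e)" by (simp only: s mult_1)
  finally have lo: "g x - g z \<le> t * (g (x - e) - g x)" by (simp add: algebra_simps)
  have "g (x + e) - g x \<le> 2 * M" using M[OF v] M[OF xin] by linarith
  moreover have "g (x - e) - g x \<le> 2 * M" using M[OF w] M[OF xin] by linarith
  ultimately have "t * (g (x + e) - g x) \<le> t * (2 * M)" "t * (g (x - e) - g x) \<le> t * (2 * M)"
    using t(1) by (simp_all only: mult_left_mono less_imp_le)
  moreover have "2 * M / r * dist z x = t * (2 * M)" by (simp add: t_def)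
  ultimately show ?thesis using up lo by linarith
qed simp

text \<open>
  One coordinate is moved at a time from \<open>x\<close> to \<open>y\<close>, always starting from the centre \<open>x\<^sub>j\<close> of its ball.
\<close>

lemma coordinatewise_estimate:
  fixes H :: "(nat \<Rightarrow> 'a::real_normed_vector) \<Rightarrow> real"
  assumes cc: "\<And>x j. x \<in> pow_set \<Omega> N \<Longrightarrow> j \<in> {1..N} \<Longrightarrow>
      convex_on \<Omega> (\<lambda>z. H (x(j := z))) \<or> concave_on \<Omega> (\<lambda>z. H (x(j := z)))"
    and M: "\<And>x. x \<in> pow_set \<Omega> N \<Longrightarrow> \<bar>H x\<bar> \<le> M"
    and x: "x \<in> pow_set \<Omega> N" and y: "y \<in> pow_set \<Omega> N" and r: "r > 0"
    and ball: "\<And>j. j \<in> {1..N} \<Longrightarrow> cball (x j) r \<subseteq> \<Omega>" and close: "\<And>j. j \<in> {1..N} \<Longrightarrow> dist (y j) (x j) \<le> r"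
  shows "\<bar>H y - H x\<bar> \<le> (\<Sum>j=1..N. 2 * M / r * dist (y j) (x j))"
proof -
  define m where "m k = (\<lambda>j. if j \<le> k then y j else x j)" for k
  have m_in: "m k \<in> pow_set \<Omega> N" for k
    using x y by (auto simp: m_def PiE_def Pi_def extensional_def)
  have "\<bar>H (m k) - H x\<bar> \<le> (\<Sum>j=1..k. 2 * M / r * dist (y j) (x j))" if "k \<le> N" for k
    using that
  proof (induction k)
    case 0
    have "m 0 = x" using x y by (auto simp: m_def fun_eq_iff PiE_def extensional_def)
    then show ?case by simp
  next
    case (Suc k)
    have j: "Suc k \<in> {1..N}" using Suc.prems by auto
    define g where "g z = H ((m k)(Suc k := z))" for z
    have g1: "g (y (Suc k)) = H (m (Suc k))"
      unfolding g_def by (rule arg_cong[of _ _ H]) (auto simp: m_def fun_eq_iff le_Suc_eq)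
    have g0: "g (x (Suc k)) = H (m k)"
      unfolding g_def by (rule arg_cong[of _ _ H]) (auto simp: m_def fun_eq_iff)
    have gM: "\<bar>g z\<bar> \<le> M" if "z \<in> \<Omega>" for z
      unfolding g_def by (intro M coordinate_update_in_pow_set[OF j m_in that])
    have "\<bar>g (y (Suc k)) - g (x (Suc k))\<bar> \<le> 2 * M / r * dist (y (Suc k)) (x (Suc k))"
    proof (cases "convex_on \<Omega> g")
      case True
      then show ?thesis by (rule convex_on_center_estimate[OF _ r ball[OF j] gM close[OF j]])
    next
      case False
      then have "convex_on \<Omega> (\<lambda>z. - g z)"
        using cc[OF m_in j, of k] by (auto simp: g_def[abs_def] concave_on_def)
      from convex_on_center_estimate[OF this r ball[OF j] _ close[OF j], of M] gM
      show ?thesis by simp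
    qed
    then show ?case using Suc by (simp add: g0 g1)
  qed
  from this[of N] show ?thesis
  proof -
    have "m N = y" using x y by (auto simp: m_def fun_eq_iff PiE_def extensional_def)
    then show ?thesis using \<open>N \<le> N \<Longrightarrow> _\<close> by simp
  qed
qed

lemma continuous_on_pow_set_if_coordinatewise:
  fixes H :: "(nat \<Rightarrow> 'a::euclidean_space) \<Rightarrow> real"
  assumes "open \<Omega>"
    and cc: "\<And>x j. x \<in> pow_set \<Omega> N \<Longrightarrow> j \<in> {1..N} \<Longrightarrow>
      convex_on \<Omega> (\<lambda>z. H (x(j := z))) \<or> concave_on \<Omega> (\<lambda>z. H (x(j := z)))"
    and M: "\<And>x. x \<in> pow_set \<Omega> N \<Longrightarrow> \<bar>H x\<bar> \<le> M"
  shows "continuous_on (pow_set \<Omega> N) H"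
  unfolding continuous_on_def
proof
  fix x assume x: "x \<in> pow_set \<Omega> N"
  have "\<exists>e>0. cball (x j) e \<subseteq> \<Omega>" if "j \<in> {1..N}" for j
  proof -
    have "x j \<in> \<Omega>" using x that by (auto simp: PiE_def)
    then show ?thesis using assms(1) open_contains_cball by blast
  qed
  then obtain e where e: "\<And>j. j \<in> {1..N} \<Longrightarrow> e j > 0 \<and> cball (x j) (e j) \<subseteq> \<Omega>" by metis
  define r where "r = Min (insert 1 (e ` {1..N}))"
  have r: "r > 0" unfolding r_def using e by (subst Min_gr_iff) auto
  have ball: "cball (x j) r \<subseteq> \<Omega>" if "j \<in> {1..N}" for j
  proof -
    have "r \<le> e j" unfolding r_def using that by (intro Min_le) auto
    then show ?thesis using e[OF that] subset_cball[of r "e j" "x j"] by blast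
  qed
  let ?F = "at x within pow_set \<Omega> N"
  have coord: "((\<lambda>y. y j) \<longlongrightarrow> x j) ?F" for j
    using continuous_on_subset[OF continuous_on_product_coordinates, of "pow_set \<Omega> N" j] x
    by (auto simp: continuous_on_def)
  have d: "((\<lambda>y. dist (y j) (x j)) \<longlongrightarrow> 0) ?F" for j
    by (rule tendsto_dist_iff[THEN iffD1, OF coord])
  have "((\<lambda>y. \<Sum>j=1..N. 2 * M / r * dist (y j) (x j)) \<longlongrightarrow> (\<Sum>j=1..N. 2 * M / r * 0)) ?F"
    by (intro tendsto_sum tendsto_mult d tendsto_const)
  then have lim: "((\<lambda>y. \<Sum>j=1..N. 2 * M / r * dist (y j) (x j)) \<longlongrightarrow> 0) ?F" by simp
  have "eventually (\<lambda>y. \<forall>j\<in>{1..N}. dist (y j) (x j) < r) ?F"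
    using r by (intro eventually_ball_finite ballI order_tendstoD(2)[OF d]) auto
  moreover have "eventually (\<lambda>y. y \<in> pow_set \<Omega> N) ?F" by (simp add: eventually_at_filter)
  ultimately have "eventually (\<lambda>y. norm (H y - H x) \<le> (\<Sum>j=1..N. 2 * M / r * dist (y j) (x j))) ?F"
  proof eventually_elim
    case (elim y)
    then show ?case
      using coordinatewise_estimate[OF cc M x _ r ball, of y] by (auto simp: less_imp_le)
  qed
  from Lim_null_comparison[OF this lim] show "(H \<longlongrightarrow> H x) ?F" by (simp add: LIM_zero_iff)
qed

lemma continuous_on_cyclic_shift_pow: "continuous_on (pow_set A N) (cyclic_shift N ^^ i)"
proof (induction i)
  case (Suc i)
  have "continuous_on UNIV (\<lambda>x. cyclic_shift N x j :: 'a)" for j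
  proof -
    have "(\<lambda>x :: nat \<Rightarrow> 'a. cyclic_shift N x j) =
        (if j \<in> {1..N} then if j = N then (\<lambda>x. x 1) else (\<lambda>x. x (j + 1)) else (\<lambda>x. undefined))"
      by (auto simp: cyclic_shift_def fun_eq_iff)
    then show ?thesis
      by (simp only: split: if_split)
         (intro conjI impI continuous_on_product_coordinates continuous_on_const)
  qed
  then have "continuous_on UNIV (cyclic_shift N :: (nat \<Rightarrow> 'a) \<Rightarrow> _)"
    by (rule continuous_on_coordinatewise_then_product)
  from continuous_on_compose[OF Suc continuous_on_subset[OF this]] show ?case
    by (simp only: funpow.simps subset_UNIV)
qed (simp add: id_def)

text \<open>
  The cyclic sum is shift invariant, so subtracting its mean cancels it exactly.
\<close>

lemma antisymmetrization:
  fixes H :: "(nat \<Rightarrow> 'a::topological_space) \<Rightarrow> real"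
  assumes "N \<ge> 1" "continuous_on (pow_set \<Omega> N) H"
  shows "(\<lambda>x. H x - cyclic_sum N H x / N) \<in> antisym_hamiltonians N \<Omega>"
proof -
  have "continuous_on (pow_set \<Omega> N) (\<lambda>x. H ((cyclic_shift N ^^ i) x))" for i
    by (rule continuous_on_compose2[OF assms(2) continuous_on_cyclic_shift_pow])
      (rule image_subsetI, rule cyclic_shift_pow_in_pow_set)
  then have "continuous_on (pow_set \<Omega> N) (\<lambda>x. \<Sum>i=0..N-1. H ((cyclic_shift N ^^ i) x))"
    by (intro continuous_on_sum)
  then have "continuous_on (pow_set \<Omega> N) (\<lambda>x. H x - cyclic_sum N H x / N)"
    unfolding cyclic_sum_def using assms(1)
    by (intro continuous_on_diff[OF assms(2)] continuous_on_divide continuous_on_const) auto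
  moreover have "cyclic_sum N (\<lambda>x. H x - cyclic_sum N H x / N) x = 0" if "x \<in> pow_set \<Omega> N" for x
    using cyclic_sum_linear[of N 1 H "- 1 / N" "cyclic_sum N H" x] cyclic_sum_cyclic_sum[OF that assms(1), of H] assms(1)
    by simp
  ultimately show ?thesis by (simp add: antisym_hamiltonians_def cyclic_sum_def)
qed

section \<open>Integrals of extended real functions\<close>

lemma ereal_integral_mono:
  assumes "AE x in M. f x \<le> g x"
  shows "ereal_integral M f \<le> ereal_integral M g"
  unfolding ereal_integral_def
proof (rule ereal_minus_mono)
  have "(\<integral>\<^sup>+x. e2ennreal (f x) \<partial>M) \<le> (\<integral>\<^sup>+x. e2ennreal (g x) \<partial>M)"
    using assms by (intro nn_integral_mono_AE) (auto elim!: eventually_mono intro: e2ennreal_mono)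
  then show "enn2ereal (\<integral>\<^sup>+x. e2ennreal (f x) \<partial>M) \<le> enn2ereal (\<integral>\<^sup>+x. e2ennreal (g x) \<partial>M)"
    by (simp add: less_eq_ennreal.rep_eq)
  have "(\<integral>\<^sup>+x. e2ennreal (- g x) \<partial>M) \<le> (\<integral>\<^sup>+x. e2ennreal (- f x) \<partial>M)"
    using assms by (intro nn_integral_mono_AE) (auto elim!: eventually_mono intro: e2ennreal_mono)
  then show "enn2ereal (\<integral>\<^sup>+x. e2ennreal (- g x) \<partial>M) \<le> enn2ereal (\<integral>\<^sup>+x. e2ennreal (- f x) \<partial>M)"
    by (simp add: less_eq_ennreal.rep_eq)
qed

lemma ereal_integral_eq_integral:
  fixes g :: "'a \<Rightarrow> real"
  assumes "integrable M g"
  shows "ereal_integral M (\<lambda>x. ereal (g x)) = ereal (integral\<^sup>L M g)"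
proof -
  have fin: "(\<integral>\<^sup>+x. ennreal (g x) \<partial>M) \<noteq> \<infinity>" "(\<integral>\<^sup>+x. ennreal (- g x) \<partial>M) \<noteq> \<infinity>"
    using assms by (auto simp: real_integrable_def)
  have e: "enn2ereal a = ereal (enn2real a)" if "a \<noteq> \<infinity>" for a
    using that by (cases a) auto
  show ?thesis
    unfolding ereal_integral_def real_lebesgue_integral_def[OF assms]
    by (simp add: e[OF fin(1)] e[OF fin(2)])
qed

section \<open>The saddle Hamiltonian of a monotone tuple\<close>

context bounded_fields
begin

lemma cofull_dense:
  assumes "negligible Z"
  shows "\<Omega> \<subseteq> closure (\<Omega> - Z)"
proof
  fix x assume x: "x \<in> \<Omega>"
  show "x \<in> closure (\<Omega> - Z)"
    unfolding closure_approachable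
  proof (intro allI impI)
    fix e :: real assume "e > 0"
    then have "\<not> negligible (\<Omega> \<inter> ball x e)"
      using x open_domain by (intro open_not_negligible) auto
    then have "\<not> \<Omega> \<inter> ball x e \<subseteq> Z" using assms negligible_subset by blast
    then show "\<exists>y\<in>\<Omega> - Z. dist y x < e" by (auto simp: dist_commute)
  qed
qed

text \<open>
  The fields are first extended from the set \<open>A\<close> of full measure on which they are monotone and
  approximately continuous. The last two properties, boundedness and domination of \<open>F\<^sub>u\<close>, are
  recorded for the duality.
\<close>

theorem saddle_hamiltonian:
  assumes Z: "negligible Z" and mono: "sub_antisymmetric N (\<Omega> - Z) (field_form N u)"
  obtains H M where "admissible N \<Omega> H" "concave_first N \<Omega> H"
    "\<And>x. x \<in> \<Omega> \<Longrightarrow> H (diag N x) = 0"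
    "\<And>x. x \<in> pow_set \<Omega> N \<Longrightarrow> concavification_last N \<Omega> (proper_cyclic_sum N H) x = ereal (- H x)"
    "AE x in \<mu>. has_gradient_last N \<Omega> H x (\<lambda>l. u l x)"
    "\<And>x. x \<in> pow_set \<Omega> N \<Longrightarrow> \<bar>H x\<bar> \<le> M"
    "AE x in \<mu>. \<forall>y\<in>pow_set \<Omega> N. y 1 = x \<longrightarrow> field_form N u y \<le> H y"
proof -
  obtain Z2 where Z2: "negligible Z2" "\<And>x \<epsilon>. x \<in> \<Omega> - Z2 \<Longrightarrow> \<epsilon> > 0 \<Longrightarrow>
    meets_small_cubes (1 / (4 * DIM('a))) x {y \<in> \<Omega>. \<forall>l\<in>{1..N-1}. norm (u l y - u l x) < \<epsilon>}"
    using fields_approximately_continuous[of "1 / (4 * DIM('a))"] by auto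
  define A where "A = \<Omega> - (Z \<union> Z2)"
  have neg: "negligible (Z \<union> Z2)" using Z Z2(1) by simp
  have dense: "\<Omega> \<subseteq> closure A" unfolding A_def by (rule cofull_dense[OF neg])
  have monoA: "sub_antisymmetric N A (field_form N u)"
    unfolding sub_antisymmetric_iff
  proof
    fix x assume "x \<in> pow_set A N"
    then have "x \<in> pow_set (\<Omega> - Z) N" by (auto simp: A_def PiE_def Pi_def)
    then show "cyclic_sum N (field_form N u) x \<le> 0" using mono by (simp add: sub_antisymmetric_iff)
  qed
  have bdA: "bounded (u l ` A)" if "l \<in> {1..N-1}" for l
    by (rule bounded_subset[OF u_bounded[OF that]]) (auto simp: A_def)
  have "A \<subseteq> \<Omega>" by (auto simp: A_def)
  from jointly_monotone_extension[OF N1 this dense monoA bdA]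
  obtain w where w: "\<And>l x. x \<in> A \<Longrightarrow> w l x = u l x" "\<And>l. l \<in> {1..N-1} \<Longrightarrow> bounded (w l ` \<Omega>)"
    "sub_antisymmetric N \<Omega> (field_form N w)"
    by blast
  have admw: "admissible N \<Omega> (field_form N w)"
    using w(3) convex_last_field_form[OF N1] by (auto simp: admissible_def)
  obtain H where H: "admissible N \<Omega> H" "\<And>x. x \<in> pow_set \<Omega> N \<Longrightarrow> field_form N w x \<le> H x"
    "\<And>x. x \<in> pow_set \<Omega> N \<Longrightarrow> concavification_last N \<Omega> (proper_cyclic_sum N H) x = ereal (- H x)"
    using self_dual_saddle[OF convex_domain N1 admw] by blast
  have subH: "sub_antisymmetric N \<Omega> H" using H(1) by (simp add: admissible_def)
  have concave: "concave_first N \<Omega> H"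
    using H(1) by (intro concave_first_if_self_dual[OF convex_domain N1 _ H(3)]) (auto simp: admissible_def)
  have diag: "H (diag N x) = 0" if "x \<in> \<Omega>" for x by (rule zero_on_diag[OF N1 that subH H(2)])
  obtain C where C: "0 \<le> C" "\<And>x. x \<in> \<Omega> \<Longrightarrow> norm x \<le> C"
    "\<And>l x. l \<in> {1..N-1} \<Longrightarrow> x \<in> \<Omega> \<Longrightarrow> norm (w l x) \<le> C"
    using common_bound[where w = w and N = N, OF bounded_domain w(2)] by blast
  define B where "B = real N * (C * (2 * C))"
  have B: "\<bar>field_form N w x\<bar> \<le> B" if "x \<in> pow_set \<Omega> N" for x
    unfolding B_def by (rule field_form_le[OF N1 that C])
  have HM: "\<bar>H x\<bar> \<le> real N * B" if x: "x \<in> pow_set \<Omega> N" for x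
  proof -
    have B0: "0 \<le> B" using C(1) by (simp add: B_def)
    have "- (real (N - 1) * B) = (\<Sum>i=1..N-1. - B)" by simp
    also have "\<dots> \<le> proper_cyclic_sum N (field_form N w) x"
      unfolding proper_cyclic_sum_def
    proof (rule sum_mono)
      fix i
      show "- B \<le> field_form N w ((cyclic_shift N ^^ i) x)"
        using B[OF cyclic_shift_pow_in_pow_set[OF x], of i] by linarith
    qed
    also have "\<dots> \<le> proper_cyclic_sum N H x" by (rule proper_cyclic_sum_mono[OF H(2) x])
    also have "\<dots> \<le> - H x" by (rule proper_cyclic_sum_le[OF N1 subH x])
    finally have "H x \<le> real (N - 1) * B" by simp
    also have "\<dots> \<le> real N * B" using B0 by (intro mult_right_mono) auto
    finally have up: "H x \<le> real N * B" .
    have "- (real N * B) \<le> - B" using B0 N1 mult_right_mono[of 1 "real N" B] by simp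
    also have "\<dots> \<le> H x" using B[OF x] H(2)[OF x] by linarith
    finally show ?thesis using up by linarith
  qed
  have grad: "has_gradient_last N \<Omega> H x (\<lambda>l. u l x)" if x: "x \<in> A" for x
  proof -
    have "has_gradient_last N \<Omega> H x (\<lambda>l. w l x)"
    proof (rule has_gradient_last_at_approximate_continuity[OF N1 convex_domain _ H(1,2)])
      show "x \<in> \<Omega>" using x by (simp add: A_def)
      fix \<epsilon> :: real assume "\<epsilon> > 0"
      have "meets_small_cubes (1 / (4 * DIM('a))) x {y \<in> \<Omega>. \<forall>l\<in>{1..N-1}. norm (u l y - u l x) < \<epsilon>}"
        using x \<open>\<epsilon> > 0\<close> by (intro Z2(2)) (auto simp: A_def)
      from meets_small_cubes_Diff[OF this neg]
      show "meets_small_cubes (1 / (4 * DIM('a))) x {y \<in> \<Omega>. \<forall>l\<in>{1..N-1}. norm (w l y - w l x) < \<epsilon>}"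
        by (rule meets_small_cubes_mono) (use w(1) x in \<open>auto simp: A_def\<close>)
    qed
    then show ?thesis using w(1)[OF x] by simp
  qed
  have below: "field_form N u y \<le> H y" if "y \<in> pow_set \<Omega> N" "y 1 \<in> A" for y
  proof -
    have "field_form N u y = field_form N w y" unfolding field_form_def using w(1)[OF that(2)] by simp
    then show ?thesis using H(2)[OF that(1)] by simp
  qed
  have AE: "AE x in \<mu>. P x" if "\<And>x. x \<in> A \<Longrightarrow> P x" for P
    unfolding AE_mu_iff using neg that by (intro exI[of _ "Z \<union> Z2"]) (auto simp: A_def)
  show ?thesis
    by (rule that[OF H(1) concave diag H(3) AE[OF grad] HM AE]) (use below in auto)
qed

lemma monotone_if_gradient:
  assumes "sub_antisymmetric N \<Omega> H" "convex_last N \<Omega> H" "\<And>x. x \<in> \<Omega> \<Longrightarrow> H (diag N x) = 0"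
    and grad: "AE x in \<mu>. has_gradient_last N \<Omega> H x (\<lambda>l. u l x)"
  obtains Z where "negligible Z" "sub_antisymmetric N (\<Omega> - Z) (field_form N u)"
proof -
  obtain Z where Z: "negligible Z" "\<And>x. x \<in> \<Omega> - Z \<Longrightarrow> has_gradient_last N \<Omega> H x (\<lambda>l. u l x)"
    using grad unfolding AE_mu_iff by blast
  have le: "field_form N u y \<le> H y" if y: "y \<in> pow_set (\<Omega> - Z) N" for y
  proof -
    have "y 1 \<in> \<Omega> - Z" "y \<in> pow_set \<Omega> N" using y N1 by (auto simp: PiE_def Pi_def)
    then show ?thesis
      by (intro field_form_le_if_gradient[OF N1 convex_domain _ assms(2) assms(3) Z(2)]) auto
  qed
  have "sub_antisymmetric N (\<Omega> - Z) (field_form N u)"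
    unfolding sub_antisymmetric_iff
  proof
    fix x assume x: "x \<in> pow_set (\<Omega> - Z) N"
    have "cyclic_sum N (field_form N u) x \<le> cyclic_sum N H x"
      unfolding cyclic_sum_def by (intro sum_mono le cyclic_shift_pow_in_pow_set[OF x])
    also have "\<dots> \<le> 0"
    proof -
      have "x \<in> pow_set \<Omega> N" using x by (auto simp: PiE_def Pi_def)
      then show ?thesis using assms(1) by (simp add: sub_antisymmetric_iff)
    qed
    finally show "cyclic_sum N (field_form N u) x \<le> 0" .
  qed
  then show ?thesis by (rule that[OF Z(1)])
qed

section \<open>Duality with antisymmetric Hamiltonians\<close>

lemma correlation_integrand:
  "integrable \<mu> (\<lambda>x. \<Sum>l=1..N-1. u l x \<bullet> x)" "correlation id = (\<integral>x. (\<Sum>l=1..N-1. u l x \<bullet> x) \<partial>\<mu>)"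
proof -
  have "integrable \<mu> (\<lambda>x. \<Sum>l=1..N-1. u l x \<bullet> (id ^^ l) x)"
    by (intro Bochner_Integration.integrable_sum integrable_inner_iterate id_periodic)
  then show "integrable \<mu> (\<lambda>x. \<Sum>l=1..N-1. u l x \<bullet> x)" by simp
qed (simp add: correlation_def)

lemma legendre_last_ge:
  assumes "x \<in> \<Omega>" "H (diag N x) = 0"
  shows "ereal (\<Sum>l=1..N-1. u l x \<bullet> x) \<le> legendre_last N \<Omega> H x (\<lambda>l. u l x)"
proof -
  have d: "diag N x \<in> {y \<in> pow_set \<Omega> N. y 1 = x}"
    using diag_in_pow_set[OF assms(1), of N] N1 by (auto simp: diag_def)
  have "(\<Sum>l=1..N-1. u l x \<bullet> x) = (\<Sum>l=1..N-1. u l x \<bullet> diag N x (l + 1)) - H (diag N x)"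
    using assms(2) by (auto simp: diag_def intro!: sum.cong)
  then show ?thesis
    unfolding legendre_last_def
    using SUP_upper[OF d, of "\<lambda>y. ereal ((\<Sum>i=1..N-1. u i x \<bullet> y (i + 1)) - H y)"] by simp
qed

lemma legendre_last_le:
  assumes "\<And>y. y \<in> pow_set \<Omega> N \<Longrightarrow> y 1 = x \<Longrightarrow> field_form N u y \<le> H y"
  shows "legendre_last N \<Omega> H x (\<lambda>l. u l x) \<le> ereal (\<Sum>l=1..N-1. u l x \<bullet> x)"
  unfolding legendre_last_def
proof (rule SUP_least)
  fix y assume y: "y \<in> {y \<in> pow_set \<Omega> N. y 1 = x}"
  then have y1: "y 1 = x" by blast
  have "field_form N u y \<le> H y" using y by (intro assms) auto
  then have "(\<Sum>l=1..N-1. u l x \<bullet> y (l + 1)) - (\<Sum>l=1..N-1. u l x \<bullet> x) \<le> H y"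
    unfolding field_form_def y1 inner_diff_right sum_subtractf .
  then show "ereal ((\<Sum>l=1..N-1. u l x \<bullet> y (l + 1)) - H y) \<le> ereal (\<Sum>l=1..N-1. u l x \<bullet> x)" by simp
qed

lemma antisym_hamiltonian_diag:
  assumes "H \<in> antisym_hamiltonians N \<Omega>" "x \<in> \<Omega>"
  shows "H (diag N x) = 0"
proof -
  have "real N * H (diag N x) = cyclic_sum N H (diag N x)"
    using N1 by (simp add: cyclic_sum_lessThan cyclic_shift_pow_diag)
  also have "\<dots> = 0"
    using assms(1) diag_in_pow_set[OF assms(2), of N] by (auto simp: antisym_hamiltonians_def cyclic_sum_def)
  finally show ?thesis using N1 by simp
qed

text \<open>
  The lower bound tests the Legendre transform at the diagonal point. It is attained by the
  antisymmetrized saddle function, which lies above \<open>H\<close> because \<open>H\<close> is sub-antisymmetric.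
\<close>

lemma legendre_duality:
  assumes "negligible Z" "sub_antisymmetric N (\<Omega> - Z) (field_form N u)"
  shows "(INF H\<in>antisym_hamiltonians N \<Omega>. ereal_integral \<mu> (\<lambda>x. legendre_last N \<Omega> H x (\<lambda>l. u l x)))
    = ereal (correlation id)"
proof (rule antisym)
  let ?g = "\<lambda>x. \<Sum>l=1..N-1. u l x \<bullet> x"
  have g: "ereal_integral \<mu> (\<lambda>x. ereal (?g x)) = ereal (correlation id)"
    unfolding correlation_integrand(2) by (rule ereal_integral_eq_integral[OF correlation_integrand(1)])
  show "ereal (correlation id) \<le>
      (INF H\<in>antisym_hamiltonians N \<Omega>. ereal_integral \<mu> (\<lambda>x. legendre_last N \<Omega> H x (\<lambda>l. u l x)))"
    unfolding g[symmetric]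
  proof (rule INF_greatest, rule ereal_integral_mono, rule AE_I2)
    fix H x assume "H \<in> antisym_hamiltonians N \<Omega>" "x \<in> space \<mu>"
    then show "ereal (?g x) \<le> legendre_last N \<Omega> H x (\<lambda>l. u l x)"
      by (intro legendre_last_ge antisym_hamiltonian_diag) (auto simp: space_mu)
  qed
  obtain H M where H: "admissible N \<Omega> H" "concave_first N \<Omega> H"
      "\<And>x. x \<in> \<Omega> \<Longrightarrow> H (diag N x) = 0"
      "\<And>x. x \<in> pow_set \<Omega> N \<Longrightarrow> concavification_last N \<Omega> (proper_cyclic_sum N H) x = ereal (- H x)"
      "AE x in \<mu>. has_gradient_last N \<Omega> H x (\<lambda>l. u l x)"
      "\<And>x. x \<in> pow_set \<Omega> N \<Longrightarrow> \<bar>H x\<bar> \<le> M"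
      "AE x in \<mu>. \<forall>y\<in>pow_set \<Omega> N. y 1 = x \<longrightarrow> field_form N u y \<le> H y"
    by (rule saddle_hamiltonian[OF assms]) (rule that)
  have "continuous_on (pow_set \<Omega> N) H"
  proof (rule continuous_on_pow_set_if_coordinatewise[OF open_domain _ H(6)])
    fix x j assume x: "x \<in> pow_set \<Omega> N" and j: "j \<in> {1..N}"
    show "convex_on \<Omega> (\<lambda>z. H (x(j := z))) \<or> concave_on \<Omega> (\<lambda>z. H (x(j := z)))"
    proof (cases "j = 1")
      case True
      then show ?thesis using H(2) x unfolding concave_first_def by blast
    next
      case False
      then have "j \<in> {2..N}" using j by auto
      then show ?thesis
        using H(1) convex_last_coordinate[OF convex_domain _ x] unfolding admissible_def by blast
    qed
  qed
  then have anti: "(\<lambda>x. H x - cyclic_sum N H x / N) \<in> antisym_hamiltonians N \<Omega>" (is "?H \<in> _")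
    by (rule antisymmetrization[OF N1])
  have above: "H y \<le> ?H y" if "y \<in> pow_set \<Omega> N" for y
  proof -
    have "cyclic_sum N H y \<le> 0" using H(1) that by (simp add: admissible_def sub_antisymmetric_iff)
    then show ?thesis by (simp add: divide_nonpos_nonneg)
  qed
  have "AE x in \<mu>. legendre_last N \<Omega> ?H x (\<lambda>l. u l x) \<le> ereal (?g x)"
    using H(7)
  proof (rule eventually_mono)
    fix x assume x: "\<forall>y\<in>pow_set \<Omega> N. y 1 = x \<longrightarrow> field_form N u y \<le> H y"
    show "legendre_last N \<Omega> ?H x (\<lambda>l. u l x) \<le> ereal (?g x)"
    proof (rule legendre_last_le)
      fix y assume y: "y \<in> pow_set \<Omega> N" "y 1 = x"
      then have "field_form N u y \<le> H y" using x by blast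
      then show "field_form N u y \<le> ?H y" using above[OF y(1)] by linarith
    qed
  qed
  from ereal_integral_mono[OF this]
  have "ereal_integral \<mu> (\<lambda>x. legendre_last N \<Omega> ?H x (\<lambda>l. u l x)) \<le> ereal (correlation id)"
    unfolding g .
  then show "(INF H\<in>antisym_hamiltonians N \<Omega>. ereal_integral \<mu> (\<lambda>x. legendre_last N \<Omega> H x (\<lambda>l. u l x)))
      \<le> ereal (correlation id)"
    by (rule INF_lower2[OF anti])
qed

end

section \<open>The equivalences\<close>

theorem theorem7:
  fixes N :: nat
    and \<Omega> :: "(real ^ 'd) set"
    and \<mu> :: "(real ^ 'd) measure"
    and u :: "nat \<Rightarrow> real ^ 'd \<Rightarrow> real ^ 'd"
  assumes "N \<ge> 2"
    and "\<Omega> \<noteq> {}" "open \<Omega>" "connected \<Omega>"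
    and "bounded \<Omega>" "convex \<Omega>"
    and "frontier \<Omega> \<in> null_sets lebesgue"
    and "\<mu> = normalized_lebesgue \<Omega>"
    and "\<And>l. l \<in> {1..N-1} \<Longrightarrow> u l \<in> borel_measurable (lebesgue_on \<Omega>)"
    and "\<And>l. l \<in> {1..N-1} \<Longrightarrow> bounded (u l ` \<Omega>)"
  shows
   "let
      p1 = (\<exists>\<Omega>\<^sub>0 \<in> null_sets lebesgue. jointly_monotone_on N (\<Omega> - \<Omega>\<^sub>0) u);
      cost = (\<lambda>\<pi>. \<integral>x. (\<Sum>l=1..N-1. u l (x 1) \<bullet> (x 1 - x (l + 1))) \<partial>\<pi>);
      \<pi>\<^sub>0 = distr \<mu> (Pi\<^sub>M {1..N} (\<lambda>_. \<mu>)) (diag N);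
      p2 = ((INF \<pi>\<in>sym_plans N \<mu>. ereal (cost \<pi>)) = 0 \<and>
            \<pi>\<^sub>0 \<in> sym_plans N \<mu> \<and> cost \<pi>\<^sub>0 = 0);
      p3 = ((INF S\<in>N_periodic_maps N \<mu>.
               ereal (\<integral>x. (\<Sum>l=1..N-1. u l x \<bullet> (x - (S ^^ l) x)) \<partial>\<mu>)) = 0);
      p4 = ((INF S\<in>N_periodic_maps N \<mu>.
               ereal (\<integral>x. (\<Sum>l=1..N-1. (norm (u l x - (S ^^ l) x))\<^sup>2) \<partial>\<mu>))
            = ereal (\<Sum>l=1..N-1. \<integral>x. (norm (u l x - x))\<^sup>2 \<partial>\<mu>));
      p5 = (\<exists>H :: (nat \<Rightarrow> real ^ 'd) \<Rightarrow> real.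
              sub_antisymmetric N \<Omega> H \<and> concave_first N \<Omega> H \<and> convex_last N \<Omega> H \<and>
              (\<forall>x\<in>\<Omega>. H (diag N x) = 0) \<and>
              (AE x in \<mu>. has_gradient_last N \<Omega> H x (\<lambda>l. u l x)) \<and>
              (\<forall>x\<in>pow_set \<Omega> N.
                 ereal (H x) +
                 concavification_last N \<Omega>
                   (\<lambda>z. \<Sum>i=1..N-1. H ((cyclic_shift N ^^ i) z)) x = 0));
      p6 = ((INF H\<in>antisym_hamiltonians N \<Omega>.
               ereal_integral \<mu> (\<lambda>x. legendre_last N \<Omega> H x (\<lambda>l. u l x)))
            = (SUP S\<in>N_periodic_maps N \<mu>.
                 ereal (\<integral>x. (\<Sum>l=1..N-1. u l x \<bullet> (S ^^ l) x) \<partial>\<mu>)) \<and>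
            id \<in> N_periodic_maps N \<mu> \<and>
            (SUP S\<in>N_periodic_maps N \<mu>.
               ereal (\<integral>x. (\<Sum>l=1..N-1. u l x \<bullet> (S ^^ l) x) \<partial>\<mu>))
            = ereal (\<integral>x. (\<Sum>l=1..N-1. u l x \<bullet> (id ^^ l) x) \<partial>\<mu>))
    in (p1 \<longleftrightarrow> p2) \<and> (p1 \<longleftrightarrow> p3) \<and> (p1 \<longleftrightarrow> p4) \<and> (p1 \<longleftrightarrow> p5) \<and> (p1 \<longleftrightarrow> p6)"
proof -
  interpret bounded_fields N \<Omega> \<mu> u
    by unfold_locales (use assms in auto)
  define polar where "polar \<longleftrightarrow> (\<forall>S\<in>N_periodic_maps N \<mu>. polar_integral S \<ge> 0)"
  define p1 where "p1 \<longleftrightarrow> (\<exists>\<Omega>\<^sub>0 \<in> null_sets lebesgue. jointly_monotone_on N (\<Omega> - \<Omega>\<^sub>0) u)"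
  define cost where "cost = (\<lambda>\<pi>. \<integral>x. (\<Sum>l=1..N-1. u l (x 1) \<bullet> (x 1 - x (l + 1))) \<partial>\<pi>)"
  define \<pi>\<^sub>0 where "\<pi>\<^sub>0 = distr \<mu> (Pi\<^sub>M {1..N} (\<lambda>_. \<mu>)) (diag N)"
  define p2 where "p2 \<longleftrightarrow> (INF \<pi>\<in>sym_plans N \<mu>. ereal (cost \<pi>)) = 0 \<and>
            \<pi>\<^sub>0 \<in> sym_plans N \<mu> \<and> cost \<pi>\<^sub>0 = 0"
  define p5 where "p5 \<longleftrightarrow> (\<exists>H :: (nat \<Rightarrow> real ^ 'd) \<Rightarrow> real.
              sub_antisymmetric N \<Omega> H \<and> concave_first N \<Omega> H \<and> convex_last N \<Omega> H \<and>
              (\<forall>x\<in>\<Omega>. H (diag N x) = 0) \<and>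
              (AE x in \<mu>. has_gradient_last N \<Omega> H x (\<lambda>l. u l x)) \<and>
              (\<forall>x\<in>pow_set \<Omega> N. ereal (H x) + concavification_last N \<Omega> (proper_cyclic_sum N H) x = 0))"
  define p6 where "p6 \<longleftrightarrow> (INF H\<in>antisym_hamiltonians N \<Omega>.
               ereal_integral \<mu> (\<lambda>x. legendre_last N \<Omega> H x (\<lambda>l. u l x)))
            = (SUP S\<in>N_periodic_maps N \<mu>. ereal (correlation S)) \<and>
            id \<in> N_periodic_maps N \<mu> \<and>
            (SUP S\<in>N_periodic_maps N \<mu>. ereal (correlation S)) = ereal (correlation id)"
  have p1_iff: "p1 \<longleftrightarrow> (\<exists>Z. negligible Z \<and> sub_antisymmetric N (\<Omega> - Z) (field_form N u))"
    unfolding p1_def jointly_monotone_on_iff_sub_antisymmetric[OF N1] negligible_iff_null_sets by blast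
  have cost_eq: "cost = (\<lambda>\<pi>. \<integral>x. - field_form N u x \<partial>\<pi>)"
    unfolding cost_def field_form_sum_negated ..
  have p1_p2: p2 if p1
    using that monge_kantorovich_if_monotone unfolding p1_iff p2_def \<pi>\<^sub>0_def cost_eq by blast
  have p2_polar: polar if p2
    using that polar_if_monge_kantorovich unfolding p2_def cost_eq polar_def by blast
  have polar_p1: p1 if polar
  proof -
    obtain Z where "negligible Z" "sub_antisymmetric N (\<Omega> - Z) (field_form N u)"
      by (rule monotone_if_polar) (use \<open>polar\<close> in \<open>auto simp: polar_def\<close>)
    then show ?thesis unfolding p1_iff by blast
  qed
  have p1_polar: "p1 \<longleftrightarrow> polar" using p1_p2 p2_polar polar_p1 by blast
  have p5_p1: p1 if p5
  proof -
    obtain H where "sub_antisymmetric N \<Omega> H" "convex_last N \<Omega> H" "\<And>x. x \<in> \<Omega> \<Longrightarrow> H (diag N x) = 0"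
      "AE x in \<mu>. has_gradient_last N \<Omega> H x (\<lambda>l. u l x)"
      using \<open>p5\<close> unfolding p5_def by blast
    then obtain Z where "negligible Z" "sub_antisymmetric N (\<Omega> - Z) (field_form N u)"
      by (rule monotone_if_gradient)
    then show ?thesis unfolding p1_iff by blast
  qed
  have p1_p5: p5 if p1
  proof -
    obtain Z where "negligible Z" "sub_antisymmetric N (\<Omega> - Z) (field_form N u)"
      using \<open>p1\<close> unfolding p1_iff by blast
    then obtain H M where H: "admissible N \<Omega> H" "concave_first N \<Omega> H"
      "\<And>x. x \<in> \<Omega> \<Longrightarrow> H (diag N x) = 0"
      "\<And>x. x \<in> pow_set \<Omega> N \<Longrightarrow> concavification_last N \<Omega> (proper_cyclic_sum N H) x = ereal (- H x)"
      "AE x in \<mu>. has_gradient_last N \<Omega> H x (\<lambda>l. u l x)"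
      "\<And>x. x \<in> pow_set \<Omega> N \<Longrightarrow> \<bar>H x\<bar> \<le> M"
      "AE x in \<mu>. \<forall>y\<in>pow_set \<Omega> N. y 1 = x \<longrightarrow> field_form N u y \<le> H y"
      by (rule saddle_hamiltonian) (rule that)
    have "ereal (H x) + concavification_last N \<Omega> (proper_cyclic_sum N H) x = 0"
      if "x \<in> pow_set \<Omega> N" for x
      unfolding H(4)[OF that] by (simp add: zero_ereal_def)
    then show ?thesis using H unfolding p5_def admissible_def by (intro exI[of _ H]) blast
  qed
  have p1_p6: p6 if p1
  proof -
    obtain Z where "negligible Z" "sub_antisymmetric N (\<Omega> - Z) (field_form N u)"
      using \<open>p1\<close> unfolding p1_iff by blast
    note inf = legendre_duality[OF this]
    have sup: "(SUP S\<in>N_periodic_maps N \<mu>. ereal (correlation S)) = ereal (correlation id)"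
      using \<open>p1\<close> unfolding SUP_correlation_iff_polar p1_polar polar_def .
    show ?thesis unfolding p6_def inf sup using id_periodic by blast
  qed
  have p6_p1: p1 if p6
    using that unfolding p1_polar p6_def SUP_correlation_iff_polar polar_def by blast
  have "p1 = p2" using p1_p2 p2_polar polar_p1 by blast
  moreover have "p1 \<longleftrightarrow> (INF S\<in>N_periodic_maps N \<mu>. ereal (polar_integral S)) = 0"
    unfolding polar_iff_INF p1_polar polar_def ..
  moreover have "p1 \<longleftrightarrow> (INF S\<in>N_periodic_maps N \<mu>.
               ereal (\<integral>x. (\<Sum>l=1..N-1. (norm (u l x - (S ^^ l) x))\<^sup>2) \<partial>\<mu>))
            = ereal (\<Sum>l=1..N-1. \<integral>x. (norm (u l x - x))\<^sup>2 \<partial>\<mu>)"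
    unfolding quadratic_iff_polar p1_polar polar_def ..
  moreover have "p1 = p5" using p1_p5 p5_p1 by blast
  moreover have "p1 = p6" using p1_p6 p6_p1 by blast
  ultimately show ?thesis
    unfolding Let_def p1_def p2_def p5_def p6_def cost_def \<pi>\<^sub>0_def polar_integral_def correlation_def
      proper_cyclic_sum_def[abs_def]
    by (intro conjI)
qed

end
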